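(* Let $I=(0,1)$ or $I=(0,\infty)$, and let $E,F$ be Banach ideal spaces on $I$ such that $F$ has the Fatou property, $E^{( * )}\ne\{0\}$ and $F^{( * )}\neq\{0\}$ are normable spaces, the operator $D_2$ is bounded on $F^{\downarrow}$, $(F')^{( * )}\neq\{0\}$ and $((E\odot F')')^{( * )}\neq\{0\}$. Assume that the following conditions hold: (i) The operator $H^*$ is bounded on the spaces $F$ and $E\odot F'$. (ii) For some $r>0$, the operator $H_r^*$ is bounded on $E$ and on $F'$, and there are constants $C_E,C_{F'}$ such that $\|H_rx^*\|_E\le C_E\|x^*\|_E$ for all $x^*\in E$ and $\|H_rx^*\|_{F'}\le C_{F'}\|x^*\|_{F'}$ for all $x^*\in F'$. Then $$M(E^{( * )},F^{( * )})=M(E,F)^{( * )}$$ (equal as sets, with equivalent (quasi-)norms).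
   Context: $I=(0,1)$ or $(0,\infty)$ with Lebesgue measure $m$; $L^0(I)$ is the space of (classes of) real measurable functions on $I$. A (quasi-)normed ideal space $E$ on $I$ is a linear subspace of $L^0(I)$ with a (quasi-)norm such that $y\in E$, $x\in L^0$, $|x|\le|y|$ a.e. imply $x\in E$ and $\|x\|_E\le\|y\|_E$; a Banach ideal space is a complete normed one. Such spaces are always assumed to have a weak unit (an element positive a.e. on $I$). $E$ has the Fatou property if $0\le x_n\uparrow x\in L^0$, $x_n\in E$, $\sup_n\|x_n\|_E<\infty$ imply $x\in E$ and $\|x_n\|_E\uparrow\|x\|_E$. A quasi-normed space is normable if it carries a norm equivalent to its quasi-norm. $x^*(t)=\inf\{\lambda>0: m\{|x|>\lambda\}\le t\}$ is the nonincreasing rearrangement. The symmetrization of $E$ is $E^{( * )}=\{x\in L^0(I):x^*\in E\}$ with functional $\|x\|_{E^{( * )}}=\|x^*\|_E$. $E^{\downarrow}$ is the cone of all $x\in E$ with $x=x^*$. "For all $x^*\in E$" means for all $x\in L^0(I)$ with $x^*\in E$. Dilation operator: $D_2x(t)=x(t/2)$, $t\in I$; bounded on $F^{\downarrow}$ means $\|D_2x\|_F\le A\|x\|_F$ for all $x\in F^{\downarrow}$ and some $A<\infty$. Köthe dual: $E'=\{x\in L^0(I):\|x\|_{E'}=\sup_{\|y\|_E\le1}\int_I|xy|\,dt<\infty\}$. Product space: $E\odot F=\{xy:x\in E,y\in F\}$ with quasi-norm $\|u\|_{E\odot F}=\inf\{\|x\|_E\|y\|_F:u=xy,\,x\in E,\,y\in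 F\}$. Multipliers: $M(E,F)=\{x\in L^0(I):xy\in F\text{ for each }y\in E\}$ with $\|x\|_{M(E,F)}=\sup_{\|y\|_E=1}\|xy\|_F$. With $l=m(I)$: $Hx(t)=\frac1t\int_0^tx(s)\,ds$, $H^*x(t)=\int_t^l\frac{x(s)}s\,ds$, and for $r>0$, $H_rx=[H(|x|^r)]^{1/r}$, $H_r^*x=[H^*(|x|^r)]^{1/r}$. An operator $T$ among these is bounded on a space $X$ if $Tx\in X$ and $\|Tx\|_X\le C\|x\|_X$ for all $x\in X$ and some constant $C$. *)

theory Defs
  imports "HOL-Analysis.Analysis"
begin

text \<open>
  Throughout, \<open>I\<close> is the underlying interval. An element of \<open>L\<^sup>0(I)\<close> is represented by a function
  \<open>real \<Rightarrow> real\<close>; only its values on \<open>I\<close>, up to null sets, are relevant.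
\<close>

abbreviation leb :: "real set \<Rightarrow> real measure" where
  "leb I \<equiv> lebesgue_on I"

definition L0 :: "real set \<Rightarrow> (real \<Rightarrow> real) set" where
  "L0 I = borel_measurable (leb I)"

text \<open>
  The norm takes values in \<open>ennreal\<close> so that suprema and infima are always meaningful; it is
  required to be finite on the elements of a (quasi-)normed space. Its values outside \<open>elts\<close>
  carry no meaning.
\<close>

record fspace =
  elts :: "(real \<Rightarrow> real) set"
  fnorm :: "(real \<Rightarrow> real) \<Rightarrow> ennreal"

text \<open>The third clause of the definition says that both components are well defined on a.e.-equivalence classes.\<close>

definition quasi_normed_with :: "real set \<Rightarrow> fspace \<Rightarrow> real \<Rightarrow> bool" where
  "quasi_normed_with I X K \<longleftrightarrow>
     elts X \<subseteq> L0 I \<and>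
     (\<lambda>_. 0) \<in> elts X \<and>
     (\<forall>x\<in>elts X. \<forall>y\<in>L0 I. (AE t in leb I. x t = y t) \<longrightarrow>
        y \<in> elts X \<and> fnorm X y = fnorm X x) \<and>
     (\<forall>x\<in>elts X. \<forall>y\<in>elts X. (\<lambda>t. x t + y t) \<in> elts X) \<and>
     (\<forall>x\<in>elts X. \<forall>c::real. (\<lambda>t. c * x t) \<in> elts X) \<and>
     (\<forall>x\<in>elts X. fnorm X x < \<infinity>) \<and>
     (\<forall>x\<in>elts X. fnorm X x = 0 \<longleftrightarrow> (AE t in leb I. x t = 0)) \<and>
     (\<forall>x\<in>elts X. \<forall>c::real. fnorm X (\<lambda>t. c * x t) = ennreal \<bar>c\<bar> * fnorm X x) \<and>
     (\<forall>x\<in>elts X. \<forall>y\<in>elts X.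
        fnorm X (\<lambda>t. x t + y t) \<le> ennreal K * (fnorm X x + fnorm X y))"

definition quasi_normed_space :: "real set \<Rightarrow> fspace \<Rightarrow> bool" where
  "quasi_normed_space I X \<longleftrightarrow> (\<exists>K\<ge>1. quasi_normed_with I X K)"

definition normed_space :: "real set \<Rightarrow> fspace \<Rightarrow> bool" where
  "normed_space I X \<longleftrightarrow> quasi_normed_with I X 1"

definition is_ideal :: "real set \<Rightarrow> fspace \<Rightarrow> bool" where
  "is_ideal I X \<longleftrightarrow>
     (\<forall>y\<in>elts X. \<forall>x\<in>L0 I. (AE t in leb I. \<bar>x t\<bar> \<le> \<bar>y t\<bar>) \<longrightarrow>
        x \<in> elts X \<and> fnorm X x \<le> fnorm X y)"

definition has_weak_unit :: "real set \<Rightarrow> fspace \<Rightarrow> bool" where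
  "has_weak_unit I X \<longleftrightarrow> (\<exists>e\<in>elts X. AE t in leb I. 0 < e t)"

definition complete_space :: "fspace \<Rightarrow> bool" where
  "complete_space X \<longleftrightarrow>
     (\<forall>u :: nat \<Rightarrow> real \<Rightarrow> real.
        (\<forall>n. u n \<in> elts X) \<and>
        (\<forall>\<epsilon>>0. \<exists>N. \<forall>m\<ge>N. \<forall>n\<ge>N. fnorm X (\<lambda>t. u m t - u n t) < \<epsilon>) \<longrightarrow>
        (\<exists>x\<in>elts X. (\<lambda>n. fnorm X (\<lambda>t. u n t - x t)) \<longlonglongrightarrow> 0))"

definition banach_ideal_space :: "real set \<Rightarrow> fspace \<Rightarrow> bool" where
  "banach_ideal_space I X \<longleftrightarrow>
     normed_space I X \<and> is_ideal I X \<and> has_weak_unit I X \<and> complete_space X"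

definition fatou_property :: "real set \<Rightarrow> fspace \<Rightarrow> bool" where
  "fatou_property I X \<longleftrightarrow>
     (\<forall>(u :: nat \<Rightarrow> real \<Rightarrow> real) x.
        (\<forall>n. u n \<in> elts X) \<and> x \<in> L0 I \<and>
        (AE t in leb I. (\<forall>n. 0 \<le> u n t) \<and> incseq (\<lambda>n. u n t) \<and> (\<lambda>n. u n t) \<longlonglongrightarrow> x t) \<and>
        (SUP n. fnorm X (u n)) < \<infinity> \<longrightarrow>
        x \<in> elts X \<and> incseq (\<lambda>n. fnorm X (u n)) \<and> (\<lambda>n. fnorm X (u n)) \<longlonglongrightarrow> fnorm X x)"

definition nontrivial :: "real set \<Rightarrow> fspace \<Rightarrow> bool" where
  "nontrivial I X \<longleftrightarrow> (\<exists>x\<in>elts X. \<not> (AE t in leb I. x t = 0))"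

text \<open>Equality as sets with equivalent (finite) norms.\<close>

definition equal_spaces :: "fspace \<Rightarrow> fspace \<Rightarrow> bool" where
  "equal_spaces X Y \<longleftrightarrow>
     elts X = elts Y \<and>
     (\<forall>x\<in>elts X. fnorm X x < \<infinity> \<and> fnorm Y x < \<infinity>) \<and>
     (\<exists>c C :: real. 0 < c \<and> 0 < C \<and>
        (\<forall>x\<in>elts X. ennreal c * fnorm X x \<le> fnorm Y x \<and> fnorm Y x \<le> ennreal C * fnorm X x))"

definition normable :: "real set \<Rightarrow> fspace \<Rightarrow> bool" where
  "normable I X \<longleftrightarrow>
     quasi_normed_space I X \<and> (\<exists>Y. normed_space I Y \<and> equal_spaces X Y)"

text \<open>
  The infimum defining \<open>x\<^sup>*(t)\<close> is \<open>+\<infinity>\<close> if no \<open>a > 0\<close> qualifies, which can happen when \<open>I\<close> has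
  infinite measure. Then \<open>x\<^sup>*\<close> is not in \<open>L\<^sup>0(I)\<close>, and the real-valued \<open>Inf\<close> below is
  meaningless; \<open>rearr_finite\<close> excludes this case.
\<close>

definition rearr :: "real set \<Rightarrow> (real \<Rightarrow> real) \<Rightarrow> real \<Rightarrow> real" where
  "rearr I x t = Inf {a. 0 < a \<and> emeasure (leb I) {s\<in>I. a < \<bar>x s\<bar>} \<le> ennreal t}"

definition rearr_finite :: "real set \<Rightarrow> (real \<Rightarrow> real) \<Rightarrow> bool" where
  "rearr_finite I x \<longleftrightarrow>
     (\<forall>t\<in>I. \<exists>a>0. emeasure (leb I) {s\<in>I. a < \<bar>x s\<bar>} \<le> ennreal t)"

definition symmetrization :: "real set \<Rightarrow> fspace \<Rightarrow> fspace" where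
  "symmetrization I X =
     \<lparr> elts = {x\<in>L0 I. rearr_finite I x \<and> rearr I x \<in> elts X},
       fnorm = (\<lambda>x. fnorm X (rearr I x)) \<rparr>"

definition decr_cone :: "real set \<Rightarrow> fspace \<Rightarrow> (real \<Rightarrow> real) set" where
  "decr_cone I X = {x\<in>elts X. rearr_finite I x \<and> (AE t in leb I. x t = rearr I x t)}"

definition koethe_dual :: "real set \<Rightarrow> fspace \<Rightarrow> fspace" where
  "koethe_dual I X =
     (let N = (\<lambda>x. SUP y\<in>{y\<in>elts X. fnorm X y \<le> 1}. \<integral>\<^sup>+ t. ennreal \<bar>x t * y t\<bar> \<partial>leb I)
      in \<lparr> elts = {x\<in>L0 I. N x < \<infinity>}, fnorm = N \<rparr>)"

definition product_space :: "real set \<Rightarrow> fspace \<Rightarrow> fspace \<Rightarrow> fspace" where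
  "product_space I X Y =
     \<lparr> elts = {u\<in>L0 I. \<exists>x\<in>elts X. \<exists>y\<in>elts Y. AE t in leb I. u t = x t * y t},
       fnorm = (\<lambda>u. Inf {fnorm X x * fnorm Y y | x y.
                  x \<in> elts X \<and> y \<in> elts Y \<and> (AE t in leb I. u t = x t * y t)}) \<rparr>"

definition multipliers :: "real set \<Rightarrow> fspace \<Rightarrow> fspace \<Rightarrow> fspace" where
  "multipliers I X Y =
     \<lparr> elts = {x\<in>L0 I. \<forall>y\<in>elts X. (\<lambda>t. x t * y t) \<in> elts Y},
       fnorm = (\<lambda>x. SUP y\<in>{y\<in>elts X. fnorm X y = 1}. fnorm Y (\<lambda>t. x t * y t)) \<rparr>"

definition dil2 :: "(real \<Rightarrow> real) \<Rightarrow> real \<Rightarrow> real" where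
  "dil2 x t = x (t / 2)"

text \<open>
  Lebesgue integrals of non-integrable functions are \<open>0\<close> by convention, so each Hardy-type
  operator comes with a predicate stating that its defining integrals converge.
\<close>

definition hardy_defined :: "real set \<Rightarrow> (real \<Rightarrow> real) \<Rightarrow> bool" where
  "hardy_defined I x \<longleftrightarrow> (\<forall>t\<in>I. set_integrable lebesgue {0<..<t} x)"

definition hardy :: "(real \<Rightarrow> real) \<Rightarrow> real \<Rightarrow> real" where
  "hardy x t = (1 / t) * (LINT s:{0<..<t}|lebesgue. x s)"

definition cohardy_defined :: "real set \<Rightarrow> (real \<Rightarrow> real) \<Rightarrow> bool" where
  "cohardy_defined I x \<longleftrightarrow> (\<forall>t\<in>I. set_integrable lebesgue (I \<inter> {t<..}) (\<lambda>s. x s / s))"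

definition cohardy :: "real set \<Rightarrow> (real \<Rightarrow> real) \<Rightarrow> real \<Rightarrow> real" where
  "cohardy I x t = (LINT s:(I \<inter> {t<..})|lebesgue. x s / s)"

definition hardy_r_defined :: "real set \<Rightarrow> real \<Rightarrow> (real \<Rightarrow> real) \<Rightarrow> bool" where
  "hardy_r_defined I r x \<longleftrightarrow> hardy_defined I (\<lambda>s. \<bar>x s\<bar> powr r)"

definition hardy_r :: "real \<Rightarrow> (real \<Rightarrow> real) \<Rightarrow> real \<Rightarrow> real" where
  "hardy_r r x t = (hardy (\<lambda>s. \<bar>x s\<bar> powr r) t) powr (1 / r)"

definition cohardy_r_defined :: "real set \<Rightarrow> real \<Rightarrow> (real \<Rightarrow> real) \<Rightarrow> bool" where
  "cohardy_r_defined I r x \<longleftrightarrow> cohardy_defined I (\<lambda>s. \<bar>x s\<bar> powr r)"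

definition cohardy_r :: "real set \<Rightarrow> real \<Rightarrow> (real \<Rightarrow> real) \<Rightarrow> real \<Rightarrow> real" where
  "cohardy_r I r x t = (cohardy I (\<lambda>s. \<bar>x s\<bar> powr r) t) powr (1 / r)"

text \<open>
  Boundedness on a subset \<open>S\<close> of \<open>X\<close> of a partially defined operator \<open>T\<close> with domain \<open>D\<close>.
\<close>

definition bounded_on ::
  "((real \<Rightarrow> real) \<Rightarrow> bool) \<Rightarrow> ((real \<Rightarrow> real) \<Rightarrow> real \<Rightarrow> real) \<Rightarrow> (real \<Rightarrow> real) set \<Rightarrow> fspace \<Rightarrow> bool"
where
  "bounded_on D T S X \<longleftrightarrow>
     (\<exists>C::real. \<forall>x\<in>S. D x \<and> T x \<in> elts X \<and> fnorm X (T x) \<le> ennreal C * fnorm X x)"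

definition dil2_bounded :: "real set \<Rightarrow> fspace \<Rightarrow> bool" where
  "dil2_bounded I X \<longleftrightarrow> bounded_on (\<lambda>_. True) dil2 (decr_cone I X) X"

definition cohardy_bounded :: "real set \<Rightarrow> fspace \<Rightarrow> bool" where
  "cohardy_bounded I X \<longleftrightarrow> bounded_on (cohardy_defined I) (cohardy I) (elts X) X"

definition cohardy_r_bounded :: "real set \<Rightarrow> real \<Rightarrow> fspace \<Rightarrow> bool" where
  "cohardy_r_bounded I r X \<longleftrightarrow> bounded_on (cohardy_r_defined I r) (cohardy_r I r) (elts X) X"

text \<open>The set \<open>rearr I ` elts (symmetrization I X)\<close> consists of all \<open>x\<^sup>* \<in> X\<close> with \<open>x \<in> L\<^sup>0(I)\<close>.\<close>

definition hardy_r_bounded_on_rearr :: "real set \<Rightarrow> real \<Rightarrow> fspace \<Rightarrow> bool" where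
  "hardy_r_bounded_on_rearr I r X \<longleftrightarrow>
     bounded_on (hardy_r_defined I r) (hardy_r r) (rearr I ` elts (symmetrization I X)) X"

end

theory Submission
  imports Defs
begin

text \<open>
  If \<open>x\<^sup>*\<close> multiplies \<open>E\<close> into \<open>F\<close>, then \<open>x\<close> multiplies \<open>E\<^sup>(\<^sup>*\<^sup>)\<close> into \<open>F\<^sup>(\<^sup>*\<^sup>)\<close> because
  \<open>(x y)\<^sup>* \<le> D\<^sub>2 (x\<^sup>* y\<^sup>*)\<close>.

  Conversely, let \<open>x\<close> multiply \<open>E\<^sup>(\<^sup>*\<^sup>)\<close> into \<open>F\<^sup>(\<^sup>*\<^sup>)\<close>. For nonincreasing \<open>a \<in> E\<close>, placing the values of
  \<open>a\<close> where \<open>|x|\<close> is large gives \<open>y\<close> with \<open>y\<^sup>* \<le> D\<^sub>2 a\<close> and \<open>x\<^sup>* a \<le> 2 D\<^sub>4 (x y)\<^sup>*\<close>, hence \<open>x\<^sup>* a \<in> F\<close>.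
  For arbitrary \<open>y \<in> E\<close>, the Fatou property gives \<open>F = F''\<close>, so it suffices to bound \<open>\<integral> x\<^sup>* |y g|\<close> for
  \<open>g \<in> F'\<close>. As \<open>x\<^sup>* \<le> H x\<^sup>*\<close>, this integral is at most \<open>\<integral> x\<^sup>* H\<^sup>*|y g|\<close>. The nonincreasing function
  \<open>H\<^sup>*|y g|\<close> lies in \<open>E \<odot> F'\<close>; for any factorization \<open>u v\<close> of it, the Cauchy-Schwarz inequality bounds
  it by a multiple of \<open>D\<^sub>2 (H\<^sub>r\<^sup>* u) D\<^sub>2 (H\<^sub>r\<^sup>* v)\<close>, a product of nonincreasing functions in \<open>E\<close> and \<open>F'\<close>,
  which reduces the claim to the nonincreasing case.
\<close>

subsection \<open>Nonincreasing rearrangements\<close>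

text \<open>The condition on \<open>H_r\<close> enters through one lower bound: if c bounds x* from
  below on (0,d), then \<open>H_r x*\<close> is at least (d/t)^(1/r) c at t >= d. With d = t/2 this
  bounds D_2 on the nonincreasing functions of E and of F'. With d = min(t0,t) it puts a strictly
  positive nonincreasing function into E, which forces x* to be finite for every multiplier x of the
  symmetrizations.

  Two obstacles shape the rest. Such a multiplier is not known beforehand to have finite norm. A
  gliding hump over nonincreasing functions gives a finite but uncontrolled bound K; the passage to
  arbitrary y in E costs a factor independent of x and K, so once the norms are known to be finite
  the argument is run again with K proportional to the norm of x. Moreover, D_2 on F is controlled
  only for functions that agree with their rearrangement, so right-continuity has to be tracked
  wherever D_2 acts in F. In E and F' monotonicity suffices, and monotonicity is all that H* and
  H_r* provide.\<close>

definition nonincr :: "real set \<Rightarrow> (real \<Rightarrow> real) \<Rightarrow> bool" where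
  "nonincr I a \<longleftrightarrow> (\<forall>t\<in>I. 0 \<le> a t) \<and> (\<forall>s\<in>I. \<forall>t\<in>I. s \<le> t \<longrightarrow> a t \<le> a s)"

text \<open>Right-continuity of a nonincreasing function, phrased by bounds instead of limits. It
  makes \<open>a\<close> equal to its rearrangement at every point of \<open>I\<close>, hence places
  elements of a space in its \<open>decr_cone\<close>.\<close>

definition nonincr_rc :: "real set \<Rightarrow> (real \<Rightarrow> real) \<Rightarrow> bool" where
  "nonincr_rc I a \<longleftrightarrow> nonincr I a \<and> (\<forall>t\<in>I. \<forall>c. (\<forall>s\<in>I. t < s \<longrightarrow> a s \<le> c) \<longrightarrow> a t \<le> c)"

lemma nonincr_nonneg: "nonincr I a \<Longrightarrow> t \<in> I \<Longrightarrow> 0 \<le> a t"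
  by (simp add: nonincr_def)

lemma nonincr_le: "nonincr I a \<Longrightarrow> s \<in> I \<Longrightarrow> t \<in> I \<Longrightarrow> s \<le> t \<Longrightarrow> a t \<le> a s"
  by (simp add: nonincr_def)

lemma nonincr_rc_imp: "nonincr_rc I a \<Longrightarrow> nonincr I a"
  by (simp add: nonincr_rc_def)

abbreviation distr_fun :: "real set \<Rightarrow> (real \<Rightarrow> real) \<Rightarrow> real \<Rightarrow> ennreal" where
  "distr_fun I x a \<equiv> emeasure (leb I) {s\<in>I. a < \<bar>x s\<bar>}"

section \<open>The interval and its Lebesgue measure\<close>

locale half_interval =
  fixes I :: "real set"
  assumes I_cases: "I = {0<..<1} \<or> I = {0<..}"
begin

lemma I_pos: "t \<in> I \<Longrightarrow> 0 < t"
  using I_cases by auto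

lemma I_down: "t \<in> I \<Longrightarrow> 0 < s \<Longrightarrow> s \<le> t \<Longrightarrow> s \<in> I"
  using I_cases by auto

lemma I_half: "t \<in> I \<Longrightarrow> t / 2 \<in> I"
  using I_down[of t "t/2"] I_pos[of t] by auto

lemma I_sets [measurable, simp]: "I \<in> sets lebesgue"
  using I_cases by auto

lemma I_nonempty: "\<exists>t. t \<in> I"
  using I_cases by (auto intro!: exI[of _ "1/2"])

lemma I_next: assumes "t \<in> I" shows "\<exists>s\<in>I. t < s"
  using I_cases
proof
  assume "I = {0<..<1}"
  then show ?thesis using assms by (intro bexI[of _ "(t+1)/2"]) auto
next
  assume "I = {0<..}"
  then show ?thesis using assms by (intro bexI[of _ "t+1"]) auto
qed

lemma I_between: "t \<in> I \<Longrightarrow> t < s \<Longrightarrow> \<exists>u\<in>I. t < u \<and> u < s"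
proof -
  assume t: "t \<in> I" "t < s"
  obtain u where u: "u \<in> I" "t < u" using I_next[OF t(1)] by auto
  obtain v where v: "t < v" "v < min u s" using dense[of t "min u s"] u t by auto
  then have "v \<in> I" using I_down[OF u(1), of v] I_pos[OF t(1)] by auto
  with v show ?thesis by auto
qed

lemma I_Ioo: "t \<in> I \<Longrightarrow> {0<..<t} \<subseteq> I" "t \<in> I \<Longrightarrow> {0<..t} \<subseteq> I"
  using I_down by auto

lemma space_leb [simp]: "space (leb I) = I"
  by (simp add: space_restrict_space)

lemma sets_leb_iff: "A \<in> sets (leb I) \<longleftrightarrow> A \<subseteq> I \<and> A \<in> sets lebesgue"
  by (subst sets_restrict_space_iff) auto

lemma emeasure_leb: "A \<subseteq> I \<Longrightarrow> emeasure (leb I) A = emeasure lebesgue A"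
  by (rule emeasure_restrict_space) auto

lemma emeasure_leb_Ioo: "t \<in> I \<Longrightarrow> emeasure (leb I) {0<..<t} = ennreal t"
  "t \<in> I \<Longrightarrow> emeasure (leb I) {0<..t} = ennreal t"
  using I_Ioo[of t] I_pos[of t] by (simp_all add: emeasure_leb)

section \<open>Distribution functions and the decreasing rearrangement\<close>

lemma distr_sets [measurable]: "x \<in> L0 I \<Longrightarrow> {s\<in>I. a < \<bar>x s\<bar>} \<in> sets (leb I)"
proof -
  assume "x \<in> L0 I"
  then have [measurable]: "x \<in> borel_measurable (leb I)" by (simp add: L0_def)
  have "{s\<in>space (leb I). a < \<bar>x s\<bar>} \<in> sets (leb I)" by measurable
  then show ?thesis by simp
qed

lemma distr_mono: "x \<in> L0 I \<Longrightarrow> a \<le> b \<Longrightarrow> distr_fun I x b \<le> distr_fun I x a"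
  by (rule emeasure_mono) (auto intro: distr_sets)

text \<open>Right-continuity of the distribution function: the sets where |x| > a + 1/(n+1) increase
  to the set where |x| > a. It is the reason why the infimum defining x*(t) is attained in
  \<open>distr_rearr_le\<close>.\<close>

lemma distr_rc:
  assumes "x \<in> L0 I" "\<And>b. a < b \<Longrightarrow> distr_fun I x b \<le> c"
  shows "distr_fun I x a \<le> c"
proof -
  let ?A = "\<lambda>n. {s\<in>I. a + 1 / Suc n < \<bar>x s\<bar>}"
  have "(\<Union>n. ?A n) = {s\<in>I. a < \<bar>x s\<bar>}"
  proof (intro equalityI subsetI)
    fix s assume s: "s \<in> {s\<in>I. a < \<bar>x s\<bar>}"
    then obtain n where "1 / Suc n < \<bar>x s\<bar> - a"
      by (metis (mono_tags, lifting) diff_gt_0_iff_gt mem_Collect_eq nat_approx_posE)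
    with s show "s \<in> (\<Union>n. ?A n)" by (auto intro!: exI[of _ n])
  next
    fix s assume "s \<in> (\<Union>n. ?A n)"
    then obtain n where "s \<in> I" "a + 1 / Suc n < \<bar>x s\<bar>" by auto
    moreover have "0 < 1 / real (Suc n)" by simp
    ultimately show "s \<in> {s\<in>I. a < \<bar>x s\<bar>}" unfolding mem_Collect_eq by linarith
  qed
  moreover have "(SUP n. emeasure (leb I) (?A n)) = emeasure (leb I) (\<Union>n. ?A n)"
  proof (rule SUP_emeasure_incseq)
    show "range ?A \<subseteq> sets (leb I)" using distr_sets[OF assms(1)] by auto
    show "incseq ?A"
    proof (rule incseq_SucI, safe)
      fix n s assume "s \<in> I" "a + 1 / real (Suc n) < \<bar>x s\<bar>"
      moreover have "1 / real (Suc (Suc n)) \<le> 1 / real (Suc n)" by (simp add: field_simps)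
      ultimately show "a + 1 / real (Suc (Suc n)) < \<bar>x s\<bar>" by linarith
    qed
  qed
  moreover have "emeasure (leb I) (?A n) \<le> c" for n by (rule assms(2)) simp
  ultimately show ?thesis by (metis (mono_tags, lifting) SUP_least)
qed

lemma rearr_set_nonempty:
  "rearr_finite I x \<Longrightarrow> t \<in> I \<Longrightarrow> {a. 0 < a \<and> distr_fun I x a \<le> ennreal t} \<noteq> {}"
  by (auto simp: rearr_finite_def)

lemma rearr_nonneg: "rearr_finite I x \<Longrightarrow> t \<in> I \<Longrightarrow> 0 \<le> rearr I x t"
  unfolding rearr_def by (rule cInf_greatest[OF rearr_set_nonempty]) auto

lemma rearr_le:
  assumes "0 \<le> a" "distr_fun I x a \<le> ennreal t" "x \<in> L0 I"
  shows "rearr I x t \<le> a"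
proof (rule dense_ge)
  fix b assume "a < b"
  then have "distr_fun I x b \<le> ennreal t"
    using distr_mono[OF assms(3), of a b] assms(2) by (meson less_imp_le order_trans)
  then show "rearr I x t \<le> b" unfolding rearr_def
    using \<open>a < b\<close> assms(1) by (intro cInf_lower bdd_belowI[of _ 0]) auto
qed

lemma rearr_less_imp:
  assumes "x \<in> L0 I" "rearr_finite I x" "t \<in> I" "rearr I x t < a"
  shows "distr_fun I x a \<le> ennreal t"
proof -
  obtain b where "b < a" "distr_fun I x b \<le> ennreal t"
    using cInf_lessD[OF rearr_set_nonempty[OF assms(2,3)] assms(4)[unfolded rearr_def]] by auto
  then show ?thesis using distr_mono[OF assms(1), of b a] by (meson less_imp_le order_trans)
qed

lemma distr_rearr_le:
  assumes "x \<in> L0 I" "rearr_finite I x" "t \<in> I"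
  shows "distr_fun I x (rearr I x t) \<le> ennreal t"
  using distr_rc rearr_less_imp assms by blast

lemma less_rearr_imp:
  assumes "x \<in> L0 I" "0 \<le> a" "a < rearr I x t"
  shows "ennreal t < distr_fun I x a"
  using rearr_le[OF assms(2) _ assms(1), of t] assms(3) by (meson linorder_not_less)

text \<open>Since the infimum is attained, b = x*(t) itself would violate the assumption if it were
  below a.\<close>

lemma le_rearr:
  assumes "x \<in> L0 I" "rearr_finite I x" "t \<in> I" "\<And>b. 0 \<le> b \<Longrightarrow> b < a \<Longrightarrow> ennreal t < distr_fun I x b"
  shows "a \<le> rearr I x t"
  using distr_rearr_le[OF assms(1-3)] assms(4)[of "rearr I x t"] rearr_nonneg[OF assms(2,3)]
  by (meson linorder_not_less)

lemma rearr_nonincr_rc: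
  assumes "x \<in> L0 I" "rearr_finite I x"
  shows "nonincr_rc I (rearr I x)"
  unfolding nonincr_rc_def nonincr_def
proof (intro conjI ballI allI impI)
  fix s t assume st: "s \<in> I" "t \<in> I" "s \<le> t"
  then have "ennreal s \<le> ennreal t" by (simp add: ennreal_leI)
  then show "rearr I x t \<le> rearr I x s"
    using order_trans[OF distr_rearr_le[OF assms st(1)]] rearr_nonneg[OF assms(2) st(1)] assms(1)
    by (intro rearr_le)
next
  fix t c assume t: "t \<in> I" and c: "\<forall>s\<in>I. t < s \<longrightarrow> rearr I x s \<le> c"
  have c0: "0 \<le> c" using I_next[OF t] c rearr_nonneg[OF assms(2)] by force
  have "distr_fun I x c \<le> ennreal t + ennreal e" if e: "0 < e" for e
  proof -
    obtain s where s: "s \<in> I" "t < s" "s < t + e" using I_between[OF t, of "t + e"] e by auto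
    have "distr_fun I x c \<le> distr_fun I x (rearr I x s)"
      using c s by (intro distr_mono assms) auto
    also have "\<dots> \<le> ennreal s" using distr_rearr_le[OF assms s(1)] .
    also have "\<dots> \<le> ennreal (t + e)" using s by (intro ennreal_leI) auto
    also have "\<dots> = ennreal t + ennreal e" using I_pos[OF t] that by simp
    finally show ?thesis .
  qed
  then have "distr_fun I x c \<le> ennreal t"
    by (rule ennreal_le_epsilon)
  then show "rearr I x t \<le> c" by (rule rearr_le[OF c0 _ assms(1)])
qed (rule rearr_nonneg[OF assms(2)])

lemma rearr_nonincr: "x \<in> L0 I \<Longrightarrow> rearr_finite I x \<Longrightarrow> nonincr I (rearr I x)"
  using rearr_nonincr_rc nonincr_rc_imp by blast

section \<open>Rearrangements of nonincreasing functions\<close>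

lemma nonincr_L0: assumes "nonincr I a" shows "a \<in> L0 I"
proof -
  have "mono_on I (\<lambda>t. - a t)"
    using assms by (auto simp: nonincr_def mono_on_def)
  then have "(\<lambda>t. - a t) \<in> borel_measurable (restrict_space borel I)"
    by (rule borel_measurable_mono_on_fnc)
  then have "(\<lambda>t. - (- a t)) \<in> borel_measurable (restrict_space borel I)"
    by (rule borel_measurable_uminus)
  moreover have "sets (restrict_space borel I) \<subseteq> sets (leb I)"
    unfolding sets_restrict_space
    by (intro image_mono subsetI) (rule sets_completionI_sets, simp only: sets_lborel)
  ultimately have "a \<in> borel_measurable (leb I)"
    by (intro borel_measurable_subalgebra[of "restrict_space borel I" "leb I" a])
      (simp_all add: space_restrict_space)
  then show ?thesis by (simp add: L0_def)
qed

lemma nonincr_distr_le: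
  assumes "nonincr I a" "t \<in> I" shows "distr_fun I a (a t) \<le> ennreal t"
proof -
  have "distr_fun I a (a t) \<le> emeasure (leb I) {0<..<t}"
  proof (rule emeasure_mono)
    show "{s \<in> I. a t < \<bar>a s\<bar>} \<subseteq> {0<..<t}"
    proof
      fix s assume "s \<in> {s \<in> I. a t < \<bar>a s\<bar>}"
      then have s: "s \<in> I" "a t < a s" using nonincr_nonneg[OF assms(1)] by auto
      then have "\<not> t \<le> s" using nonincr_le[OF assms(1,2) s(1)] by auto
      then show "s \<in> {0<..<t}" using I_pos[OF s(1)] by auto
    qed
    show "{0<..<t} \<in> sets (leb I)" using I_Ioo[OF assms(2)] by (simp add: sets_leb_iff)
  qed
  then show ?thesis by (simp add: emeasure_leb_Ioo assms)
qed

lemma nonincr_finite: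
  assumes "nonincr I a" shows "rearr_finite I a"
  unfolding rearr_finite_def
proof
  fix t assume t: "t \<in> I"
  have "distr_fun I a (a t + 1) \<le> distr_fun I a (a t)"
    by (intro distr_mono nonincr_L0 assms) auto
  then show "\<exists>b>0. distr_fun I a b \<le> ennreal t"
    using nonincr_distr_le[OF assms t] nonincr_nonneg[OF assms t]
    by (intro exI[of _ "a t + 1"]) auto
qed

lemma rearr_nonincr_le:
  assumes "nonincr I a" "t \<in> I" shows "rearr I a t \<le> a t"
  using rearr_le[OF nonincr_nonneg[OF assms] nonincr_distr_le[OF assms] nonincr_L0[OF assms(1)]] .

text \<open>At a jump \<open>a\<close> may exceed its right-continuous rearrangement, so the
  comparison holds only with a strictly later point: above a level below \<open>a t\<close> lies all
  of (0,t], whose measure exceeds s.\<close>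

lemma nonincr_le_rearr:
  assumes "nonincr I a" "s \<in> I" "t \<in> I" "s < t" shows "a t \<le> rearr I a s"
proof (rule le_rearr[OF nonincr_L0[OF assms(1)] nonincr_finite[OF assms(1)] assms(2)])
  fix b assume b: "0 \<le> b" "b < a t"
  have "ennreal s < ennreal t" using assms(4) I_pos[OF assms(2)] by (simp add: ennreal_lessI)
  also have "ennreal t = emeasure (leb I) {0<..t}" by (simp add: emeasure_leb_Ioo assms)
  also have "\<dots> \<le> distr_fun I a b"
  proof (rule emeasure_mono)
    show "{0<..t} \<subseteq> {s \<in> I. b < \<bar>a s\<bar>}"
      using I_Ioo[OF assms(3)] nonincr_le[OF assms(1) _ assms(3)] b(2)
      by (auto intro: less_le_trans simp: subset_eq) (meson abs_ge_self dual_order.strict_trans1 greaterThanAtMost_iff)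
    show "{s \<in> I. b < \<bar>a s\<bar>} \<in> sets (leb I)" by (intro distr_sets nonincr_L0 assms)
  qed
  finally show "ennreal s < distr_fun I a b" .
qed

lemma rearr_nonincr_rc_eq:
  assumes "nonincr_rc I a" "t \<in> I" shows "rearr I a t = a t"
proof (rule antisym)
  show "rearr I a t \<le> a t" by (rule rearr_nonincr_le[OF nonincr_rc_imp[OF assms(1)] assms(2)])
  have "\<forall>s\<in>I. t < s \<longrightarrow> a s \<le> rearr I a t"
    using nonincr_le_rearr[OF nonincr_rc_imp[OF assms(1)] assms(2)] by blast
  then show "a t \<le> rearr I a t" using assms unfolding nonincr_rc_def by blast
qed

lemma nonincr_rc_dil2:
  assumes "nonincr_rc I a" shows "nonincr_rc I (dil2 a)"
  unfolding nonincr_rc_def nonincr_def dil2_def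
proof (intro conjI ballI allI impI)
  note d = nonincr_rc_imp[OF assms]
  fix t assume t: "t \<in> I"
  show "0 \<le> a (t / 2)" using nonincr_nonneg[OF d I_half[OF t]] .
  fix c assume c: "\<forall>s\<in>I. t < s \<longrightarrow> a (s / 2) \<le> c"
  obtain u where u: "u \<in> I" "t < u" using I_next[OF t] by auto
  have "a s \<le> c" if "s \<in> I" "t / 2 < s" for s
  proof -
    \<comment> \<open>For \<open>I = (0,1)\<close> the point \<open>2 * s\<close> may leave the
      interval; the minimum with \<open>u\<close> keeps it inside.\<close>
    define s' where "s' = min u (2 * s)"
    have "t < s'" "s' \<le> u" "s' / 2 \<le> s" using u that by (auto simp: s'_def)
    then have "s' \<in> I" using I_down[OF u(1)] I_pos[OF t] by auto
    then have "a (s' / 2) \<le> c" using c \<open>t < s'\<close> by auto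
    then show ?thesis
      using nonincr_le[OF d I_half[OF \<open>s' \<in> I\<close>] that(1) \<open>s'/2 \<le> s\<close>] by auto
  qed
  then show "a (t / 2) \<le> c" using assms I_half[OF t] unfolding nonincr_rc_def by blast
next
  fix s t assume "s \<in> I" "t \<in> I" "s \<le> t"
  then show "a (t / 2) \<le> a (s / 2)"
    by (intro nonincr_le[OF nonincr_rc_imp[OF assms]] I_half) auto
qed

lemma nonincr_dil2: assumes "nonincr I a" shows "nonincr I (dil2 a)"
  using assms I_half unfolding nonincr_def dil2_def by simp

lemma nonincr_mult: "nonincr I a \<Longrightarrow> nonincr I b \<Longrightarrow> nonincr I (\<lambda>t. a t * b t)"
  unfolding nonincr_def by (auto intro!: mult_mono)

text \<open>The two arguments tend to t one after the other. For s, u > t the product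
  \<open>a s * b u\<close> is at most the diagonal value at min(s,u), hence at most c;
  right-continuity of \<open>b\<close> then removes u and that of \<open>a\<close> removes
  s.\<close>

lemma nonincr_rc_mult:
  assumes a: "nonincr_rc I a" and b: "nonincr_rc I b"
  shows "nonincr_rc I (\<lambda>t. a t * b t)"
  unfolding nonincr_rc_def
proof (intro conjI ballI allI impI)
  note da = nonincr_rc_imp[OF a] and db = nonincr_rc_imp[OF b]
  show "nonincr I (\<lambda>t. a t * b t)" by (rule nonincr_mult[OF da db])
  fix t c assume t: "t \<in> I" and c: "\<forall>s\<in>I. t < s \<longrightarrow> a s * b s \<le> c"
  have c0: "0 \<le> c" using I_next[OF t] c nonincr_nonneg[OF da] nonincr_nonneg[OF db]
    by (meson mult_nonneg_nonneg order_trans)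
  show "a t * b t \<le> c"
  proof (rule ccontr)
    assume n: "\<not> a t * b t \<le> c"
    have *: "a s * b t \<le> c" if "s \<in> I" "t < s" for s
    proof (cases "a s = 0")
      case False
      then have as: "0 < a s" using nonincr_nonneg[OF da that(1)] by auto
      have "b t \<le> c / a s"
      proof -
        have "b u \<le> c / a s" if u: "u \<in> I" "t < u" for u
        proof -
          define v where "v = min s u"
          have v: "v \<in> I" "t < v" "v \<le> s" "v \<le> u"
            using \<open>s\<in>I\<close> \<open>t<s\<close> u by (auto simp: v_def min_def)
          have "a s * b u \<le> a v * b v"
            using nonincr_le[OF da v(1) \<open>s\<in>I\<close> v(3)] nonincr_le[OF db v(1) u(1) v(4)]
              nonincr_nonneg[OF da v(1)] nonincr_nonneg[OF db u(1)] by (intro mult_mono) auto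
          also have "\<dots> \<le> c" using c v by auto
          finally show ?thesis using as by (simp add: field_simps)
        qed
        then show ?thesis using b t unfolding nonincr_rc_def by blast
      qed
      then show ?thesis using as by (simp add: field_simps)
    qed (use c0 in simp)
    have "b t \<noteq> 0" using n c0 by auto
    then have bt: "0 < b t" using nonincr_nonneg[OF db t] by auto
    then have "\<forall>s\<in>I. t < s \<longrightarrow> a s \<le> c / b t" using * by (simp add: field_simps)
    then have "a t \<le> c / b t" using a t unfolding nonincr_rc_def by blast
    then show False using bt n by (simp add: field_simps)
  qed
qed

section \<open>Rearrangements of multiples and products\<close>

lemma rearr_scale:
  assumes "x \<in> L0 I" "rearr_finite I x" "0 < c"
  shows "rearr_finite I (\<lambda>t. c * x t)" "t \<in> I \<Longrightarrow> rearr I (\<lambda>t. c * x t) t = c * rearr I x t"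
proof -
  have e: "distr_fun I (\<lambda>t. c * x t) (c * a) = distr_fun I x a" for a
    using assms(3) by (simp add: abs_mult)
  show fin: "rearr_finite I (\<lambda>t. c * x t)"
    unfolding rearr_finite_def
  proof
    fix t assume "t \<in> I"
    then obtain a where "0 < a" "distr_fun I x a \<le> ennreal t"
      using assms(2) unfolding rearr_finite_def by auto
    then show "\<exists>a>0. distr_fun I (\<lambda>t. c * x t) a \<le> ennreal t"
      using assms(3) by (intro exI[of _ "c * a"]) (simp only: e, simp)
  qed
  have m: "(\<lambda>t. c * x t) \<in> L0 I" using assms(1) by (simp add: L0_def)
  assume t: "t \<in> I"
  show "rearr I (\<lambda>t. c * x t) t = c * rearr I x t"
  proof (rule antisym)
    show "rearr I (\<lambda>t. c * x t) t \<le> c * rearr I x t"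
      using distr_rearr_le[OF assms(1,2) t] rearr_nonneg[OF assms(2) t] assms(3)
      by (intro rearr_le[OF _ _ m]) (simp_all only: e, simp_all)
    have "rearr I x t \<le> rearr I (\<lambda>t. c * x t) t / c"
    proof (rule rearr_le[OF _ _ assms(1)])
      show "distr_fun I x (rearr I (\<lambda>t. c * x t) t / c) \<le> ennreal t"
        using distr_rearr_le[OF m fin t] assms(3) by (subst e[symmetric]) simp
    qed (use rearr_nonneg[OF fin t] assms(3) in simp)
    then show "c * rearr I x t \<le> rearr I (\<lambda>t. c * x t) t"
      using assms(3) by (simp add: field_simps)
  qed
qed

text \<open>Where |x y| > a b, either |x| > a or |y| > b. With a = x*(t/2) and b = y*(t/2) each
  alternative has measure at most t/2; this splitting of t is the source of D_2.\<close>

lemma rearr_mult: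
  assumes "x \<in> L0 I" "rearr_finite I x" "y \<in> L0 I" "rearr_finite I y"
  shows "rearr_finite I (\<lambda>t. x t * y t)"
    "t \<in> I \<Longrightarrow> rearr I (\<lambda>t. x t * y t) t \<le> rearr I x (t/2) * rearr I y (t/2)"
proof -
  have m: "(\<lambda>t. x t * y t) \<in> L0 I" using assms by (simp add: L0_def)
  have d: "distr_fun I (\<lambda>t. x t * y t) (a * b) \<le> ennreal t"
    if t: "t \<in> I" and a: "rearr I x (t/2) \<le> a" and b: "rearr I y (t/2) \<le> b" for t a b
  proof -
    have ab: "0 \<le> a" "0 \<le> b" using a b rearr_nonneg assms I_half[OF t] by (meson order_trans)+
    have "distr_fun I (\<lambda>t. x t * y t) (a * b) \<le>
        emeasure (leb I) ({s\<in>I. a < \<bar>x s\<bar>} \<union> {s\<in>I. b < \<bar>y s\<bar>})"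
    proof (rule emeasure_mono)
      show "{s \<in> I. a * b < \<bar>x s * y s\<bar>} \<subseteq> {s \<in> I. a < \<bar>x s\<bar>} \<union> {s \<in> I. b < \<bar>y s\<bar>}"
        using ab by (auto simp: abs_mult not_less) (meson abs_ge_zero linorder_not_less mult_mono)
    qed (intro sets.Un distr_sets assms)
    also have "\<dots> \<le> distr_fun I x a + distr_fun I y b"
      by (intro emeasure_subadditive distr_sets assms)
    also have "\<dots> \<le> ennreal (t/2) + ennreal (t/2)"
      using distr_rearr_le[OF assms(1,2) I_half[OF t]] distr_mono[OF assms(1) a]
        distr_rearr_le[OF assms(3,4) I_half[OF t]] distr_mono[OF assms(3) b]
      by (intro add_mono) (auto intro: order_trans)
    also have "\<dots> = ennreal t" using I_pos[OF t] by (simp flip: ennreal_plus)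
    finally show ?thesis .
  qed
  show "rearr_finite I (\<lambda>t. x t * y t)"
    unfolding rearr_finite_def
  proof
    fix t assume t: "t \<in> I"
    show "\<exists>a>0. distr_fun I (\<lambda>t. x t * y t) a \<le> ennreal t"
      using d[OF t, of "rearr I x (t/2) + 1" "rearr I y (t/2) + 1"]
        rearr_nonneg[OF assms(2) I_half[OF t]] rearr_nonneg[OF assms(4) I_half[OF t]]
      by (intro exI[of _ "(rearr I x (t/2) + 1) * (rearr I y (t/2) + 1)"]) auto
  qed
  show "rearr I (\<lambda>t. x t * y t) t \<le> rearr I x (t/2) * rearr I y (t/2)" if t: "t \<in> I"
    using d[OF t order.refl order.refl]
      rearr_nonneg[OF assms(2) I_half[OF t]] rearr_nonneg[OF assms(4) I_half[OF t]]
    by (intro rearr_le[OF _ _ m]) auto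
qed

end

subsection \<open>The Lorentz-Luxemburg theorem\<close>

lemma is_ideal_elts:
  "is_ideal I X \<Longrightarrow> y \<in> elts X \<Longrightarrow> x \<in> L0 I \<Longrightarrow> AE t in leb I. \<bar>x t\<bar> \<le> \<bar>y t\<bar> \<Longrightarrow> x \<in> elts X"
  by (auto simp: is_ideal_def)

lemma is_ideal_norm_le:
  "is_ideal I X \<Longrightarrow> y \<in> elts X \<Longrightarrow> x \<in> L0 I \<Longrightarrow> AE t in leb I. \<bar>x t\<bar> \<le> \<bar>y t\<bar> \<Longrightarrow> fnorm X x \<le> fnorm X y"
  by (auto simp: is_ideal_def)

lemma normed_spaceD:
  assumes "normed_space I X"
  shows "x \<in> elts X \<Longrightarrow> x \<in> L0 I"
    "(\<lambda>_. 0) \<in> elts X"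
    "x \<in> elts X \<Longrightarrow> y \<in> elts X \<Longrightarrow> (\<lambda>t. x t + y t) \<in> elts X"
    "x \<in> elts X \<Longrightarrow> (\<lambda>t. c * x t) \<in> elts X"
    "x \<in> elts X \<Longrightarrow> fnorm X x < \<infinity>"
    "x \<in> elts X \<Longrightarrow> fnorm X x = 0 \<longleftrightarrow> (AE t in leb I. x t = 0)"
    "x \<in> elts X \<Longrightarrow> fnorm X (\<lambda>t. c * x t) = ennreal \<bar>c\<bar> * fnorm X x"
    "x \<in> elts X \<Longrightarrow> y \<in> elts X \<Longrightarrow> fnorm X (\<lambda>t. x t + y t) \<le> fnorm X x + fnorm X y"
  using assms by (auto simp: normed_space_def quasi_normed_with_def)

lemma koethe_dual_norm:
  "fnorm (koethe_dual I X) x =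
     (SUP y\<in>{y\<in>elts X. fnorm X y \<le> 1}. \<integral>\<^sup>+ t. ennreal \<bar>x t * y t\<bar> \<partial>leb I)"
  by (simp add: koethe_dual_def)

lemma koethe_dual_elts:
  "x \<in> elts (koethe_dual I X) \<longleftrightarrow> x \<in> L0 I \<and> fnorm (koethe_dual I X) x < \<infinity>"
  by (simp add: koethe_dual_def)

lemma convergent_if_summable_diff:
  fixes f :: "nat \<Rightarrow> real"
  assumes "summable (\<lambda>k. \<bar>f (Suc k) - f k\<bar>)"
  shows "convergent f"
proof -
  have "summable (\<lambda>k. f (Suc k) - f k)" using assms by (rule summable_rabs_cancel)
  then have "(\<lambda>n. \<Sum>k<n. f (Suc k) - f k) \<longlonglongrightarrow> (\<Sum>k. f (Suc k) - f k)" by (rule summable_LIMSEQ)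
  then have "(\<lambda>n. f n - f 0) \<longlonglongrightarrow> (\<Sum>k. f (Suc k) - f k)" by (simp add: sum_lessThan_telescope)
  then have "(\<lambda>n. f n - f 0 + f 0) \<longlonglongrightarrow> (\<Sum>k. f (Suc k) - f k) + f 0" by (intro tendsto_intros)
  then show ?thesis by (auto simp: convergent_def)
qed

lemma INF_atLeast_tendsto:
  fixes f :: "nat \<Rightarrow> real"
  assumes "f \<longlonglongrightarrow> L" "\<And>k. 0 \<le> f k"
  shows "(\<lambda>k. INF j\<in>{k..}. f j) \<longlonglongrightarrow> L"
proof (rule LIMSEQ_I)
  fix e :: real assume "0 < e"
  then obtain K where K: "\<And>j. j \<ge> K \<Longrightarrow> \<bar>f j - L\<bar> < e / 2"
    using LIMSEQ_D[OF assms(1), of "e/2"] by (auto simp: real_norm_def)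
  have "norm ((INF j\<in>{k..}. f j) - L) < e" if "k \<ge> K" for k
  proof -
    have "L - e/2 \<le> (INF j\<in>{k..}. f j)"
    proof (rule cINF_greatest)
      fix j assume "j \<in> {k..}"
      then have "\<bar>f j - L\<bar> < e/2" using K that by auto
      then show "L - e/2 \<le> f j" by linarith
    qed simp
    moreover have "(INF j\<in>{k..}. f j) \<le> f k"
      using assms(2) by (intro cINF_lower bdd_belowI[of _ 0]) auto
    ultimately show ?thesis using K[OF that] \<open>0 < e\<close> unfolding real_norm_def by linarith
  qed
  then show "\<exists>no. \<forall>n\<ge>no. norm ((INF j\<in>{n..}. f j) - L) < e" by blast
qed

text \<open>The Fatou property speaks of increasing sequences only. The tail infima of
  \<open>f\<close> increase to the same limit and lie below \<open>f k\<close>, so the ideal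
  property hands the norm bound on to them.\<close>

lemma fatou_limit:
  assumes "is_ideal I X" "fatou_property I X"
    and f: "\<And>k. f k \<in> elts X" "\<And>k. f k \<in> L0 I" "\<And>k. fnorm X (f k) \<le> ennreal c" "\<And>k t. 0 \<le> f k t"
    and x: "x \<in> L0 I" "AE t in leb I. (\<lambda>k. f k t) \<longlonglongrightarrow> x t"
  shows "x \<in> elts X" "fnorm X x \<le> ennreal c"
proof -
  define u where "u k t = (INF j\<in>{k..}. f j t)" for k t
  have bdd: "bdd_below ((\<lambda>j. f j t) ` {k..})" for k t
    using f(4) by (intro bdd_belowI[of _ 0]) auto
  have um: "u k \<in> L0 I" for k
    unfolding L0_def u_def
    using f(2) bdd by (intro borel_measurable_cINF) (auto simp: L0_def)
  have u0: "0 \<le> u k t" for k t unfolding u_def using f(4) by (intro cINF_greatest) auto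
  have uf: "u k t \<le> f k t" for k t unfolding u_def using bdd by (intro cINF_lower) auto
  have uX: "u k \<in> elts X" for k
    using u0 uf f(4) by (intro is_ideal_elts[OF assms(1) f(1)[of k] um]) simp
  have un: "fnorm X (u k) \<le> ennreal c" for k
    using u0 uf f(4) by (intro order_trans[OF is_ideal_norm_le[OF assms(1) f(1)[of k] um] f(3)]) simp
  have inc: "incseq (\<lambda>k. u k t)" for t
  proof (rule incseq_SucI)
    fix k show "u k t \<le> u (Suc k) t" unfolding u_def
      using bdd by (intro cINF_superset_mono) auto
  qed
  have lim: "AE t in leb I. (\<lambda>k. u k t) \<longlonglongrightarrow> x t"
    using x(2) by eventually_elim (auto simp: u_def intro!: INF_atLeast_tendsto f)
  have sup: "(SUP k. fnorm X (u k)) \<le> ennreal c" using un by (intro SUP_least)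
  then have "(SUP k. fnorm X (u k)) < \<infinity>" by (metis ennreal_less_top infinity_ennreal_def order_le_less_trans)
  moreover have "AE t in leb I. (\<forall>n. 0 \<le> u n t) \<and> incseq (\<lambda>n. u n t) \<and> (\<lambda>n. u n t) \<longlonglongrightarrow> x t"
    using lim by eventually_elim (auto simp: u0 inc)
  ultimately have *: "x \<in> elts X \<and> incseq (\<lambda>n. fnorm X (u n)) \<and> (\<lambda>n. fnorm X (u n)) \<longlonglongrightarrow> fnorm X x"
    using assms(2)[unfolded fatou_property_def, rule_format, of u x] uX x(1) by auto
  then show "x \<in> elts X" by simp
  show "fnorm X x \<le> ennreal c"
    using * un by (intro LIMSEQ_le_const2[of "\<lambda>n. fnorm X (u n)"]) auto
qed

context half_interval
begin

section \<open>Minimising the L2 distance over the unit ball\<close>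

lemma borel_measurable_leb: "f \<in> borel_measurable borel \<Longrightarrow> f \<in> borel_measurable (leb I)"
  by (intro measurable_restrict_space1 measurable_completion) simp

lemma integrable_bounded_supp:
  assumes "f \<in> L0 I" "\<And>t. \<bar>f t\<bar> \<le> c * indicator {0<..<n::real} t"
  shows "integrable (leb I) f"
proof (rule Bochner_Integration.integrable_bound)
  have "{0<..<n} \<inter> I \<in> sets (leb I)" by (simp add: sets_leb_iff sets.Int)
  moreover have "emeasure (leb I) ({0<..<n} \<inter> I) < \<infinity>"
  proof -
    have "emeasure (leb I) ({0<..<n} \<inter> I) \<le> emeasure lebesgue {0<..<n}"
      by (subst emeasure_leb) (blast, rule emeasure_mono, auto)
    also have "\<dots> < \<infinity>" by (cases "0 \<le> n") auto
    finally show ?thesis .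
  qed
  ultimately show "integrable (leb I) (\<lambda>t. c * indicator ({0<..<n} \<inter> I) t)" by simp
  show "f \<in> borel_measurable (leb I)" using assms(1) by (simp add: L0_def)
  show "AE t in leb I. norm (f t) \<le> norm (c * indicator ({0<..<n} \<inter> I) t)"
  proof (rule AE_I2)
    fix t assume "t \<in> space (leb I)"
    then show "norm (f t) \<le> norm (c * indicator ({0<..<n} \<inter> I) t)"
      using assms(2)[of t] by (auto simp: indicator_def)
  qed
qed

lemma integral_indicator_Ioo_le:
  assumes "0 \<le> (n::real)" shows "(\<integral>t. indicator {0<..<n} t \<partial>leb I) \<le> n"
proof -
  have *: "{0<..<n} \<inter> I \<in> sets (leb I)" by (simp add: sets_leb_iff sets.Int)
  have "(\<integral>t. indicator {0<..<n} t \<partial>leb I) = (\<integral>t. indicator ({0<..<n} \<inter> I) t \<partial>leb I)"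
    by (rule Bochner_Integration.integral_cong) (auto simp: indicator_def)
  also have "\<dots> = measure (leb I) ({0<..<n} \<inter> I)" using * by simp
  also have "\<dots> \<le> n"
  proof -
    have "emeasure (leb I) ({0<..<n} \<inter> I) \<le> emeasure lebesgue {0<..<n}"
      by (subst emeasure_leb) (blast, rule emeasure_mono, auto)
    also have "\<dots> = ennreal n" using assms by simp
    finally show ?thesis using assms by (simp add: measure_def enn2real_leI)
  qed
  finally show ?thesis .
qed

text \<open>On (0,n) geometric decay of the squared L2 increments makes the L1 increments summable.
  The sequence therefore converges almost everywhere itself, without passing to a subsequence, and
  \<open>fatou_limit\<close> applies.\<close>

lemma minimizing_sequence_limit:
  assumes X: "is_ideal I X" "fatou_property I X"
    and z: "z \<in> L0 I" "\<And>t. 0 \<le> z t" "\<And>t. z t \<le> n * indicator {0<..<n::real} t" "0 < n"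
    and f: "\<And>k. f k \<in> elts X" "\<And>k. f k \<in> L0 I" "\<And>k. fnorm X (f k) \<le> 1"
      "\<And>k t. 0 \<le> f k t" "\<And>k t. f k t \<le> z t"
    and J: "\<And>k. (\<integral>t. (f (Suc k) t - f k t)\<^sup>2 \<partial>leb I) \<le> 4 * (1/16)^k"
  shows "\<exists>g. g \<in> elts X \<and> g \<in> L0 I \<and> fnorm X g \<le> 1 \<and> (\<forall>t. 0 \<le> g t \<and> g t \<le> z t) \<and>
           (AE t in leb I. (\<lambda>k. f k t) \<longlonglongrightarrow> g t)"
proof -
  have fm [measurable]: "f k \<in> borel_measurable (leb I)" for k using f(2) by (simp add: L0_def)
  have zm [measurable]: "z \<in> borel_measurable (leb I)" using z(1) by (simp add: L0_def)
  let ?i = "indicator {0<..<n} :: real \<Rightarrow> real"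
  have i: "integrable (leb I) ?i"
    by (rule integrable_bounded_supp[of _ 1 n]) (auto simp: L0_def intro: borel_measurable_leb)
  have db: "\<bar>f (Suc k) t - f k t\<bar> \<le> n * ?i t" for k t
    using f(4)[of "Suc k" t] f(5)[of "Suc k" t] f(4)[of k t] f(5)[of k t] z(3)[of t] by linarith
  have di: "integrable (leb I) (\<lambda>t. \<bar>f (Suc k) t - f k t\<bar>)" for k
    by (rule integrable_bounded_supp[of _ n n]) (use db in \<open>auto simp: L0_def\<close>)
  have dsb: "\<bar>(f (Suc k) t - f k t)\<^sup>2\<bar> \<le> n\<^sup>2 * ?i t" for k t
  proof (cases "t \<in> {0<..<n}")
    case True
    then have "\<bar>f (Suc k) t - f k t\<bar>\<^sup>2 \<le> n\<^sup>2" using db[of k t] by (intro power_mono) auto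
    then show ?thesis using True by simp
  qed (use db[of k t] in simp)
  have dsi: "integrable (leb I) (\<lambda>t. (f (Suc k) t - f k t)\<^sup>2)" for k
    by (rule integrable_bounded_supp[of _ "n\<^sup>2" n]) (use dsb in \<open>auto simp: L0_def\<close>)
  have est: "(\<integral>t. \<bar>f (Suc k) t - f k t\<bar> \<partial>leb I) \<le> (n + 4) * (1/2)^k" for k
  proof -
    \<comment> \<open>Weighted arithmetic-geometric inequality. The weight 2^k is balanced against
      the rate (1/16)^k: both terms remain summable after integration over (0,n).\<close>
    have pw: "\<bar>u\<bar> \<le> (1/2)^k + 2^k * u\<^sup>2" for u :: real
    proof -
      have "0 \<le> ((1/2)^k) * (1 - 2^k * \<bar>u\<bar>)\<^sup>2" by simp
      also have "\<dots> = (1/2)^k - 2 * \<bar>u\<bar> + 2^k * u\<^sup>2"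
        by (simp add: power2_eq_square algebra_simps power_one_over)
      finally show ?thesis by (simp add: abs_if split: if_splits)
    qed
    have pw': "\<bar>f (Suc k) t - f k t\<bar> \<le> (1/2)^k * ?i t + 2^k * (f (Suc k) t - f k t)\<^sup>2" for t
    proof (cases "t \<in> {0<..<n}")
      case True then show ?thesis using pw[of "f (Suc k) t - f k t"] by simp
    next
      case False then show ?thesis using db[of k t] by simp
    qed
    have "(\<integral>t. \<bar>f (Suc k) t - f k t\<bar> \<partial>leb I) \<le>
        (\<integral>t. (1/2)^k * ?i t + 2^k * (f (Suc k) t - f k t)\<^sup>2 \<partial>leb I)"
      by (rule integral_mono[OF di _ pw']) (intro Bochner_Integration.integrable_add integrable_mult_right i dsi)
    also have "\<dots> = (1/2)^k * (\<integral>t. ?i t \<partial>leb I) + 2^k * (\<integral>t. (f (Suc k) t - f k t)\<^sup>2 \<partial>leb I)"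
      using i dsi[of k] by (subst Bochner_Integration.integral_add) auto
    also have "\<dots> \<le> (1/2)^k * n + 2^k * (4 * (1/16)^k)"
      using integral_indicator_Ioo_le[of n] z(4) J[of k] by (intro add_mono mult_left_mono) auto
    also have "2^k * (4 * (1/16)^k) = 4 * ((1/8)^k :: real)"
      by (simp flip: power_mult_distrib)
    also have "(1/2)^k * n + 4 * (1/8)^k \<le> (n + 4) * ((1/2)^k :: real)"
      using power_mono[of "1/8" "1/2::real" k] by (simp add: algebra_simps)
    finally show ?thesis by simp
  qed
  have "(\<integral>\<^sup>+t. (\<Sum>k. ennreal \<bar>f (Suc k) t - f k t\<bar>) \<partial>leb I) =
      (\<Sum>k. \<integral>\<^sup>+t. ennreal \<bar>f (Suc k) t - f k t\<bar> \<partial>leb I)"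
    by (rule nn_integral_suminf) measurable
  also have "\<dots> = (\<Sum>k. ennreal (\<integral>t. \<bar>f (Suc k) t - f k t\<bar> \<partial>leb I))"
    by (intro suminf_cong nn_integral_eq_integral di) auto
  also have "\<dots> \<le> (\<Sum>k. ennreal ((n + 4) * (1/2)^k))"
    by (intro suminf_le ennreal_leI est) auto
  also have "\<dots> < \<infinity>"
  proof -
    have "summable (\<lambda>k. (n + 4) * (1/2)^k)" by (intro summable_mult summable_geometric) simp
    then show ?thesis using z(4) by (subst suminf_ennreal2) auto
  qed
  finally have "(\<integral>\<^sup>+t. (\<Sum>k. ennreal \<bar>f (Suc k) t - f k t\<bar>) \<partial>leb I) \<noteq> \<infinity>" by simp
  then have "AE t in leb I. (\<Sum>k. ennreal \<bar>f (Suc k) t - f k t\<bar>) \<noteq> \<infinity>"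
    by (intro nn_integral_PInf_AE) measurable
  then have conv: "AE t in leb I. convergent (\<lambda>k. f k t)"
  proof eventually_elim
    case (elim t)
    have "summable (\<lambda>k. \<bar>f (Suc k) t - f k t\<bar>)"
      by (rule summable_suminf_not_top) (use elim in auto)
    then show ?case by (rule convergent_if_summable_diff)
  qed
  \<comment> \<open>The value of \<open>lim\<close> is unspecified where the sequence diverges.
    Clamping it between 0 and z makes the bounds hold everywhere and changes nothing where the limit
    exists.\<close>
  define g where "g t = max 0 (min (z t) (lim (\<lambda>k. f k t)))" for t
  have gm: "g \<in> L0 I" unfolding L0_def g_def by measurable
  have g: "0 \<le> g t" "g t \<le> z t" for t using z(2)[of t] by (auto simp: g_def)
  have lim: "AE t in leb I. (\<lambda>k. f k t) \<longlonglongrightarrow> g t"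
    using conv
  proof eventually_elim
    case (elim t)
    then have l: "(\<lambda>k. f k t) \<longlonglongrightarrow> lim (\<lambda>k. f k t)" by (simp add: convergent_LIMSEQ_iff)
    have "0 \<le> lim (\<lambda>k. f k t)" "lim (\<lambda>k. f k t) \<le> z t"
      using LIMSEQ_le_const[OF l] LIMSEQ_le_const2[OF l] f(4,5) by auto
    with l show ?case by (simp add: g_def)
  qed
  show ?thesis
    using fatou_limit[OF X f(1,2) _ f(4) gm lim, of 1] f(3) gm g lim by auto
qed

text \<open>
  The minimiser of the \<open>L\<^sup>2\<close> distance to \<open>z\<close> over the unit ball plays the role of the Hahn-Banach
  functional: its residual is a functional on which \<open>z\<close> would exceed the unit ball.
\<close>

lemma bounded_in_unit_ball:
  assumes X: "normed_space I X" "is_ideal I X" "fatou_property I X"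
    and z: "z \<in> L0 I" "\<And>t. 0 \<le> z t" "\<And>t. z t \<le> n * indicator {0<..<n::real} t" "0 < n"
    and dual: "\<And>g. g \<in> elts (koethe_dual I X) \<Longrightarrow>
      (\<integral>\<^sup>+t. ennreal \<bar>z t * g t\<bar> \<partial>leb I) \<le> fnorm (koethe_dual I X) g"
  shows "z \<in> elts X \<and> fnorm X z \<le> 1"
proof -
  \<comment> \<open>Bounded functions supported in (0,n) have integrable products, so that
    \<open>J\<close> can be expanded. The minimising sequence is taken in \<open>C\<close>, where z
    is a common bound.\<close>
  define B where "B = {h\<in>L0 I. h \<in> elts X \<and> fnorm X h \<le> 1 \<and> (\<exists>m. \<forall>t. 0 \<le> h t \<and> h t \<le> m * indicator {0<..<n} t)}"
  define C where "C = {h\<in>B. \<forall>t. h t \<le> z t}"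
  define J where "J h = (\<integral>t. (z t - h t)\<^sup>2 \<partial>leb I)" for h
  let ?i = "indicator {0<..<n} :: real \<Rightarrow> real"
  have bd: "\<exists>m\<ge>0. \<forall>t. \<bar>h t\<bar> \<le> m * ?i t" if hz: "h \<in> B \<or> h = z" for h
  proof -
    have "\<exists>m. \<forall>t. 0 \<le> h t \<and> h t \<le> m * ?i t" using hz z(2,3) by (auto simp: B_def)
    then obtain m where m: "\<forall>t. 0 \<le> h t \<and> h t \<le> m * ?i t" by blast
    have "\<bar>h t\<bar> \<le> max 0 m * ?i t" for t
      using m[rule_format, of t] by (auto simp: indicator_def)
    then show ?thesis by (intro exI[of _ "max 0 m"]) auto
  qed
  have hm: "h \<in> borel_measurable (leb I)" if "h \<in> B \<or> h = z" for h
    using that z(1) by (auto simp: B_def L0_def)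
  have int2: "integrable (leb I) (\<lambda>t. h t * k t)" if hk: "h \<in> B \<or> h = z" "k \<in> B \<or> k = z" for h k
  proof -
    obtain m where m: "m \<ge> 0" "\<And>t. \<bar>h t\<bar> \<le> m * ?i t" using bd[OF hk(1)] by auto
    obtain l where l: "l \<ge> 0" "\<And>t. \<bar>k t\<bar> \<le> l * ?i t" using bd[OF hk(2)] by auto
    note [measurable] = hm[OF hk(1)] hm[OF hk(2)]
    have "\<bar>h t * k t\<bar> \<le> (m * l) * ?i t" for t
    proof -
      have "\<bar>h t * k t\<bar> \<le> (m * ?i t) * (l * ?i t)"
        unfolding abs_mult using m l by (intro mult_mono) auto
      also have "\<dots> = (m * l) * ?i t" by (auto simp: indicator_def)
      finally show ?thesis .
    qed
    then show ?thesis by (intro integrable_bounded_supp[of _ "m * l" n]) (auto simp: L0_def)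
  qed
  have exp: "(a - b)\<^sup>2 = a * a - 2 * (a * b) + b * b" for a b :: real
    by (simp add: power2_eq_square algebra_simps)
  have Jeq: "J h = (\<integral>t. z t * z t \<partial>leb I) - 2 * (\<integral>t. z t * h t \<partial>leb I) + (\<integral>t. h t * h t \<partial>leb I)"
    if "h \<in> B" for h
    unfolding J_def exp using int2[of z z] int2[of z h] int2[of h h] that by simp
  have J0: "0 \<le> J h" for h unfolding J_def by simp
  have convexB: "(\<lambda>t. (1 - \<theta>) * h t + \<theta> * k t) \<in> B" if hkB: "h \<in> B" "k \<in> B" "0 \<le> \<theta>" "\<theta> \<le> 1" for h k \<theta>
  proof -
    obtain m where m: "m \<ge> 0" "\<And>t. \<bar>h t\<bar> \<le> m * ?i t" using bd[of h] hkB by auto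
    obtain l where l: "l \<ge> 0" "\<And>t. \<bar>k t\<bar> \<le> l * ?i t" using bd[of k] hkB by auto
    have hk: "h \<in> elts X" "k \<in> elts X" "fnorm X h \<le> 1" "fnorm X k \<le> 1" "\<And>t. 0 \<le> h t" "\<And>t. 0 \<le> k t"
      using that by (auto simp: B_def)
    note e = normed_spaceD(4)[OF X(1) hk(1), of "1 - \<theta>"] normed_spaceD(4)[OF X(1) hk(2), of \<theta>]
    have "fnorm X (\<lambda>t. (1 - \<theta>) * h t + \<theta> * k t) \<le> ennreal (1 - \<theta>) * fnorm X h + ennreal \<theta> * fnorm X k"
      using normed_spaceD(8)[OF X(1) e] normed_spaceD(7)[OF X(1) hk(1), of "1 - \<theta>"]
        normed_spaceD(7)[OF X(1) hk(2), of \<theta>] that by simp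
    also have "\<dots> \<le> ennreal (1 - \<theta>) * 1 + ennreal \<theta> * 1"
      using hk by (intro add_mono mult_left_mono) auto
    also have "\<dots> = 1" using that by (simp flip: ennreal_plus)
    finally have "fnorm X (\<lambda>t. (1 - \<theta>) * h t + \<theta> * k t) \<le> 1" .
    moreover have "(1 - \<theta>) * h t + \<theta> * k t \<le> (m + l) * ?i t" for t
    proof -
      have "(1 - \<theta>) * h t + \<theta> * k t \<le> 1 * h t + 1 * k t"
        using that hk(5)[of t] hk(6)[of t] by (intro add_mono mult_right_mono) auto
      then show ?thesis using m(2)[of t] l(2)[of t] by (simp add: distrib_right)
    qed
    moreover have "(\<lambda>t. (1 - \<theta>) * h t + \<theta> * k t) \<in> elts X" using normed_spaceD(3)[OF X(1) e] .
    moreover have "0 \<le> (1 - \<theta>) * h t + \<theta> * k t" for t using hk that by simp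
    ultimately show ?thesis using normed_spaceD(1)[OF X(1)] unfolding B_def by blast
  qed
  have zero: "(\<lambda>_. 0) \<in> C"
  proof -
    have "fnorm X (\<lambda>_. 0) = 0" using normed_spaceD(6)[OF X(1) normed_spaceD(2)[OF X(1)]] by simp
    then show ?thesis using normed_spaceD(2)[OF X(1)] normed_spaceD(1)[OF X(1)] z(2)
      by (auto simp: C_def B_def intro!: exI[of _ 0])
  qed
  define d where "d = Inf (J ` C)"
  have bddJ: "bdd_below (J ` C)" using J0 by (intro bdd_belowI[of _ 0]) auto
  have d_le: "d \<le> J h" if "h \<in> C" for h unfolding d_def using bddJ that by (intro cInf_lower) auto
  have "\<exists>h\<in>C. J h < d + (1/16)^k" for k
    using cInf_lessD[of "J ` C" "d + (1/16)^k"] zero unfolding d_def by auto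
  then obtain f where f: "\<And>k. f k \<in> C" "\<And>k. J (f k) < d + (1/16)^k" by metis
  have fB: "f k \<in> B" for k using f(1) by (simp add: C_def)
  \<comment> \<open>Parallelogram law: the midpoint of two nearly optimal functions lies again in
    \<open>C\<close>, so its \<open>J\<close> is at least \<open>d\<close>.\<close>
  have cauchy: "(\<integral>t. (f (Suc k) t - f k t)\<^sup>2 \<partial>leb I) \<le> 4 * (1/16)^k" for k
  proof -
    let ?a = "f (Suc k)" and ?b = "f k"
    let ?m = "\<lambda>t. (1 - 1/2) * ?a t + (1/2) * ?b t"
    have mB: "?m \<in> B" by (rule convexB[OF fB fB]) auto
    moreover have "?m t \<le> z t" for t
      using f(1)[of k] f(1)[of "Suc k"] by (simp add: C_def) (metis add_mono field_sum_of_halves divide_right_mono zero_le_numeral add_divide_distrib)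
    ultimately have mC: "?m \<in> C" by (simp add: C_def)
    note Z = int2[of ?a ?a] int2[of ?a ?b] int2[of ?b ?b] int2[of z ?a] int2[of z ?b] int2[of z z]
    have "(\<integral>t. (?a t - ?b t)\<^sup>2 \<partial>leb I) = (\<integral>t. ?a t * ?a t \<partial>leb I) - 2 * (\<integral>t. ?a t * ?b t \<partial>leb I) + (\<integral>t. ?b t * ?b t \<partial>leb I)"
      unfolding exp using Z fB by simp
    moreover have "J ?m = (\<integral>t. z t * z t \<partial>leb I) - (\<integral>t. z t * ?a t \<partial>leb I) - (\<integral>t. z t * ?b t \<partial>leb I)
       + (\<integral>t. ?a t * ?a t \<partial>leb I) / 4 + (\<integral>t. ?a t * ?b t \<partial>leb I) / 2 + (\<integral>t. ?b t * ?b t \<partial>leb I) / 4"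
    proof -
      have "(z t - ?m t)\<^sup>2 = z t * z t - z t * ?a t - z t * ?b t + ?a t * ?a t / 4 + ?a t * ?b t / 2 + ?b t * ?b t / 4" for t
        by (simp add: power2_eq_square field_simps)
      then show ?thesis unfolding J_def using Z fB by simp
    qed
    ultimately have "(\<integral>t. (?a t - ?b t)\<^sup>2 \<partial>leb I) = 2 * J ?a + 2 * J ?b - 4 * J ?m"
      using Jeq[OF fB[of k]] Jeq[OF fB[of "Suc k"]] by simp
    also have "\<dots> \<le> 2 * (d + (1/16)^Suc k) + 2 * (d + (1/16)^k) - 4 * d"
      using f(2)[of "Suc k"] f(2)[of k] d_le[OF mC] by (intro diff_mono add_mono mult_left_mono less_imp_le) auto
    also have "\<dots> \<le> 4 * (1/16)^k" by simp
    finally show ?thesis .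
  qed
  obtain g where g: "g \<in> elts X" "g \<in> L0 I" "fnorm X g \<le> 1" "\<And>t. 0 \<le> g t" "\<And>t. g t \<le> z t"
    and lim: "AE t in leb I. (\<lambda>k. f k t) \<longlonglongrightarrow> g t"
  proof -
    have "f k \<in> elts X" "f k \<in> L0 I" "fnorm X (f k) \<le> 1" "0 \<le> f k t" "f k t \<le> z t" for k t
      using f(1)[of k] by (auto simp: C_def B_def)
    from minimizing_sequence_limit[OF X(2,3) z this cauchy] show thesis using that by blast
  qed
  have gB: "g \<in> B" unfolding B_def using g z(3) by (auto intro!: exI[of _ n] intro: order_trans)
  have Jg: "J g \<le> d"
  proof -
    have "(\<lambda>k. J (f k)) \<longlonglongrightarrow> J g"
      unfolding J_def
    proof (rule integral_dominated_convergence[where w="\<lambda>t. z t * z t"])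
      have [measurable]: "z \<in> borel_measurable (leb I)" "g \<in> borel_measurable (leb I)"
        "\<And>i. f i \<in> borel_measurable (leb I)" using hm gB fB by auto
      show "(\<lambda>t. (z t - g t)\<^sup>2) \<in> borel_measurable (leb I)"
        "\<And>i. (\<lambda>t. (z t - f i t)\<^sup>2) \<in> borel_measurable (leb I)" by measurable
      show "integrable (leb I) (\<lambda>t. z t * z t)" by (intro int2) auto
      show "AE t in leb I. (\<lambda>i. (z t - f i t)\<^sup>2) \<longlonglongrightarrow> (z t - g t)\<^sup>2"
        using lim by eventually_elim (intro tendsto_intros)
      fix i show "AE t in leb I. norm ((z t - f i t)\<^sup>2) \<le> z t * z t"
      proof (rule AE_I2)
        fix t have "0 \<le> f i t" "f i t \<le> z t" using f(1)[of i] by (auto simp: C_def B_def)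
        then have "(z t - f i t)\<^sup>2 \<le> (z t)\<^sup>2" by (intro power_mono) auto
        then show "norm ((z t - f i t)\<^sup>2) \<le> z t * z t" by (simp add: power2_eq_square)
      qed
    qed
    moreover have "(\<lambda>k. d + (1/16)^k) \<longlonglongrightarrow> d + 0"
      by (intro tendsto_intros LIMSEQ_power_zero) simp
    ultimately show ?thesis
      using f(2) by (intro LIMSEQ_le[of "\<lambda>k. J (f k)" "J g" "\<lambda>k. d + (1/16)^k" d]) (auto intro: less_imp_le)
  qed
  \<comment> \<open>Cutting h off at z never increases its distance to z, so a minimiser over
    \<open>C\<close> also minimises over the convex set \<open>B\<close>, where the variation below
    takes place.\<close>
  have opt: "J g \<le> J h" if h: "h \<in> B" for h
  proof -
    let ?h = "\<lambda>t. min (h t) (z t)"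
    have h': "h \<in> elts X" "h \<in> L0 I" "fnorm X h \<le> 1" "\<And>t. 0 \<le> h t" using h by (auto simp: B_def)
    have mm: "?h \<in> L0 I" using h' z(1) by (auto simp: L0_def)
    have a: "AE t in leb I. \<bar>?h t\<bar> \<le> \<bar>h t\<bar>" using h'(4) z(2) by auto
    have "?h \<in> elts X" "fnorm X ?h \<le> 1"
      using is_ideal_elts[OF X(2) h'(1) mm a] is_ideal_norm_le[OF X(2) h'(1) mm a] h'(3) by auto
    then have "?h \<in> C" unfolding C_def B_def
      using mm h'(4) z(2,3) by (auto intro!: exI[of _ n] simp: min.coboundedI2)
    then have "J g \<le> J ?h" using d_le Jg by force
    also have "\<dots> \<le> J h"
      unfolding J_def
    proof (rule integral_mono)
      have "?h \<in> B" using \<open>?h \<in> C\<close> by (simp add: C_def)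
      then show "integrable (leb I) (\<lambda>t. (z t - ?h t)\<^sup>2)"
        unfolding exp using int2[of z z] int2[of z ?h] int2[of ?h ?h] by auto
      show "integrable (leb I) (\<lambda>t. (z t - h t)\<^sup>2)"
        unfolding exp using int2[of z z] int2[of z h] int2[of h h] h by auto
      show "(z t - ?h t)\<^sup>2 \<le> (z t - h t)\<^sup>2" for t by (auto simp: min_def)
    qed
    finally show ?thesis .
  qed
  define \<gamma> where "\<gamma> = (\<integral>t. (z t - g t) * g t \<partial>leb I)"
  have eqh: "(z t - g t) * h t = z t * h t - g t * h t" for t h by (simp add: algebra_simps)
  have ih: "integrable (leb I) (\<lambda>t. (z t - g t) * h t)" if "h \<in> B \<or> h = z" for h
    unfolding eqh using int2[of z h] int2[of g h] that gB by auto
  have g0: "0 \<le> \<gamma>" unfolding \<gamma>_def using g by (intro Bochner_Integration.integral_nonneg) auto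
  \<comment> \<open>First variation along the segment from g to h: minimality gives 2 P <= \<theta>
    Q for all small \<theta>, and \<theta> tends to 0.\<close>
  have var: "(\<integral>t. (z t - g t) * h t \<partial>leb I) \<le> \<gamma>" if h: "h \<in> B" for h
  proof -
    define Q where "Q = (\<integral>t. (h t - g t)\<^sup>2 \<partial>leb I)"
    define P where "P = (\<integral>t. (z t - g t) * h t \<partial>leb I) - \<gamma>"
    have *: "2 * P \<le> \<theta> * Q" if th: "0 < \<theta>" "\<theta> < 1" for \<theta>
    proof -
      let ?k = "\<lambda>t. (1 - \<theta>) * g t + \<theta> * h t"
      have kB: "?k \<in> B" by (rule convexB[OF gB h]) (use th in auto)
      note Z = int2[of g g] int2[of g h] int2[of h h] int2[of z g] int2[of z h] int2[of z z]
      have "(z t - ?k t)\<^sup>2 = (z t - g t)\<^sup>2 - 2 * \<theta> * ((z t - g t) * h t - (z t - g t) * g t) + \<theta>\<^sup>2 * (h t - g t)\<^sup>2" for t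
        by (simp add: power2_eq_square algebra_simps)
      moreover have "integrable (leb I) (\<lambda>t. (h t - g t)\<^sup>2)" "integrable (leb I) (\<lambda>t. (z t - g t)\<^sup>2)"
        unfolding exp using int2[of h h] int2[of h g] Z h gB by auto
      ultimately have "J ?k = J g - 2 * \<theta> * P + \<theta>\<^sup>2 * Q"
        unfolding J_def P_def Q_def \<gamma>_def using ih[of h] ih[of g] h gB by simp
      then have "2 * \<theta> * P \<le> \<theta>\<^sup>2 * Q" using opt[OF kB] by linarith
      then have "\<theta> * (2 * P) \<le> \<theta> * (\<theta> * Q)" by (simp add: power2_eq_square algebra_simps)
      then show ?thesis using th by simp
    qed
    have "2 * P \<le> 0"
    proof (rule tendsto_lowerbound[of "\<lambda>\<theta>. \<theta> * Q" 0 "at_right 0"])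
      show "((\<lambda>\<theta>. \<theta> * Q) \<longlongrightarrow> 0) (at_right 0)"
        by (rule tendsto_eq_intros refl | simp)+
      show "\<forall>\<^sub>F \<theta> in at_right 0. 2 * P \<le> \<theta> * Q"
        using * by (auto simp: eventually_at_right_field intro!: exI[of _ 1])
    qed simp
    then show ?thesis by (simp add: P_def)
  qed
  let ?p = "\<lambda>t. z t - g t"
  have pm [measurable]: "?p \<in> borel_measurable (leb I)" using z(1) g(2) by (simp add: L0_def)
  have psupp: "?p t = 0" if "t \<notin> {0<..<n}" for t
    using g(4)[of t] g(5)[of t] z(3)[of t] that by simp
  have pn: "fnorm (koethe_dual I X) ?p \<le> ennreal \<gamma>"
    unfolding koethe_dual_norm
  proof (rule SUP_least, clarify)
    fix y assume y: "y \<in> elts X" "fnorm X y \<le> 1"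
    have ym [measurable]: "y \<in> borel_measurable (leb I)" using normed_spaceD(1)[OF X(1) y(1)] by (simp add: L0_def)
    \<comment> \<open>\<open>var\<close> is available only for elements of \<open>B\<close>. The
      truncations of |y| belong to \<open>B\<close> and increase to |y| on (0,n), outside of which
      the residual vanishes.\<close>
    define h where "h m t = min \<bar>y t\<bar> (real m) * ?i t" for m :: nat and t
    have hmm: "h m \<in> L0 I" for m
      unfolding L0_def h_def
      by (intro borel_measurable_times borel_measurable_min borel_measurable_abs ym
          borel_measurable_const borel_measurable_leb) simp
    have hy: "AE t in leb I. \<bar>h m t\<bar> \<le> \<bar>y t\<bar>" for m by (auto simp: h_def indicator_def)
    have hB: "h m \<in> B" for m
    proof -
      have "\<forall>t. 0 \<le> h m t \<and> h m t \<le> real m * ?i t" by (simp add: h_def indicator_def)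
      then show ?thesis unfolding B_def
        using is_ideal_elts[OF X(2) y(1) hmm hy] order_trans[OF is_ideal_norm_le[OF X(2) y(1) hmm hy] y(2)] hmm
        by blast
    qed
    have "(\<integral>\<^sup>+ t. ennreal \<bar>?p t * y t\<bar> \<partial>leb I) = (\<integral>\<^sup>+ t. (SUP m. ennreal (?p t * h m t)) \<partial>leb I)"
    proof (rule nn_integral_cong)
      fix t
      show "ennreal \<bar>?p t * y t\<bar> = (SUP m. ennreal (?p t * h m t))"
      proof (rule antisym)
        show "ennreal \<bar>?p t * y t\<bar> \<le> (SUP m. ennreal (?p t * h m t))"
        proof (cases "t \<in> {0<..<n}")
          case True
          obtain m where "\<bar>y t\<bar> \<le> real m" using real_arch_simple by blast
          then have "ennreal \<bar>?p t * y t\<bar> = ennreal (?p t * h m t)"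
            using True g(5)[of t] by (simp add: h_def abs_mult)
          then show ?thesis by (auto intro: SUP_upper)
        qed (use psupp[of t] in simp)
        show "(SUP m. ennreal (?p t * h m t)) \<le> ennreal \<bar>?p t * y t\<bar>"
          using g(5)[of t] by (intro SUP_least ennreal_leI) (auto simp: h_def abs_mult indicator_def intro!: mult_left_mono)
      qed
    qed
    also have "\<dots> = (SUP m. \<integral>\<^sup>+ t. ennreal (?p t * h m t) \<partial>leb I)"
    proof (rule nn_integral_monotone_convergence_SUP)
      show "incseq (\<lambda>m t. ennreal (?p t * h m t))"
        using g(5) by (intro incseq_SucI le_funI ennreal_leI mult_left_mono) (auto simp: h_def indicator_def min_def)
      show "\<And>m. (\<lambda>t. ennreal (?p t * h m t)) \<in> borel_measurable (leb I)"
        using hmm unfolding L0_def by measurable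
    qed
    also have "\<dots> \<le> ennreal \<gamma>"
    proof (rule SUP_least)
      fix m
      have "(\<integral>\<^sup>+ t. ennreal (?p t * h m t) \<partial>leb I) = ennreal (\<integral>t. ?p t * h m t \<partial>leb I)"
        using g(5) hB[of m] by (intro nn_integral_eq_integral ih) (auto simp: B_def)
      also have "\<dots> \<le> ennreal \<gamma>" using var[OF hB] by (rule ennreal_leI)
      finally show "(\<integral>\<^sup>+ t. ennreal (?p t * h m t) \<partial>leb I) \<le> ennreal \<gamma>" .
    qed
    finally show "(\<integral>\<^sup>+ t. ennreal \<bar>?p t * y t\<bar> \<partial>leb I) \<le> ennreal \<gamma>" .
  qed
  have "?p \<in> elts (koethe_dual I X)"
    using pn pm by (simp add: koethe_dual_elts L0_def) (metis ennreal_less_top order_le_less_trans infinity_ennreal_def)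
  \<comment> \<open>The hypothesis, tested on the residual p = z - g, gives that the integral of p z
    is at most \<open>\<gamma>\<close>, the integral of p g. Hence p^2 has integral at most 0 and z
    = g almost everywhere.\<close>
  from order_trans[OF dual[OF this] pn]
  have "(\<integral>\<^sup>+ t. ennreal (?p t * z t) \<partial>leb I) \<le> ennreal \<gamma>"
    using g(5) z(2) by (simp add: abs_mult mult.commute)
  then have "ennreal (\<integral>t. ?p t * z t \<partial>leb I) \<le> ennreal \<gamma>"
    using g(5) z(2) by (subst nn_integral_eq_integral[symmetric, OF ih]) auto
  then have "(\<integral>t. ?p t * z t \<partial>leb I) \<le> \<gamma>" using g0 by (simp add: ennreal_le_iff)
  moreover have "(\<integral>t. ?p t * z t \<partial>leb I) - \<gamma> = J g"
    unfolding \<gamma>_def J_def using ih[of z] ih[of g] gB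
    by (subst Bochner_Integration.integral_diff[symmetric]) (auto simp: power2_eq_square algebra_simps)
  ultimately have "J g = 0" using J0[of g] by linarith
  moreover have "integrable (leb I) (\<lambda>t. (z t - g t)\<^sup>2)"
    unfolding exp using int2[of z z] int2[of z g] int2[of g g] gB by auto
  ultimately have "AE t in leb I. (z t - g t)\<^sup>2 = 0"
    unfolding J_def by (subst integral_nonneg_eq_0_iff_AE[symmetric]) auto
  then have "AE t in leb I. \<bar>z t\<bar> \<le> \<bar>g t\<bar>" by eventually_elim auto
  then show ?thesis
    using is_ideal_elts[OF X(2) g(1) z(1)] is_ideal_norm_le[OF X(2) g(1) z(1)] g(3) by auto
qed

text \<open>The assumption places z in the ball of radius c of the second Koethe dual. Truncating
  |z|/c in height and support reduces the claim to \<open>bounded_in_unit_ball\<close>; the Fatou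
  property recovers z from the truncations.\<close>

theorem lorentz_luxemburg:
  assumes X: "normed_space I X" "is_ideal I X" "fatou_property I X"
    and z: "z \<in> L0 I" "0 < c"
    and dual: "\<And>g. g \<in> elts (koethe_dual I X) \<Longrightarrow>
      (\<integral>\<^sup>+t. ennreal \<bar>z t * g t\<bar> \<partial>leb I) \<le> ennreal c * fnorm (koethe_dual I X) g"
  shows "z \<in> elts X" "fnorm X z \<le> ennreal c"
proof -
  have zm [measurable]: "z \<in> borel_measurable (leb I)" using z(1) by (simp add: L0_def)
  define u where "u k t = min (\<bar>z t\<bar> / c) (real (Suc k)) * indicator {0<..<real (Suc k)} t" for k t
  have um: "u k \<in> L0 I" for k
    unfolding u_def L0_def
    by (intro borel_measurable_times borel_measurable_min borel_measurable_divide borel_measurable_abs zm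
        borel_measurable_const borel_measurable_leb) simp
  have u0: "0 \<le> u k t" for k t using z(2) by (simp add: u_def)
  have uz: "u k t \<le> \<bar>z t\<bar> / c" for k t using z(2) by (simp add: u_def indicator_def)
  have ub: "u k \<in> elts X \<and> fnorm X (u k) \<le> 1" for k
  proof (rule bounded_in_unit_ball[OF X um u0, of _ "real (Suc k)"])
    show "u k t \<le> real (Suc k) * indicator {0<..<real (Suc k)} t" for t
      by (simp add: u_def indicator_def)
    fix g assume g: "g \<in> elts (koethe_dual I X)"
    then have [measurable]: "g \<in> borel_measurable (leb I)" by (simp add: koethe_dual_elts L0_def)
    have "ennreal c * (\<integral>\<^sup>+t. ennreal \<bar>u k t * g t\<bar> \<partial>leb I) = (\<integral>\<^sup>+t. ennreal c * ennreal \<bar>u k t * g t\<bar> \<partial>leb I)"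
      using um by (intro nn_integral_cmult[symmetric]) (auto simp: L0_def)
    also have "\<dots> \<le> (\<integral>\<^sup>+t. ennreal \<bar>z t * g t\<bar> \<partial>leb I)"
    proof (rule nn_integral_mono)
      fix t
      have "c * \<bar>u k t * g t\<bar> \<le> \<bar>z t * g t\<bar>"
        using mult_left_mono[OF uz[of k t], of "c * \<bar>g t\<bar>"] u0[of k t] z(2)
        by (simp add: abs_mult mult.commute mult.left_commute)
      then show "ennreal c * ennreal \<bar>u k t * g t\<bar> \<le> ennreal \<bar>z t * g t\<bar>"
        using z(2) by (simp add: ennreal_leI flip: ennreal_mult)
    qed
    also have "\<dots> \<le> ennreal c * fnorm (koethe_dual I X) g" by (rule dual[OF g])
    finally show "(\<integral>\<^sup>+t. ennreal \<bar>u k t * g t\<bar> \<partial>leb I) \<le> fnorm (koethe_dual I X) g"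
      using z(2) by (simp add: ennreal_mult_le_mult_iff)
  qed auto
  let ?w = "\<lambda>t. \<bar>z t\<bar> / c"
  have wm: "?w \<in> L0 I" unfolding L0_def by measurable
  have lim: "AE t in leb I. (\<lambda>k. u k t) \<longlonglongrightarrow> ?w t"
  proof (rule AE_I2)
    fix t assume "t \<in> space (leb I)"
    then have t: "0 < t" using I_pos by simp
    obtain N where N: "max (?w t) t < real N" using reals_Archimedean2 by blast
    have "u k t = ?w t" if "k \<ge> N" for k
      using N that t by (auto simp: u_def indicator_def min_def)
    then show "(\<lambda>k. u k t) \<longlonglongrightarrow> ?w t"
      by (intro tendsto_eventually) (auto simp: eventually_sequentially)
  qed
  have w: "?w \<in> elts X" "fnorm X ?w \<le> ennreal 1"
    using fatou_limit[OF X(2,3) _ um _ u0 wm lim, of 1] ub by auto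
  have "(\<lambda>t. c * ?w t) \<in> elts X" by (rule normed_spaceD(4)[OF X(1) w(1)])
  moreover have "fnorm X (\<lambda>t. c * ?w t) \<le> ennreal c"
    using normed_spaceD(7)[OF X(1) w(1), of c] z(2) mult_left_mono[OF w(2), of "ennreal c"] by simp
  moreover have "AE t in leb I. \<bar>z t\<bar> \<le> \<bar>c * ?w t\<bar>" using z(2) by simp
  ultimately show "z \<in> elts X" "fnorm X z \<le> ennreal c"
    using is_ideal_elts[OF X(2) _ z(1)] is_ideal_norm_le[OF X(2) _ z(1)] by (blast, metis order_trans)
qed


subsection \<open>Realising products of rearrangements\<close>

text \<open>With 2^K the largest power of 2 not exceeding t/2, the measures form a geometric series
  of sum 2 * 2^K <= t. Overlaps are absorbed by subadditivity.\<close>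

lemma emeasure_Un_dyadic_le:
  fixes T :: "int \<Rightarrow> real set"
  assumes "\<And>k. T k \<in> sets (leb I)" "\<And>k. emeasure (leb I) (T k) \<le> ennreal (2 powr k)" "0 < t"
  shows "emeasure (leb I) (\<Union>k\<in>{k. 2 powr k < t / 2}. T k) \<le> ennreal t"
proof -
  define K where "K = \<lfloor>log 2 (t / 2)\<rfloor>"
  have K: "2 powr K \<le> t / 2"
    using assms(3) by (subst le_log_iff[symmetric]) (auto simp: K_def)
  have kK: "k \<le> K" if "2 powr k < t / 2" for k :: int
  proof -
    have "real_of_int k \<le> log 2 (t / 2)"
      using that assms(3) by (subst le_log_iff) auto
    then show ?thesis by (simp add: K_def le_floor_iff)
  qed
  have "(\<Union>k\<in>{k. 2 powr k < t / 2}. T k) \<subseteq> (\<Union>n::nat. T (K - int n))"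
  proof clarify
    fix s k assume "s \<in> T k" "2 powr real_of_int k < t / 2"
    then show "s \<in> (\<Union>n. T (K - int n))" using kK[of k] by (intro UN_I[of "nat (K - k)"]) auto
  qed
  then have "emeasure (leb I) (\<Union>k\<in>{k. 2 powr k < t / 2}. T k) \<le> emeasure (leb I) (\<Union>n::nat. T (K - int n))"
    using assms(1) by (intro emeasure_mono) auto
  also have "\<dots> \<le> (\<Sum>n. emeasure (leb I) (T (K - int n)))"
    using assms(1) by (intro emeasure_subadditive_countably) auto
  also have "\<dots> \<le> (\<Sum>n. ennreal (2 powr K * (1/2)^n))"
  proof (intro suminf_le)
    fix n :: nat
    have "2 powr (K - int n) = 2 powr K * (1/2)^n"
      by (simp add: powr_diff powr_realpow power_divide)
    then show "emeasure (leb I) (T (K - int n)) \<le> ennreal (2 powr K * (1/2)^n)"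
      using assms(2)[of "K - int n"] by simp
  qed auto
  also have "\<dots> = ennreal (\<Sum>n. 2 powr K * (1/2)^n)"
    by (intro suminf_ennreal2 summable_mult summable_geometric) auto
  also have "(\<Sum>n. 2 powr K * (1/2::real)^n) = 2 * 2 powr K"
    by (subst suminf_mult) (auto simp: suminf_geometric intro!: summable_geometric)
  also have "ennreal (2 * 2 powr K) \<le> ennreal t"
    using K by (intro ennreal_leI) simp
  finally show ?thesis .
qed

text \<open>
  The sets \<open>T k\<close> may overlap; since \<open>m(T k) \<le> 2\<^sup>k\<close> this costs only a dilation by \<open>2\<close>. The
  supremum is infinite at most on a null set, where \<open>enn2real\<close> replaces it by \<open>0\<close>.
\<close>

lemma placement:
  fixes T :: "int \<Rightarrow> real set"
  assumes T: "\<And>k. T k \<in> sets (leb I)" "\<And>k. emeasure (leb I) (T k) \<le> ennreal (2 powr k)"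
      "\<And>k. T k \<noteq> {} \<Longrightarrow> 2 powr k \<in> I"
    and a: "nonincr I a"
  shows "\<exists>y\<in>L0 I. rearr_finite I y \<and> (\<forall>t\<in>I. rearr I y t \<le> a (t / 2)) \<and> (\<forall>t. 0 \<le> y t) \<and>
           (\<forall>k. AE s in leb I. s \<in> T k \<longrightarrow> a (2 powr k) \<le> y s)"
proof -
  define Y where "Y s = (SUP k. ennreal (a (2 powr real_of_int k)) * indicator (T k) s)" for s
  have Ym [measurable]: "Y \<in> borel_measurable (leb I)"
    unfolding Y_def using T(1) by (intro borel_measurable_SUP) auto
  define y where "y s = enn2real (Y s)" for s
  have ym: "y \<in> L0 I" unfolding L0_def y_def by measurable
  have y0: "0 \<le> y s" for s by (simp add: y_def)
  \<comment> \<open>If \<open>Y s > a (t / 2)\<close>, then s lies in some \<open>T k\<close> with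
    \<open>a (2 powr k) > a (t / 2)\<close>, and monotonicity forces 2^k < t/2.\<close>
  have tail: "emeasure (leb I) {s\<in>I. ennreal (a (t / 2)) < Y s} \<le> ennreal t" if t: "t \<in> I" for t
  proof -
    have "{s\<in>I. ennreal (a (t / 2)) < Y s} \<subseteq> (\<Union>k\<in>{k::int. 2 powr k < t / 2}. T k)"
    proof
      fix s assume "s \<in> {s\<in>I. ennreal (a (t / 2)) < Y s}"
      then obtain k where k: "ennreal (a (t / 2)) < ennreal (a (2 powr real_of_int k)) * indicator (T k) s"
        by (auto simp: Y_def less_SUP_iff)
      then have s: "s \<in> T k" by (cases "s \<in> T k") auto
      then have kI: "2 powr k \<in> I" using T(3) by auto
      have "a (t / 2) < a (2 powr k)"
        using k s nonincr_nonneg[OF a I_half[OF t]] by (simp add: ennreal_less_iff)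
      then have "\<not> t / 2 \<le> 2 powr k" using nonincr_le[OF a I_half[OF t] kI] by auto
      then show "s \<in> (\<Union>k\<in>{k::int. 2 powr k < t / 2}. T k)"
        using s by (intro UN_I[of k]) auto
    qed
    then have "emeasure (leb I) {s\<in>I. ennreal (a (t / 2)) < Y s} \<le>
        emeasure (leb I) (\<Union>k\<in>{k::int. 2 powr k < t / 2}. T k)"
      using T(1) by (intro emeasure_mono) auto
    also have "\<dots> \<le> ennreal t"
      by (rule emeasure_Un_dyadic_le[OF T(1,2) I_pos[OF t]])
    finally show ?thesis .
  qed
  have sm: "{s\<in>I. c < Y s} \<in> sets (leb I)" for c
  proof -
    have "{s\<in>space (leb I). c < Y s} \<in> sets (leb I)" by measurable
    then show ?thesis by simp
  qed
  have tm: "{s\<in>I. Y s = \<infinity>} \<in> sets (leb I)"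
  proof -
    have "{s\<in>space (leb I). Y s = \<infinity>} \<in> sets (leb I)" by measurable
    then show ?thesis by simp
  qed
  have fin: "AE s in leb I. Y s \<noteq> \<infinity>"
  proof -
    obtain t where t: "t \<in> I" using I_nonempty by auto
    have "emeasure (leb I) {s\<in>I. Y s = \<infinity>} \<le> 0 + ennreal e" if e: "0 < e" for e
    proof -
      define u where "u = min e t"
      have u: "u \<in> I" "u \<le> e" using I_down[OF t, of u] I_pos[OF t] e by (auto simp: u_def)
      have "emeasure (leb I) {s\<in>I. Y s = \<infinity>} \<le> emeasure (leb I) {s\<in>I. ennreal (a (u / 2)) < Y s}"
        by (intro emeasure_mono sm) auto
      also have "\<dots> \<le> ennreal u" by (rule tail[OF u(1)])
      also have "\<dots> \<le> ennreal e" using u by (intro ennreal_leI)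
      finally show ?thesis by simp
    qed
    then have "emeasure (leb I) {s\<in>I. Y s = \<infinity>} \<le> 0" by (rule ennreal_le_epsilon)
    then show ?thesis using tm by (intro AE_I[of _ _ "{s\<in>I. Y s = \<infinity>}"]) auto
  qed
  have d: "distr_fun I y (a (t / 2)) \<le> ennreal t" if t: "t \<in> I" for t
  proof -
    have "{s \<in> I. a (t / 2) < \<bar>y s\<bar>} \<subseteq> {s\<in>I. ennreal (a (t / 2)) < Y s}"
    proof clarify
      fix s assume "a (t / 2) < \<bar>y s\<bar>"
      then have "a (t / 2) < enn2real (Y s)" by (simp add: y_def)
      then show "ennreal (a (t / 2)) < Y s"
        using nonincr_nonneg[OF a I_half[OF t]]
        by (metis ennreal_enn2real_if ennreal_lessI ennreal_less_top order_le_less_trans top.not_eq_extremum)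
    qed
    then show ?thesis using order_trans[OF emeasure_mono[OF _ sm] tail[OF t]] by blast
  qed
  have "rearr_finite I y" unfolding rearr_finite_def
  proof
    fix t assume t: "t \<in> I"
    have "distr_fun I y (a (t/2) + 1) \<le> ennreal t"
      by (rule order_trans[OF distr_mono[OF ym] d[OF t]]) simp
    then show "\<exists>b>0. distr_fun I y b \<le> ennreal t"
      using nonincr_nonneg[OF a I_half[OF t]] by (intro exI[of _ "a (t/2) + 1"]) auto
  qed
  moreover have "\<forall>t\<in>I. rearr I y t \<le> a (t / 2)"
    using rearr_le[OF nonincr_nonneg[OF a I_half] d ym] by blast
  moreover have "AE s in leb I. s \<in> T k \<longrightarrow> a (2 powr k) \<le> y s" for k
    using fin
  proof eventually_elim
    case (elim s)
    show ?case
    proof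
      assume s: "s \<in> T k"
      have "ennreal (a (2 powr k)) * indicator (T k) s \<le> Y s"
        unfolding Y_def by (intro SUP_upper) simp
      then have "ennreal (a (2 powr k)) \<le> Y s" using s by simp
      then show "a (2 powr k) \<le> y s"
        unfolding y_def using elim by (metis enn2real_ennreal enn2real_mono infinity_ennreal_def le_cases ennreal_neg enn2real_nonneg order_trans top.not_eq_extremum)
    qed
  qed
  ultimately show ?thesis using ym y0 by blast
qed

text \<open>The function s |-> m(A \<inter> [0,s]) is 1-Lipschitz, vanishes at 0 and eventually
  exceeds m, so the intermediate value theorem yields a cut of measure exactly m. The strict
  inequality covers the case of infinite measure of A.\<close>

lemma subset_of_emeasure:
  assumes A: "A \<in> sets (leb I)" and m: "0 \<le> m" "ennreal m < emeasure (leb I) A"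
  shows "\<exists>T\<in>sets (leb I). T \<subseteq> A \<and> emeasure (leb I) T = ennreal m"
proof -
  have AI: "A \<subseteq> I" "A \<in> sets lebesgue" using A by (auto simp: sets_leb_iff)
  define \<phi> where "\<phi> s = measure lebesgue (A \<inter> {0..s})" for s
  have lm: "A \<inter> {0..s} \<in> lmeasurable" for s
    by (rule fmeasurableI2[of "{0..s}"]) (use AI in auto)
  have em: "emeasure lebesgue (A \<inter> {0..s}) = ennreal (\<phi> s)" for s
    unfolding \<phi>_def using lm by (simp add: emeasure_eq_measure2 fmeasurableD2)
  have "(SUP n::nat. emeasure lebesgue (A \<inter> {0..real n})) = emeasure lebesgue (\<Union>n. A \<inter> {0..real n})"
    using AI by (intro SUP_emeasure_incseq) (auto simp: incseq_def)
  also have "(\<Union>n. A \<inter> {0..real n}) = A"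
  proof -
    have "\<exists>n. s \<in> A \<inter> {0..real n}" if "s \<in> A" for s
      using real_arch_simple[of s] I_pos[of s] that AI by auto
    then show ?thesis by blast
  qed
  finally have "ennreal m < (SUP n::nat. emeasure lebesgue (A \<inter> {0..real n}))"
    using m(2) AI by (simp add: emeasure_leb)
  then obtain n :: nat where "ennreal m < emeasure lebesgue (A \<inter> {0..real n})"
    by (auto simp: less_SUP_iff)
  then have n: "m < \<phi> n" using m(1) by (simp add: em ennreal_less_iff)
  have lip: "\<phi> t \<le> \<phi> s + (t - s) \<and> \<phi> s \<le> \<phi> t" if "s \<le> t" for s t
  proof
    have "\<phi> t \<le> measure lebesgue (A \<inter> {0..s} \<union> {s..t})"
      unfolding \<phi>_def using lm AI by (intro measure_mono_fmeasurable fmeasurable.Un) auto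
    also have "\<dots> \<le> \<phi> s + measure lebesgue {s..t}"
      unfolding \<phi>_def by (rule measure_Un_le) (use AI in auto)
    finally show "\<phi> t \<le> \<phi> s + (t - s)" using that by simp
    show "\<phi> s \<le> \<phi> t"
      unfolding \<phi>_def using lm AI that by (intro measure_mono_fmeasurable) auto
  qed
  have "1-lipschitz_on {0..real n} \<phi>"
  proof (rule lipschitz_onI)
    fix s t show "dist (\<phi> s) (\<phi> t) \<le> 1 * dist s t"
      using lip[of s t] lip[of t s] by (cases "s \<le> t") (auto simp: dist_real_def)
  qed simp
  then have "continuous_on {0..real n} \<phi>" by (rule lipschitz_on_continuous_on)
  moreover have "\<phi> 0 \<le> m"
  proof -
    have "A \<inter> {0..0} = {}" using I_pos AI by fastforce
    then show ?thesis using m(1) unfolding \<phi>_def by simp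
  qed
  ultimately obtain s where "\<phi> s = m" using IVT'[of \<phi> 0 m "real n"] n by auto
  then have "emeasure (leb I) (A \<inter> {0..s}) = ennreal m"
    using em[of s] AI by (subst emeasure_leb) auto
  moreover have "A \<inter> {0..s} \<in> sets (leb I)" using AI by (auto simp: sets_leb_iff)
  ultimately show ?thesis by blast
qed

text \<open>One level set of finite measure is enough: the higher ones decrease to the empty set,
  and continuity from above makes their measures tend to 0.\<close>

lemma rearr_finite_if_distr_finite:
  assumes x: "x \<in> L0 I" and fin: "distr_fun I x a < \<infinity>"
  shows "rearr_finite I x"
  unfolding rearr_finite_def
proof
  fix t assume t: "t \<in> I"
  let ?A = "\<lambda>n::nat. {s\<in>I. \<bar>a\<bar> + 1 + real n < \<bar>x s\<bar>}"
  have "(INF n. emeasure (leb I) (?A n)) = emeasure (leb I) (\<Inter>n. ?A n)"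
  proof (rule INF_emeasure_decseq)
    show "range ?A \<subseteq> sets (leb I)" using distr_sets[OF x] by auto
    show "decseq ?A" by (auto simp: decseq_def)
    fix n show "emeasure (leb I) (?A n) \<noteq> \<infinity>"
      using distr_mono[OF x, of a "\<bar>a\<bar> + 1 + real n"] fin by (auto simp: top_unique)
  qed
  also have "(\<Inter>n. ?A n) = {}"
  proof -
    have "\<exists>n. s \<notin> ?A n" for s
    proof -
      obtain n where "\<bar>x s\<bar> \<le> real n" using real_arch_simple by blast
      then show ?thesis by (intro exI[of _ n]) auto
    qed
    then show ?thesis by blast
  qed
  finally have "(INF n. emeasure (leb I) (?A n)) < ennreal t" using I_pos[OF t] by simp
  then obtain n where "emeasure (leb I) (?A n) < ennreal t" by (auto simp: INF_less_iff)
  then show "\<exists>b>0. distr_fun I x b \<le> ennreal t"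
    by (intro exI[of _ "\<bar>a\<bar> + 1 + real n"]) auto
qed

text \<open>If x* were infinite, every level set of |x| would have infinite measure. One can then
  pick \<open>T k\<close> of measure 2^k with |x| > 2^k / g(2^k) on it and place g(2^k) there. The
  product exceeds 2^k on a set of measure 2^k for every k, which contradicts finiteness of its
  rearrangement at t = 1.\<close>

lemma rearr_finite_if_products:
  assumes x: "x \<in> L0 I" and g: "nonincr I g" "\<And>t. t \<in> I \<Longrightarrow> 0 < g t"
    and prod: "\<And>y. y \<in> L0 I \<Longrightarrow> rearr_finite I y \<Longrightarrow> (\<And>t. t \<in> I \<Longrightarrow> rearr I y t \<le> g (t / 2)) \<Longrightarrow>
      rearr_finite I (\<lambda>t. x t * y t)"
  shows "rearr_finite I x"
proof (rule ccontr)
  assume "\<not> rearr_finite I x"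
  then have inf: "distr_fun I x a = \<infinity>" for a
    using rearr_finite_if_distr_finite[OF x, of a] by (metis infinity_ennreal_def top.not_eq_extremum)
  have "emeasure (leb I) I = \<infinity>"
  proof -
    have "distr_fun I x 0 \<le> emeasure (leb I) I"
      by (rule emeasure_mono) (auto simp: sets_leb_iff)
    then show ?thesis using inf[of 0] by (simp add: top_unique)
  qed
  then have I: "I = {0<..}" using I_cases by (auto simp: emeasure_leb)
  define Q where "Q k T \<longleftrightarrow> T \<in> sets (leb I) \<and>
      T \<subseteq> {s\<in>I. 2 powr real_of_int k / g (2 powr real_of_int k) < \<bar>x s\<bar>} \<and>
      emeasure (leb I) T = ennreal (2 powr real_of_int k)" for k T
  have "\<exists>T. Q k T" for k
    using subset_of_emeasure[OF distr_sets[OF x], of "2 powr k" "2 powr k / g (2 powr k)"]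
    unfolding Q_def by (auto simp: inf)
  then obtain T where "\<And>k. Q k (T k)" by metis
  then have T: "\<And>k. T k \<in> sets (leb I)"
    "\<And>k. T k \<subseteq> {s\<in>I. 2 powr k / g (2 powr k) < \<bar>x s\<bar>}"
    "\<And>k. emeasure (leb I) (T k) = ennreal (2 powr k)"
    unfolding Q_def by blast+
  obtain y where y: "y \<in> L0 I" "rearr_finite I y" "\<And>t. t \<in> I \<Longrightarrow> rearr I y t \<le> g (t / 2)" "\<And>t. 0 \<le> y t"
    and yT: "\<And>k. AE s in leb I. s \<in> T k \<longrightarrow> g (2 powr k) \<le> y s"
    using placement[of T g] T g(1) I by auto
  have xy: "(\<lambda>t. x t * y t) \<in> L0 I" using x y by (simp add: L0_def)
  have "1 \<in> I" using I by simp
  then obtain a where a: "0 < a" "distr_fun I (\<lambda>t. x t * y t) a \<le> ennreal 1"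
    using prod[OF y(1,2,3)] unfolding rearr_finite_def by blast
  obtain n :: nat where n: "a < 2 ^ n" using real_arch_pow[of 2 a] by auto
  \<comment> \<open>The extra 1 makes 2^k > 1 strictly even for n = 0, so that the measure of
    \<open>T k\<close> exceeds t = 1.\<close>
  define k where "k = int n + 1"
  have ak: "a < 2 powr k" "1 < 2 powr k"
  proof -
    have "2 powr k = 2 * 2 ^ n" by (simp add: k_def powr_add powr_realpow)
    moreover have "(1::real) \<le> 2 ^ n" by simp
    ultimately show "a < 2 powr k" "1 < 2 powr k" using n a(1) by linarith+
  qed
  have gk: "0 < g (2 powr k)" using g(2) I by simp
  have "ennreal 1 < ennreal (2 powr k)" using ak by (simp add: ennreal_lessI)
  also have "\<dots> \<le> distr_fun I (\<lambda>t. x t * y t) a"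
    unfolding T(3)[symmetric]
  proof (rule emeasure_mono_AE[OF _ distr_sets[OF xy]])
    show "AE s in leb I. s \<in> T k \<longrightarrow> s \<in> {s \<in> I. a < \<bar>x s * y s\<bar>}"
      using yT[of k]
    proof eventually_elim
      case (elim s)
      show ?case
      proof
        assume s: "s \<in> T k"
        then have "s \<in> I" "2 powr k / g (2 powr k) < \<bar>x s\<bar>" "g (2 powr k) \<le> y s"
          using T(2)[of k] elim by auto
        then have "2 powr k < \<bar>x s\<bar> * g (2 powr k)" using gk by (simp add: field_simps)
        also have "\<dots> \<le> \<bar>x s\<bar> * y s" using \<open>g (2 powr k) \<le> y s\<close> by (intro mult_left_mono) auto
        finally show "s \<in> {s \<in> I. a < \<bar>x s * y s\<bar>}"
          using ak \<open>s \<in> I\<close> y(4)[of s] by (simp add: abs_mult)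
      qed
    qed
  qed
  finally show False using a(2) by simp
qed

text \<open>The value \<open>a (2 powr k)\<close> is placed on a set of measure 2^k where |x| >
  x*(2^k)/2. The factor 1/2 puts the level strictly below x*(2^k), so the level set has measure
  greater than 2^k and contains such a set. For 2^k <= t < 2^(k+1) the set has measure greater than
  t/4.\<close>

lemma rearr_product_attained:
  assumes x: "x \<in> L0 I" "rearr_finite I x" and a: "nonincr I a"
  shows "\<exists>y\<in>L0 I. rearr_finite I y \<and> (\<forall>t\<in>I. rearr I y t \<le> a (t / 2)) \<and>
           (\<forall>t\<in>I. rearr I x t * a t \<le> 2 * rearr I (\<lambda>t. x t * y t) (t / 4))"
proof -
  \<comment> \<open>Where x*(2^k) = 0 no level lies strictly between, and 2^k may leave
    \<open>I\<close>; in both cases \<open>T k\<close> is empty, and nothing has to be shown for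
    it.\<close>
  define P where "P k \<longleftrightarrow> 2 powr real_of_int k \<in> I \<and> 0 < rearr I x (2 powr k)" for k
  define Q where "Q k T \<longleftrightarrow> T \<in> sets (leb I) \<and> (\<not> P k \<longrightarrow> T = {}) \<and>
      (P k \<longrightarrow> T \<subseteq> {s\<in>I. rearr I x (2 powr real_of_int k) / 2 < \<bar>x s\<bar>}) \<and>
      (P k \<longrightarrow> emeasure (leb I) T = ennreal (2 powr real_of_int k))" for k T
  have "\<exists>T. Q k T" for k
  proof (cases "P k")
    case True
    then have "ennreal (2 powr k) < distr_fun I x (rearr I x (2 powr k) / 2)"
      by (intro less_rearr_imp x) (auto simp: P_def)
    from subset_of_emeasure[OF distr_sets[OF x(1)] _ this] show ?thesis
      using True unfolding Q_def by auto
  qed (auto simp: Q_def)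
  then obtain T where "\<And>k. Q k (T k)" by metis
  then have T: "\<And>k. T k \<in> sets (leb I)" "\<And>k. \<not> P k \<Longrightarrow> T k = {}"
    "\<And>k. P k \<Longrightarrow> T k \<subseteq> {s\<in>I. rearr I x (2 powr k) / 2 < \<bar>x s\<bar>}"
    "\<And>k. P k \<Longrightarrow> emeasure (leb I) (T k) = ennreal (2 powr k)"
    unfolding Q_def by blast+
  have "emeasure (leb I) (T k) \<le> ennreal (2 powr k)" for k
    using T(2,4)[of k] by (cases "P k") auto
  moreover have "T k \<noteq> {} \<Longrightarrow> 2 powr k \<in> I" for k using T(2)[of k] by (auto simp: P_def)
  ultimately obtain y where y: "y \<in> L0 I" "rearr_finite I y" "\<And>t. t \<in> I \<Longrightarrow> rearr I y t \<le> a (t / 2)" "\<And>t. 0 \<le> y t"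
    and yT: "\<And>k. AE s in leb I. s \<in> T k \<longrightarrow> a (2 powr k) \<le> y s"
    using placement[of T a] T(1) a by auto
  have xy: "(\<lambda>t. x t * y t) \<in> L0 I" using x y by (simp add: L0_def)
  note xyf = rearr_mult(1)[OF x y(1,2)]
  have "rearr I x t * a t \<le> 2 * rearr I (\<lambda>t. x t * y t) (t / 4)" if t: "t \<in> I" for t
  proof -
    have t4: "t / 4 \<in> I" using I_half[OF I_half[OF t]] by simp
    define k where "k = \<lfloor>log 2 t\<rfloor>"
    have k: "2 powr k \<le> t" "t < 2 * 2 powr k"
    proof -
      show "2 powr k \<le> t" using I_pos[OF t] by (subst le_log_iff[symmetric]) (auto simp: k_def)
      have "log 2 t < real_of_int k + 1" unfolding k_def by linarith
      then have "t < 2 powr (real_of_int k + 1)" using I_pos[OF t] by (subst (asm) log_less_iff) auto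
      then show "t < 2 * 2 powr k" by (simp add: powr_add)
    qed
    have kI: "2 powr k \<in> I" using I_down[OF t _ k(1)] by simp
    have x0: "0 \<le> rearr I x t" and a0: "0 \<le> a t" using rearr_nonneg[OF x(2) t] nonincr_nonneg[OF a t] .
    show ?thesis
    proof (cases "rearr I x t = 0 \<or> a t = 0")
      case True then show ?thesis using rearr_nonneg[OF xyf t4] by auto
    next
      case False
      then have pos: "0 < rearr I x t" "0 < a t" using x0 a0 by auto
      have le: "rearr I x t \<le> rearr I x (2 powr k)" "a t \<le> a (2 powr k)"
        using nonincr_le[OF rearr_nonincr[OF x] kI t k(1)] nonincr_le[OF a kI t k(1)] .
      then have Pk: "P k" using pos kI by (simp add: P_def)
      have "rearr I x (2 powr k) / 2 * a (2 powr k) \<le> rearr I (\<lambda>t. x t * y t) (t / 4)"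
      proof (rule le_rearr[OF xy xyf t4])
        fix b assume b: "0 \<le> b" "b < rearr I x (2 powr k) / 2 * a (2 powr k)"
        have "ennreal (t / 4) < ennreal (2 powr k)" using k I_pos[OF t] by (intro ennreal_lessI) auto
        also have "\<dots> \<le> distr_fun I (\<lambda>t. x t * y t) b"
          unfolding T(4)[OF Pk, symmetric]
        proof (rule emeasure_mono_AE[OF _ distr_sets[OF xy]])
          show "AE s in leb I. s \<in> T k \<longrightarrow> s \<in> {s \<in> I. b < \<bar>x s * y s\<bar>}"
            using yT[of k]
          proof eventually_elim
            case (elim s)
            show ?case
            proof
              assume s: "s \<in> T k"
              then have "s \<in> I" "rearr I x (2 powr k) / 2 < \<bar>x s\<bar>" "a (2 powr k) \<le> y s"
                using T(3)[OF Pk] elim by auto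
              then have "rearr I x (2 powr k) / 2 * a (2 powr k) \<le> \<bar>x s\<bar> * y s"
                using pos le by (intro mult_mono) auto
              then show "s \<in> {s \<in> I. b < \<bar>x s * y s\<bar>}"
                using b(2) \<open>s \<in> I\<close> y(4)[of s] by (simp add: abs_mult)
            qed
          qed
        qed
        finally show "ennreal (t / 4) < distr_fun I (\<lambda>t. x t * y t) b" .
      qed
      moreover have "rearr I x t * a t \<le> rearr I x (2 powr k) * a (2 powr k)"
        using le pos by (intro mult_mono) auto
      ultimately show ?thesis by simp
    qed
  qed
  then show ?thesis using y by blast
qed

end

subsection \<open>Hardy-type operators\<close>

text \<open>The common ground of E and F' in the dilation and factorization arguments: E is a normed
  space, while for the Koethe dual only homogeneity and the ideal property are established.\<close>

definition homogeneous :: "fspace \<Rightarrow> bool" where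
  "homogeneous X \<longleftrightarrow> (\<forall>x\<in>elts X. \<forall>c::real.
     (\<lambda>t. c * x t) \<in> elts X \<and> fnorm X (\<lambda>t. c * x t) = ennreal \<bar>c\<bar> * fnorm X x)"

lemma normed_space_homogeneous: "normed_space I X \<Longrightarrow> homogeneous X"
  by (simp add: homogeneous_def normed_spaceD(4,7))

lemma homogeneousD:
  assumes "homogeneous X" "x \<in> elts X"
  shows "(\<lambda>t. c * x t) \<in> elts X" "fnorm X (\<lambda>t. c * x t) = ennreal \<bar>c\<bar> * fnorm X x"
  using assms by (auto simp: homogeneous_def)

lemma koethe_dual_ideal: "is_ideal I (koethe_dual I X)"
  unfolding is_ideal_def
proof (intro ballI impI)
  fix y x assume y: "y \<in> elts (koethe_dual I X)" and x: "x \<in> L0 I"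
    and le: "AE t in leb I. \<bar>x t\<bar> \<le> \<bar>y t\<bar>"
  have "fnorm (koethe_dual I X) x \<le> fnorm (koethe_dual I X) y"
    unfolding koethe_dual_norm
  proof (rule SUP_mono, rule bexI)
    fix z assume "z \<in> {y \<in> elts X. fnorm X y \<le> 1}"
    show "(\<integral>\<^sup>+t. ennreal \<bar>x t * z t\<bar> \<partial>leb I) \<le> (\<integral>\<^sup>+t. ennreal \<bar>y t * z t\<bar> \<partial>leb I)"
      using le by (intro nn_integral_mono_AE) (auto elim!: eventually_mono intro!: ennreal_leI mult_right_mono simp: abs_mult)
  qed
  then show "x \<in> elts (koethe_dual I X) \<and> fnorm (koethe_dual I X) x \<le> fnorm (koethe_dual I X) y"
    using x y by (auto simp: koethe_dual_elts)
qed

lemma koethe_dual_homogeneous: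
  assumes "elts X \<subseteq> L0 I"
  shows "homogeneous (koethe_dual I X)"
  unfolding homogeneous_def
proof (intro ballI allI)
  fix x and c :: real assume x: "x \<in> elts (koethe_dual I X)"
  have "fnorm (koethe_dual I X) (\<lambda>t. c * x t) = ennreal \<bar>c\<bar> * fnorm (koethe_dual I X) x"
    unfolding koethe_dual_norm SUP_mult_left_ennreal
  proof (rule SUP_cong[OF refl])
    fix y assume "y \<in> {y \<in> elts X. fnorm X y \<le> 1}"
    then have [measurable]: "y \<in> borel_measurable (leb I)" "x \<in> borel_measurable (leb I)"
      using assms x by (auto simp: koethe_dual_elts L0_def)
    have "(\<integral>\<^sup>+ t. ennreal \<bar>c * x t * y t\<bar> \<partial>leb I) = (\<integral>\<^sup>+ t. ennreal \<bar>c\<bar> * ennreal \<bar>x t * y t\<bar> \<partial>leb I)"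
      by (intro nn_integral_cong) (simp add: abs_mult mult.assoc flip: ennreal_mult)
    also have "\<dots> = ennreal \<bar>c\<bar> * (\<integral>\<^sup>+ t. ennreal \<bar>x t * y t\<bar> \<partial>leb I)"
      by (rule nn_integral_cmult) measurable
    finally show "(\<integral>\<^sup>+ t. ennreal \<bar>c * x t * y t\<bar> \<partial>leb I) = ennreal \<bar>c\<bar> * (\<integral>\<^sup>+ t. ennreal \<bar>x t * y t\<bar> \<partial>leb I)" .
  qed
  then show "(\<lambda>t. c * x t) \<in> elts (koethe_dual I X) \<and>
      fnorm (koethe_dual I X) (\<lambda>t. c * x t) = ennreal \<bar>c\<bar> * fnorm (koethe_dual I X) x"
    using x by (auto simp: koethe_dual_elts L0_def ennreal_mult_less_top)
qed

lemma koethe_dual_Holder: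
  assumes X: "normed_space I X" and x: "x \<in> elts X" and g: "g \<in> L0 I"
  shows "(\<integral>\<^sup>+t. ennreal \<bar>g t * x t\<bar> \<partial>leb I) \<le> fnorm X x * fnorm (koethe_dual I X) g"
\<comment> \<open>Here x cannot be normalised. The dual norm of g may be infinite, and 0 times
  infinity is 0 in \<open>ennreal\<close>, so the integral itself must be shown to vanish.\<close>
proof (cases "fnorm X x = 0")
  case True
  then have "AE t in leb I. x t = 0" using normed_spaceD(6)[OF X x] by simp
  then have "(\<integral>\<^sup>+t. ennreal \<bar>g t * x t\<bar> \<partial>leb I) = (\<integral>\<^sup>+t. 0 \<partial>leb I)"
    by (intro nn_integral_cong_AE) (auto elim!: eventually_mono)
  then show ?thesis by simp
next
  case False
  have [measurable]: "x \<in> borel_measurable (leb I)" "g \<in> borel_measurable (leb I)"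
    using normed_spaceD(1)[OF X x] g by (auto simp: L0_def)
  obtain c where c: "fnorm X x = ennreal c" "0 < c"
    using False normed_spaceD(5)[OF X x]
    by (cases "fnorm X x") (auto simp: less_le)
  let ?y = "\<lambda>t. (1 / c) * x t"
  have "?y \<in> elts X" "fnorm X ?y \<le> 1"
    using normed_spaceD(4,7)[OF X x, of "1/c"] c by (auto simp flip: ennreal_mult)
  then have "(\<integral>\<^sup>+t. ennreal \<bar>g t * ?y t\<bar> \<partial>leb I) \<le> fnorm (koethe_dual I X) g"
    unfolding koethe_dual_norm by (intro SUP_upper) auto
  then have "ennreal c * (\<integral>\<^sup>+t. ennreal \<bar>g t * ?y t\<bar> \<partial>leb I) \<le> fnorm X x * fnorm (koethe_dual I X) g"
    unfolding c by (intro mult_left_mono) auto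
  also have "ennreal c * (\<integral>\<^sup>+t. ennreal \<bar>g t * ?y t\<bar> \<partial>leb I) = (\<integral>\<^sup>+t. ennreal c * ennreal \<bar>g t * ?y t\<bar> \<partial>leb I)"
    by (intro nn_integral_cmult[symmetric]) measurable
  also have "\<dots> = (\<integral>\<^sup>+t. ennreal \<bar>g t * x t\<bar> \<partial>leb I)"
    using c(2) by (intro nn_integral_cong) (simp add: abs_mult flip: ennreal_mult)
  finally show ?thesis .
qed

text \<open>The best weight is \<open>\<alpha> = sqrt (B / A)\<close>. It degenerates when A or B is
  0, so both are enlarged by e, which then tends to 0.\<close>

lemma le_two_sqrt_if_weighted:
  fixes A B c :: real
  assumes "0 \<le> A" "0 \<le> B" "0 \<le> c" and le: "\<And>\<alpha>. 0 < \<alpha> \<Longrightarrow> c \<le> \<alpha> * A + B / \<alpha>"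
  shows "c\<^sup>2 \<le> 4 * (A * B)"
proof -
  have "c\<^sup>2 \<le> 4 * ((A + e) * (B + e))" if e: "0 < e" for e
  proof -
    define p q where "p = sqrt (A + e)" and "q = sqrt (B + e)"
    have pq: "0 < p" "0 < q" "p\<^sup>2 = A + e" "q\<^sup>2 = B + e" using assms e by (auto simp: p_def q_def)
    have "c \<le> (q / p) * A + B / (q / p)" using pq by (intro le) simp
    also have "\<dots> \<le> (q / p) * p\<^sup>2 + q\<^sup>2 / (q / p)"
      using pq e by (intro add_mono mult_left_mono divide_right_mono) auto
    also have "\<dots> = 2 * (p * q)" using pq(1,2) by (simp add: power2_eq_square)
    finally have "c\<^sup>2 \<le> (2 * (p * q))\<^sup>2" using assms by (intro power_mono)
    then show ?thesis by (simp add: power_mult_distrib pq)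
  qed
  then have "\<forall>\<^sub>F e in at_right 0. c\<^sup>2 \<le> 4 * ((A + e) * (B + e))"
    by (auto simp: eventually_at_right_field intro!: exI[of _ 1])
  moreover have "((\<lambda>e. 4 * ((A + e) * (B + e))) \<longlongrightarrow> 4 * ((A + 0) * (B + 0))) (at_right 0)"
    by (intro tendsto_intros)
  ultimately have "c\<^sup>2 \<le> 4 * ((A + 0) * (B + 0))"
    by (intro tendsto_lowerbound) auto
  then show ?thesis by simp
qed

context half_interval
begin

section \<open>Tonelli duality and pointwise bounds for the Hardy-type operators\<close>

lemma sigma_finite_leb: "sigma_finite_measure (leb I)"
proof
  let ?A = "\<lambda>n::nat. I \<inter> {0<..<real n}"
  have s: "?A n \<in> sets (leb I)" for n by (simp add: sets_leb_iff sets.Int)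
  have "emeasure (leb I) (?A n) \<noteq> \<infinity>" for n
  proof -
    have "emeasure (leb I) (?A n) \<le> emeasure lebesgue {0<..<real n}"
      by (subst emeasure_leb) (blast, rule emeasure_mono, auto)
    also have "\<dots> = ennreal n" by simp
    finally show ?thesis by (auto simp: top_unique)
  qed
  moreover have "(\<Union>n. ?A n) = I"
  proof -
    have "\<exists>n. t \<in> ?A n" if "t \<in> I" for t
      using reals_Archimedean2[of t] I_pos[OF that] that by auto
    then show ?thesis by blast
  qed
  ultimately show "\<exists>A. countable A \<and> A \<subseteq> sets (leb I) \<and> \<Union> A = space (leb I) \<and> (\<forall>a\<in>A. emeasure (leb I) a \<noteq> \<infinity>)"
    using s by (intro exI[of _ "range ?A"]) auto
qed

lemma ennreal_cohardy:
  assumes "cohardy_defined I h" "\<And>s. 0 \<le> h s" "t \<in> I"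
  shows "ennreal (cohardy I h t) = (\<integral>\<^sup>+s. ennreal (h s / s) * indicator {t<..} s \<partial>leb I)"
    "0 \<le> cohardy I h t"
proof -
  let ?f = "\<lambda>s. indicator (I \<inter> {t<..}) s * (h s / s)"
  have pos: "0 \<le> ?f s" for s
    using assms(2)[of s] I_pos[of s] by (auto simp: indicator_def)
  have int: "integrable lebesgue ?f"
    using assms(1,3) by (simp add: cohardy_defined_def set_integrable_def)
  have eq: "cohardy I h t = (\<integral>s. ?f s \<partial>lebesgue)"
    by (simp add: cohardy_def set_lebesgue_integral_def)
  show "0 \<le> cohardy I h t" unfolding eq using pos by (intro Bochner_Integration.integral_nonneg)
  have "ennreal (cohardy I h t) = (\<integral>\<^sup>+s. ennreal (?f s) \<partial>lebesgue)"
    unfolding eq using pos by (intro nn_integral_eq_integral[symmetric] int) auto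
  also have "\<dots> = (\<integral>\<^sup>+s. ennreal (h s / s) * indicator {t<..} s * indicator I s \<partial>lebesgue)"
    by (intro nn_integral_cong) (auto simp: indicator_def)
  also have "\<dots> = (\<integral>\<^sup>+s. ennreal (h s / s) * indicator {t<..} s \<partial>leb I)"
    by (subst nn_integral_restrict_space) auto
  finally show "ennreal (cohardy I h t) = (\<integral>\<^sup>+s. ennreal (h s / s) * indicator {t<..} s \<partial>leb I)" .
qed

lemma cohardy_nonincr:
  assumes "cohardy_defined I h" "\<And>s. 0 \<le> h s"
  shows "nonincr I (cohardy I h)"
  unfolding nonincr_def
proof (intro conjI ballI impI)
  show "0 \<le> cohardy I h t" if "t \<in> I" for t by (rule ennreal_cohardy(2)[OF assms that])
  fix s t assume st: "s \<in> I" "t \<in> I" "s \<le> t"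
  have "ennreal (cohardy I h t) \<le> ennreal (cohardy I h s)"
    unfolding ennreal_cohardy(1)[OF assms st(1)] ennreal_cohardy(1)[OF assms st(2)]
    using st by (intro nn_integral_mono mult_left_mono) (auto simp: indicator_def)
  then show "cohardy I h t \<le> cohardy I h s"
    using ennreal_cohardy(2)[OF assms st(1)] by (simp add: ennreal_le_iff)
qed

lemma cohardy_r_nonincr:
  assumes "cohardy_r_defined I r u" "0 < r"
  shows "nonincr I (cohardy_r I r u)"
proof -
  have n: "nonincr I (cohardy I (\<lambda>s. \<bar>u s\<bar> powr r))"
    using assms(1) unfolding cohardy_r_defined_def by (rule cohardy_nonincr) simp
  show ?thesis
    unfolding nonincr_def cohardy_r_def
    using nonincr_nonneg[OF n] nonincr_le[OF n] assms(2) by (auto intro!: powr_mono2)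
qed

text \<open>Integrating \<open>w \<le> H w\<close> against \<open>h\<close> and moving \<open>H\<close> to \<open>h\<close> by Tonelli.\<close>

lemma nonincr_cohardy_duality:
  assumes w: "nonincr I w" and h: "h \<in> L0 I" "\<And>s. 0 \<le> h s" "cohardy_defined I h"
  shows "(\<integral>\<^sup>+t. ennreal (w t * h t) \<partial>leb I) \<le> (\<integral>\<^sup>+t. ennreal (w t * cohardy I h t) \<partial>leb I)"
proof -
  interpret sigma_finite_measure "leb I" by (rule sigma_finite_leb)
  interpret pair_sigma_finite "leb I" "leb I" ..
  have wm [measurable]: "w \<in> borel_measurable (leb I)" using nonincr_L0[OF w] by (simp add: L0_def)
  have hm [measurable]: "h \<in> borel_measurable (leb I)" using h(1) by (simp add: L0_def)
  have idm [measurable]: "(\<lambda>s::real. s) \<in> borel_measurable (leb I)" by (rule borel_measurable_leb) simp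
  let ?f = "\<lambda>(t, s). ennreal (w t) * (ennreal (h s / s) * indicator {t<..} s)"
  have i1: "(\<lambda>p. fst p) \<in> borel_measurable (leb I \<Otimes>\<^sub>M leb I)"
    by (rule measurable_compose[OF measurable_fst idm])
  have i2: "(\<lambda>p. snd p) \<in> borel_measurable (leb I \<Otimes>\<^sub>M leb I)"
    by (rule measurable_compose[OF measurable_snd idm])
  have "{p \<in> space (leb I \<Otimes>\<^sub>M leb I). fst p < snd p} \<in> sets (leb I \<Otimes>\<^sub>M leb I)"
    using i1 i2 by (rule borel_measurable_less)
  then have i3: "indicator {p \<in> space (leb I \<Otimes>\<^sub>M leb I). fst p < snd p} \<in> borel_measurable (leb I \<Otimes>\<^sub>M leb I)"
    by (rule borel_measurable_indicator)
  have fm: "?f \<in> borel_measurable (leb I \<Otimes>\<^sub>M leb I)"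
  \<comment> \<open>The set \<open>{t<..}\<close> varies with the other variable. Its indicator is
    rewritten as that of the set where fst p < snd p, which is measurable because both projections
    are.\<close>
  proof (subst measurable_cong)
    show "?f p = ennreal (w (fst p)) * (ennreal (h (snd p) / snd p) *
        indicator {p \<in> space (leb I \<Otimes>\<^sub>M leb I). fst p < snd p} p)"
      if "p \<in> space (leb I \<Otimes>\<^sub>M leb I)" for p
      using that by (cases p) (auto simp: indicator_def)
    show "(\<lambda>p. ennreal (w (fst p)) * (ennreal (h (snd p) / snd p) *
        indicator {p \<in> space (leb I \<Otimes>\<^sub>M leb I). fst p < snd p} p)) \<in> borel_measurable (leb I \<Otimes>\<^sub>M leb I)"
      using i3 by measurable
  qed
  have "(\<integral>\<^sup>+t. ennreal (w t * cohardy I h t) \<partial>leb I) = (\<integral>\<^sup>+t. (\<integral>\<^sup>+s. ?f (t, s) \<partial>leb I) \<partial>leb I)"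
  proof (rule nn_integral_cong)
    fix t assume "t \<in> space (leb I)"
    then have t: "t \<in> I" by simp
    have "ennreal (w t * cohardy I h t) = ennreal (w t) * (\<integral>\<^sup>+s. ennreal (h s / s) * indicator {t<..} s \<partial>leb I)"
      using nonincr_nonneg[OF w t] ennreal_cohardy[OF h(3,2) t] by (simp add: ennreal_mult)
    also have "\<dots> = (\<integral>\<^sup>+s. ?f (t, s) \<partial>leb I)"
      by (subst nn_integral_cmult[symmetric]) (auto intro!: borel_measurable_times_ennreal borel_measurable_leb)
    finally show "ennreal (w t * cohardy I h t) = (\<integral>\<^sup>+s. ?f (t, s) \<partial>leb I)" .
  qed
  also have "\<dots> = (\<integral>\<^sup>+s. (\<integral>\<^sup>+t. ?f (t, s) \<partial>leb I) \<partial>leb I)"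
    using Fubini'[of "\<lambda>t s. ?f (t, s)"] fm by (simp add: case_prod_beta')
  \<comment> \<open>The inequality w <= H w in the form s w(s) <= integral of w over (0,s),
    multiplied by h(s)/s.\<close>
  also have "\<dots> \<ge> (\<integral>\<^sup>+s. ennreal (w s * h s) \<partial>leb I)"
  proof (rule nn_integral_mono)
    fix s assume "s \<in> space (leb I)"
    then have s: "s \<in> I" by simp
    have ss: "{0<..<s} \<in> sets (leb I)" using I_Ioo[OF s] by (simp add: sets_leb_iff)
    have "ennreal (w s * h s) = ennreal (h s / s) * (ennreal (w s) * ennreal s)"
      using nonincr_nonneg[OF w s] h(2)[of s] I_pos[OF s] by (simp flip: ennreal_mult)
    also have "ennreal (w s) * ennreal s = (\<integral>\<^sup>+t. ennreal (w s) * indicator {0<..<s} t \<partial>leb I)"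
      using ss by (simp add: nn_integral_cmult_indicator emeasure_leb_Ioo[OF s])
    also have "ennreal (h s / s) * \<dots> = (\<integral>\<^sup>+t. ennreal (h s / s) * (ennreal (w s) * indicator {0<..<s} t) \<partial>leb I)"
      using ss by (intro nn_integral_cmult[symmetric]) auto
    also have "\<dots> \<le> (\<integral>\<^sup>+t. ?f (t, s) \<partial>leb I)"
    proof (rule nn_integral_mono)
      fix t assume "t \<in> space (leb I)"
      then have t: "t \<in> I" by simp
      show "ennreal (h s / s) * (ennreal (w s) * indicator {0<..<s} t) \<le> ?f (t, s)"
      proof (cases "t < s")
        case True
        then have "ennreal (w s) \<le> ennreal (w t)" using nonincr_le[OF w t s] by (simp add: ennreal_leI)
        then have "ennreal (h s / s) * ennreal (w s) \<le> ennreal (h s / s) * ennreal (w t)"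
          by (rule mult_left_mono) simp
        then show ?thesis using True I_pos[OF t] by (simp add: mult.commute)
      qed simp
    qed
    finally show "ennreal (w s * h s) \<le> (\<integral>\<^sup>+t. ?f (t, s) \<partial>leb I)" .
  qed
  finally show ?thesis .
qed

text \<open>
  For nonincreasing \<open>z = u v\<close> the Cauchy-Schwarz inequality on \<open>(t/2, t)\<close>, in its weighted
  arithmetic-geometric form, bounds \<open>z t\<close> by a product of nonincreasing functions.
\<close>

lemma nonincr_factor_bound:
  assumes z: "nonincr I z" and uv: "u \<in> L0 I" "v \<in> L0 I" "AE t in leb I. z t = u t * v t"
    and r: "0 < r" and def: "cohardy_r_defined I r u" "cohardy_r_defined I r v"
    and t: "t \<in> I"
  shows "z t \<le> 4 powr (1 / r) * (dil2 (cohardy_r I r u) t * dil2 (cohardy_r I r v) t)"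
proof -
  let ?p = "\<lambda>s. \<bar>u s\<bar> powr r" and ?q = "\<lambda>s. \<bar>v s\<bar> powr r"
  define A where "A = cohardy I ?p (t/2)"
  define B where "B = cohardy I ?q (t/2)"
  note h = I_half[OF t]
  have dp: "cohardy_defined I ?p" "cohardy_defined I ?q"
    using def by (auto simp: cohardy_r_defined_def)
  have A: "ennreal A = (\<integral>\<^sup>+s. ennreal (?p s / s) * indicator {t/2<..} s \<partial>leb I)" "0 \<le> A"
    unfolding A_def using ennreal_cohardy[OF dp(1) _ h] by auto
  have B: "ennreal B = (\<integral>\<^sup>+s. ennreal (?q s / s) * indicator {t/2<..} s \<partial>leb I)" "0 \<le> B"
    unfolding B_def using ennreal_cohardy[OF dp(2) _ h] by auto
  have z0: "0 \<le> z t" using nonincr_nonneg[OF z t] .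
  \<comment> \<open>By the factorization, c is at most the geometric mean of |u|^r and |v|^r on
    (t/2,t), which any weight \<alpha> splits into a sum.\<close>
  define c where "c = sqrt (z t powr r)"
  have c0: "0 \<le> c" by (simp add: c_def)
  have [measurable]: "u \<in> borel_measurable (leb I)" "v \<in> borel_measurable (leb I)"
    using uv by (auto simp: L0_def)
  have idm [measurable]: "(\<lambda>s::real. s) \<in> borel_measurable (leb I)" by (rule borel_measurable_leb) simp
  have im [measurable]: "(indicator {t/2<..} :: real \<Rightarrow> ennreal) \<in> borel_measurable (leb I)"
    by (rule measurable_restrict_space1, rule measurable_completion) simp
  have ss: "{t/2<..<t} \<in> sets (leb I)" using I_down[OF t] I_pos[OF t] by (auto simp: sets_leb_iff)
  have "c \<le> \<alpha> * A + B / \<alpha>" if \<alpha>: "0 < \<alpha>" for \<alpha>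
  proof -
    have ae: "AE s in leb I. ennreal (2 * c / t) * indicator {t/2<..<t} s \<le>
        ennreal \<alpha> * (ennreal (?p s / s) * indicator {t/2<..} s) +
        ennreal (1/\<alpha>) * (ennreal (?q s / s) * indicator {t/2<..} s)"
      using uv(3) AE_space
    proof eventually_elim
      case (elim s)
      show ?case
      proof (cases "s \<in> {t/2<..<t}")
        case True
        then have s: "s \<in> I" "0 < s" "s < t" using I_down[OF t, of s] I_pos[OF t] by auto
        have "z t \<le> z s" using nonincr_le[OF z s(1) t] s by simp
        also have "z s = \<bar>u s\<bar> * \<bar>v s\<bar>"
          using elim(1) nonincr_nonneg[OF z s(1)] by (simp flip: abs_mult)
        finally have "z t powr r \<le> (\<bar>u s\<bar> * \<bar>v s\<bar>) powr r"
          using z0 r by (intro powr_mono2) auto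
        also have "\<dots> = ?p s * ?q s" by (simp add: powr_mult)
        finally have "c \<le> sqrt (?p s * ?q s)" by (simp add: c_def)
        also have "?p s * ?q s = (\<alpha> * ?p s) * (?q s / \<alpha>)" using \<alpha> by simp
        also have "sqrt \<dots> \<le> ((\<alpha> * ?p s) + (?q s / \<alpha>)) / 2"
          using \<alpha> by (intro arith_geo_mean_sqrt) auto
        finally have c2: "2 * c \<le> \<alpha> * ?p s + ?q s / \<alpha>" by simp
        have "2 * c / t \<le> 2 * c / s" using s c0 by (intro divide_left_mono) auto
        also have "\<dots> \<le> (\<alpha> * ?p s + ?q s / \<alpha>) / s" using c2 s by (intro divide_right_mono) auto
        also have "\<dots> = \<alpha> * (?p s / s) + (1/\<alpha>) * (?q s / s)" by (simp add: add_divide_distrib)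
        finally have "ennreal (2 * c / t) \<le> ennreal (\<alpha> * (?p s / s) + (1/\<alpha>) * (?q s / s))"
          by (rule ennreal_leI)
        also have "\<dots> = ennreal \<alpha> * ennreal (?p s / s) + ennreal (1/\<alpha>) * ennreal (?q s / s)"
          using \<alpha> s by (simp flip: ennreal_mult ennreal_plus)
        finally show ?thesis using True by simp
      qed simp
    qed
    \<comment> \<open>The interval (t/2,t) has length t/2 and 1/s >= 1/t on it. Averaging over it
      turns the pointwise bound into one by the two integrals from t/2 on, that is, H* at
      t/2.\<close>
    have "ennreal c = ennreal (2 * c / t) * ennreal (t / 2)"
      using c0 I_pos[OF t] by (simp flip: ennreal_mult)
    also have "ennreal (t / 2) = emeasure (leb I) {t/2<..<t}"
      using ss I_pos[OF t] by (subst emeasure_leb) (auto simp: sets_leb_iff)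
    also have "ennreal (2 * c / t) * emeasure (leb I) {t/2<..<t} =
        (\<integral>\<^sup>+s. ennreal (2 * c / t) * indicator {t/2<..<t} s \<partial>leb I)"
      using ss by (simp add: nn_integral_cmult_indicator)
    also have "\<dots> \<le> (\<integral>\<^sup>+s. ennreal \<alpha> * (ennreal (?p s / s) * indicator {t/2<..} s) +
        ennreal (1/\<alpha>) * (ennreal (?q s / s) * indicator {t/2<..} s) \<partial>leb I)"
      by (rule nn_integral_mono_AE[OF ae])
    also have "\<dots> = ennreal \<alpha> * ennreal A + ennreal (1/\<alpha>) * ennreal B"
      unfolding A B by (subst nn_integral_add) (auto simp: nn_integral_cmult)
    also have "\<dots> = ennreal (\<alpha> * A + B / \<alpha>)"
      using \<alpha> A(2) B(2) by (simp flip: ennreal_mult ennreal_plus)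
    finally have "ennreal c \<le> ennreal (\<alpha> * A + B / \<alpha>)" .
    moreover have "0 \<le> \<alpha> * A + B / \<alpha>" using \<alpha> A(2) B(2) by simp
    ultimately show ?thesis by (simp only: ennreal_le_iff)
  qed
  then have "c\<^sup>2 \<le> 4 * (A * B)" by (rule le_two_sqrt_if_weighted[OF A(2) B(2) c0])
  then have "z t powr r \<le> 4 * (A * B)" by (simp add: c_def)
  then have "(z t powr r) powr (1/r) \<le> (4 * (A * B)) powr (1/r)" using r by (intro powr_mono2) auto
  also have "(z t powr r) powr (1/r) = z t" using r z0 by (simp add: powr_powr)
  also have "(4 * (A * B)) powr (1/r) = 4 powr (1/r) * (A powr (1/r) * B powr (1/r))"
    using A(2) B(2) by (simp add: powr_mult)
  finally show ?thesis by (simp add: dil2_def cohardy_r_def A_def B_def)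
qed

text \<open>Only the part of the integral over (0,d) is kept. The choice of d determines the use:
  t/2 gives dilation, min(t0,t) gives a positive minorant.\<close>

lemma hardy_r_lower_bound:
  assumes b: "hardy_r_defined I r b" and r: "0 < r" and t: "t \<in> I"
    and c: "0 \<le> c" "\<And>s. 0 < s \<Longrightarrow> s < d \<Longrightarrow> c \<le> b s" and d: "0 < d" "d \<le> t"
  shows "(d / t) powr (1/r) * c \<le> hardy_r r b t"
proof -
  have int: "integrable lebesgue (\<lambda>s. indicator {0<..<t} s * \<bar>b s\<bar> powr r)"
    using b t by (simp add: hardy_r_defined_def hardy_defined_def set_integrable_def)
  have "d * c powr r = (\<integral>s. indicator {0<..<d} s * c powr r \<partial>lebesgue)"
    using d by simp
  also have "\<dots> \<le> (\<integral>s. indicator {0<..<t} s * \<bar>b s\<bar> powr r \<partial>lebesgue)"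
  proof (rule integral_mono[OF _ int])
    show "integrable lebesgue (\<lambda>s. indicator {0<..<d} s * c powr r)"
      using d by (intro integrable_mult_left integrable_real_indicator) auto
    show "indicator {0<..<d} s * c powr r \<le> indicator {0<..<t} s * \<bar>b s\<bar> powr r" for s
      using c(1) c(2)[of s] d r by (auto simp: indicator_def intro!: powr_mono2)
  qed
  finally have "(d / t) * c powr r \<le> hardy (\<lambda>s. \<bar>b s\<bar> powr r) t"
    using I_pos[OF t] by (simp add: hardy_def set_lebesgue_integral_def field_simps)
  then have "((d / t) * c powr r) powr (1/r) \<le> hardy_r r b t"
    unfolding hardy_r_def using d r I_pos[OF t] by (intro powr_mono2) auto
  also have "((d / t) * c powr r) powr (1/r) = (d / t) powr (1/r) * c"
    unfolding powr_mult powr_powr using c(1) r by simp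
  finally show ?thesis .
qed

text \<open>On (0,t/2) the rearrangement of \<open>a\<close> is at least \<open>a (t / 2)\<close>,
  so D_2 a <= 2^(1/r) H_r a*. The detour through a* is forced because H_r is controlled on
  rearrangements only; a* <= a returns to \<open>a\<close>.\<close>

lemma dil2_bounded_via_hardy_r:
  assumes X: "is_ideal I X" "homogeneous X" and r: "0 < r" "hardy_r_bounded_on_rearr I r X"
  shows "\<exists>C>0. \<forall>a\<in>elts X. nonincr I a \<longrightarrow> dil2 a \<in> elts X \<and> fnorm X (dil2 a) \<le> ennreal C * fnorm X a"
proof -
  obtain C0 where C0: "\<And>x. x \<in> rearr I ` elts (symmetrization I X) \<Longrightarrow>
      hardy_r_defined I r x \<and> hardy_r r x \<in> elts X \<and> fnorm X (hardy_r r x) \<le> ennreal C0 * fnorm X x"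
    using r(2) unfolding hardy_r_bounded_on_rearr_def bounded_on_def by blast
  define D where "D = 2 powr (1/r)"
  have D: "0 < D" by (simp add: D_def)
  have "dil2 a \<in> elts X \<and> fnorm X (dil2 a) \<le> ennreal (D * max 1 C0) * fnorm X a"
    if a: "a \<in> elts X" "nonincr I a" for a
  proof -
    let ?b = "rearr I a"
    note fin = nonincr_finite[OF a(2)] and am = nonincr_L0[OF a(2)]
    have bm: "?b \<in> L0 I" by (rule nonincr_L0[OF rearr_nonincr[OF am fin]])
    have ba: "AE t in leb I. \<bar>?b t\<bar> \<le> \<bar>a t\<bar>"
      using rearr_nonincr_le[OF a(2)] rearr_nonneg[OF fin] by (intro AE_I2) force
    have bX: "?b \<in> elts X" by (rule is_ideal_elts[OF X(1) a(1) bm ba])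
    then have "?b \<in> rearr I ` elts (symmetrization I X)"
      using am fin by (auto simp: symmetrization_def)
    note H = C0[OF this]
    let ?h = "\<lambda>t. D * hardy_r r ?b t"
    have "AE t in leb I. \<bar>dil2 a t\<bar> \<le> \<bar>?h t\<bar>"
    proof (rule AE_I2)
      fix t assume "t \<in> space (leb I)"
      then have t: "t \<in> I" by simp
      have a0: "0 \<le> a (t/2)" using nonincr_nonneg[OF a(2) I_half[OF t]] .
      have "((t/2) / t) powr (1/r) * a (t/2) \<le> hardy_r r ?b t"
      proof (rule hardy_r_lower_bound[OF _ r(1) t a0])
        fix s :: real assume s: "0 < s" "s < t/2"
        then show "a (t/2) \<le> ?b s"
          using nonincr_le_rearr[OF a(2) I_down[OF I_half[OF t] s(1)] I_half[OF t]] by simp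
      qed (use H I_pos[OF t] in auto)
      also have "((t/2) / t) powr (1/r) = 1 / D"
        using I_pos[OF t] by (simp add: D_def powr_divide)
      finally have "a (t/2) \<le> D * hardy_r r ?b t" using D by (simp add: field_simps)
      then show "\<bar>dil2 a t\<bar> \<le> \<bar>?h t\<bar>" using a0 by (simp add: dil2_def)
    qed
    note le = this
    have hX: "?h \<in> elts X" "fnorm X ?h = ennreal D * fnorm X (hardy_r r ?b)"
      using homogeneousD[OF X(2), of "hardy_r r ?b" D] H D by auto
    have dm: "dil2 a \<in> L0 I" by (rule nonincr_L0[OF nonincr_dil2[OF a(2)]])
    have "fnorm X (dil2 a) \<le> ennreal D * fnorm X (hardy_r r ?b)"
      using is_ideal_norm_le[OF X(1) hX(1) dm le] hX(2) by simp
    also have "\<dots> \<le> ennreal D * (ennreal C0 * fnorm X ?b)"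
      using H by (intro mult_left_mono) auto
    also have "\<dots> \<le> ennreal D * (ennreal (max 1 C0) * fnorm X a)"
      using is_ideal_norm_le[OF X(1) a(1) bm ba] by (intro mult_left_mono mult_mono ennreal_leI) auto
    also have "\<dots> = ennreal (D * max 1 C0) * fnorm X a"
      using D by (simp add: ennreal_mult mult.assoc)
    finally show ?thesis using is_ideal_elts[OF X(1) hX(1) dm le] by simp
  qed
  moreover have "0 < D * max 1 C0" using D by simp
  ultimately show ?thesis by blast
qed


subsection \<open>Multipliers on nonincreasing functions\<close>

lemma AE_zero_if_rearr_zero:
  assumes "x \<in> L0 I" "rearr_finite I x" "\<And>t. t \<in> I \<Longrightarrow> rearr I x t = 0"
  shows "AE t in leb I. x t = 0"
proof -
  obtain t where t: "t \<in> I" using I_nonempty by auto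
  have "distr_fun I x 0 \<le> 0 + ennreal e" if e: "0 < e" for e
  proof -
    define u where "u = min e t"
    have u: "u \<in> I" "u \<le> e" using I_down[OF t, of u] I_pos[OF t] e by (auto simp: u_def)
    have "distr_fun I x 0 \<le> ennreal u" using distr_rearr_le[OF assms(1,2) u(1)] assms(3)[OF u(1)] by simp
    also have "\<dots> \<le> ennreal e" using u by (intro ennreal_leI)
    finally show ?thesis by simp
  qed
  then have "distr_fun I x 0 \<le> 0" by (rule ennreal_le_epsilon)
  then show ?thesis using distr_sets[OF assms(1), of 0] by (intro AE_I[of _ _ "{s\<in>I. 0 < \<bar>x s\<bar>}"]) auto
qed

text \<open>An interval (0,t] is not a null set. For monotone functions this turns a bound almost
  everywhere into one at every point.\<close>

lemma AE_imp_ex_le: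
  assumes "AE t in leb I. P t" "t \<in> I"
  shows "\<exists>s\<in>I. s \<le> t \<and> P s"
proof (rule ccontr)
  assume n: "\<not> (\<exists>s\<in>I. s \<le> t \<and> P s)"
  have "AE s in leb I. s \<notin> {0<..t}"
    using assms(1) AE_space by eventually_elim (use n in auto)
  moreover have "{0<..t} \<in> sets (leb I)" using I_Ioo[OF assms(2)] by (simp add: sets_leb_iff)
  ultimately have "emeasure (leb I) {0<..t} = 0"
    using AE_iff_null_sets[of "{0<..t}" "leb I"] by (simp add: null_setsD1)
  then show False using emeasure_leb_Ioo(2)[OF assms(2)] I_pos[OF assms(2)] by simp
qed

text \<open>The norm limit x of the partial sums dominates each of them: the positive part of S_N -
  x lies below |S_m - x| for all m >= N, so its norm is 0. No almost everywhere convergence has to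
  be extracted.\<close>

lemma partial_sums_dominated:
  assumes X: "normed_space I X" "is_ideal I X" "complete_space X"
    and b: "\<And>n. b n \<in> elts X" "\<And>n t. t \<in> I \<Longrightarrow> 0 \<le> b n t" "\<And>n. fnorm X (b n) \<le> ennreal ((1/2)^n)"
  shows "\<exists>x\<in>elts X. AE t in leb I. \<forall>N. (\<Sum>n<N. b n t) \<le> x t"
proof -
  define S where "S N t = (\<Sum>n<N. b n t)" for N :: nat and t
  have SX: "S N \<in> elts X" for N
  proof (induction N)
    case 0 then show ?case using normed_spaceD(2)[OF X(1)] by (simp add: S_def)
  next
    case (Suc N)
    have "S (Suc N) = (\<lambda>t. S N t + b N t)" by (auto simp: S_def)
    then show ?case using normed_spaceD(3)[OF X(1) Suc b(1)] by simp
  qed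
  have Sm: "S N \<in> L0 I" for N by (rule normed_spaceD(1)[OF X(1) SX])
  have Smono: "S N t \<le> S M t" if "N \<le> M" "t \<in> I" for N M t
    unfolding S_def using that b(2) by (intro sum_mono2) auto
  have diffX: "(\<lambda>t. x t - y t) \<in> elts X" "fnorm X (\<lambda>t. y t - x t) = fnorm X (\<lambda>t. x t - y t)"
    if "x \<in> elts X" "y \<in> elts X" for x y
  proof -
    show d: "(\<lambda>t. x t - y t) \<in> elts X"
      using normed_spaceD(3)[OF X(1) that(1) normed_spaceD(4)[OF X(1) that(2), of "-1"]] by simp
    show "fnorm X (\<lambda>t. y t - x t) = fnorm X (\<lambda>t. x t - y t)"
      using normed_spaceD(7)[OF X(1) d, of "-1"] by simp
  qed
  have dn: "fnorm X (\<lambda>t. S (N + k) t - S N t) \<le> ennreal (2 * (1/2)^N - 2 * (1/2)^(N + k))" for N k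
  proof (induction k)
    case 0
    have "fnorm X (\<lambda>_. 0) = 0" using normed_spaceD(6)[OF X(1) normed_spaceD(2)[OF X(1)]] by simp
    then show ?case by simp
  next
    case (Suc k)
    have e: "(\<lambda>t. S (N + Suc k) t - S N t) = (\<lambda>t. (S (N + k) t - S N t) + b (N + k) t)"
      by (auto simp: S_def)
    have "fnorm X (\<lambda>t. S (N + Suc k) t - S N t) \<le> fnorm X (\<lambda>t. S (N + k) t - S N t) + fnorm X (b (N + k))"
      unfolding e by (intro normed_spaceD(8)[OF X(1)] diffX SX b)
    also have "\<dots> \<le> ennreal (2 * (1/2)^N - 2 * (1/2)^(N + k)) + ennreal ((1/2)^(N + k))"
      by (intro add_mono Suc b)
    also have "\<dots> = ennreal (2 * (1/2)^N - 2 * (1/2)^(N + k) + (1/2)^(N + k))"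
      using power_decreasing[of N "N + k" "1/2::real"] by (subst ennreal_plus) auto
    also have "2 * (1/2)^N - 2 * (1/2)^(N + k) + (1/2)^(N + k) = 2 * (1/2)^N - 2 * ((1/2::real)^(N + Suc k))"
      by simp
    finally show ?case .
  qed
  have dn': "fnorm X (\<lambda>t. S m t - S n t) \<le> ennreal (2 * (1/2)^N)" if "N \<le> m" "N \<le> n" for N m n
  proof -
    have *: "fnorm X (\<lambda>t. S m t - S n t) \<le> ennreal (2 * (1/2)^N)" if "N \<le> n" "n \<le> m" for m n
    proof -
      have "fnorm X (\<lambda>t. S m t - S n t) \<le> ennreal (2 * (1/2)^n - 2 * (1/2)^m)"
        using dn[of n "m - n"] that by simp
      also have "\<dots> \<le> ennreal (2 * (1/2)^N)"
      proof (rule ennreal_leI)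
        have "(1/2::real)^n \<le> (1/2)^N" using that by (intro power_decreasing) auto
        moreover have "0 \<le> (1/2::real)^m" by simp
        ultimately show "2 * (1/2::real)^n - 2 * (1/2)^m \<le> 2 * (1/2)^N" by linarith
      qed
      finally show ?thesis .
    qed
    show ?thesis
    proof (cases "n \<le> m")
      case False
      then have "fnorm X (\<lambda>t. S n t - S m t) \<le> ennreal (2 * (1/2)^N)" using * that by simp
      then show ?thesis using diffX(2)[OF SX SX, of n m] by simp
    qed (use * that in simp)
  qed
  have lim0: "(\<lambda>N. ennreal (2 * (1/2)^N)) \<longlonglongrightarrow> 0"
  proof -
    have "(\<lambda>N. 2 * (1/2::real)^N) \<longlonglongrightarrow> 2 * 0" by (intro tendsto_intros LIMSEQ_power_zero) simp
    then have "(\<lambda>N. ennreal (2 * (1/2)^N)) \<longlonglongrightarrow> ennreal (2 * 0)" by (rule tendsto_ennrealI)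
    then show ?thesis by simp
  qed
  have "\<exists>N. \<forall>m\<ge>N. \<forall>n\<ge>N. fnorm X (\<lambda>t. S m t - S n t) < e" if "0 < e" for e
  proof -
    obtain N where "ennreal (2 * (1/2)^N) < e"
      using order_tendstoD(2)[OF lim0 \<open>0 < e\<close>] by (auto simp: eventually_sequentially)
    then show ?thesis using dn' by (intro exI[of _ N]) (meson order_le_less_trans)
  qed
  then obtain x where x: "x \<in> elts X" "(\<lambda>n. fnorm X (\<lambda>t. S n t - x t)) \<longlonglongrightarrow> 0"
    using X(3)[unfolded complete_space_def, rule_format, of S] SX by blast
  have "AE t in leb I. S N t \<le> x t" for N
  proof -
    let ?p = "\<lambda>t. max 0 (S N t - x t)"
    have pm: "?p \<in> L0 I" using Sm[of N] normed_spaceD(1)[OF X(1) x(1)] by (simp add: L0_def)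
    have ae: "AE t in leb I. \<bar>?p t\<bar> \<le> \<bar>S m t - x t\<bar>" if "N \<le> m" for m
      using Smono[OF that] by (intro AE_I2) force
    have pX: "?p \<in> elts X" by (rule is_ideal_elts[OF X(2) diffX(1)[OF SX x(1)] pm ae[OF order.refl]])
    have "fnorm X ?p \<le> 0"
    proof (rule LIMSEQ_le_const[OF x(2)])
      show "\<exists>M. \<forall>n\<ge>M. fnorm X ?p \<le> fnorm X (\<lambda>t. S n t - x t)"
        using is_ideal_norm_le[OF X(2) diffX(1)[OF SX x(1)] pm ae] by blast
    qed
    then have "AE t in leb I. ?p t = 0" using normed_spaceD(6)[OF X(1) pX] by simp
    then show ?thesis by eventually_elim (simp add: max_def split: if_splits)
  qed
  then have "AE t in leb I. \<forall>N. S N t \<le> x t" by (simp add: AE_all_countable)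
  then show ?thesis using x(1) unfolding S_def by blast
qed

text \<open>Gliding hump; the sum of the normalised bad functions is again nonincreasing.\<close>

lemma multiplier_bounded_on_nonincr:
  assumes X: "normed_space I X" "is_ideal I X" "complete_space X"
    and Y: "normed_space I Y" "is_ideal I Y"
    and w: "\<And>a. a \<in> elts X \<Longrightarrow> nonincr I a \<Longrightarrow> (\<lambda>t. w t * a t) \<in> elts Y"
  shows "\<exists>K>0. \<forall>a\<in>elts X. nonincr I a \<longrightarrow> fnorm Y (\<lambda>t. w t * a t) \<le> ennreal K * fnorm X a"
proof (rule ccontr)
  assume neg: "\<not> ?thesis"
  \<comment> \<open>With the factor 4^n, scaling the functions to norm 2^(-n) still leaves products
    with w of norm at least 2^n.\<close>
  have "\<exists>a. a \<in> elts X \<and> nonincr I a \<and> ennreal (4^n) * fnorm X a < fnorm Y (\<lambda>t. w t * a t)" for n :: nat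
    using neg by (auto simp: not_le dest!: spec[of _ "4^n"])
  then obtain a where a: "\<And>n. a n \<in> elts X" "\<And>n. nonincr I (a n)"
    "\<And>n::nat. ennreal (4^n) * fnorm X (a n) < fnorm Y (\<lambda>t. w t * a n t)" by metis
  have nz: "fnorm X (a n) \<noteq> 0" for n
  proof
    assume "fnorm X (a n) = 0"
    then have "AE t in leb I. a n t = 0" using normed_spaceD(6)[OF X(1) a(1)] by simp
    then have "AE t in leb I. w t * a n t = 0" by eventually_elim simp
    then have "fnorm Y (\<lambda>t. w t * a n t) = 0" using normed_spaceD(6)[OF Y(1) w[OF a(1,2)]] by blast
    then show False using a(3)[of n] by simp
  qed
  define \<rho> where "\<rho> n = enn2real (fnorm X (a n))" for n
  have \<rho>: "fnorm X (a n) = ennreal (\<rho> n)" "0 < \<rho> n" for n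
    using nz[of n] normed_spaceD(5)[OF X(1) a(1), of n]
    by (auto simp: \<rho>_def enn2real_positive_iff less_top zero_less_iff_neq_zero)
  define c where "c n = (1/2)^n / \<rho> n" for n
  have c: "0 < c n" for n using \<rho>(2) by (simp add: c_def)
  define b where "b n t = c n * a n t" for n t
  have bX: "b n \<in> elts X" for n unfolding b_def by (rule normed_spaceD(4)[OF X(1) a(1)])
  have b0: "0 \<le> b n t" if "t \<in> I" for n t
    using nonincr_nonneg[OF a(2) that] less_imp_le[OF c] by (simp add: b_def)
  have bmono: "b n t \<le> b n s" if "s \<in> I" "t \<in> I" "s \<le> t" for n s t
    using nonincr_le[OF a(2) that] less_imp_le[OF c] by (simp add: b_def mult_left_mono)
  have bn: "fnorm X (b n) \<le> ennreal ((1/2)^n)" for n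
  proof -
    have "fnorm X (b n) = ennreal (c n) * ennreal (\<rho> n)"
      unfolding b_def normed_spaceD(7)[OF X(1) a(1)] \<rho>(1) using c[of n] by simp
    also have "\<dots> = ennreal ((1/2)^n)"
      using c[of n] \<rho>(2)[of n] by (simp add: c_def flip: ennreal_mult)
    finally show ?thesis by simp
  qed
  have wb: "(\<lambda>t. w t * b n t) = (\<lambda>t. c n * (w t * a n t))" for n by (auto simp: b_def)
  have big: "ennreal (2^n) \<le> fnorm Y (\<lambda>t. w t * b n t)" for n
  proof -
    have "ennreal (2^n) = ennreal (c n) * (ennreal (4^n) * ennreal (\<rho> n))"
    proof -
      have "(4::real)^n = 2^n * 2^n" by (simp flip: power_mult_distrib)
      then have "c n * (4^n * \<rho> n) = 2^n" using \<rho>(2)[of n] by (simp add: c_def power_divide)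
      then show ?thesis using c[of n] \<rho>(2)[of n] by (simp flip: ennreal_mult)
    qed
    also have "\<dots> \<le> ennreal (c n) * fnorm Y (\<lambda>t. w t * a n t)"
      using a(3)[of n] \<rho>(1)[of n] by (intro mult_left_mono) (auto intro: less_imp_le)
    also have "\<dots> = fnorm Y (\<lambda>t. w t * b n t)"
      unfolding wb normed_spaceD(7)[OF Y(1) w[OF a(1,2)]] using c[of n] by simp
    finally show ?thesis .
  qed
  obtain x where x: "x \<in> elts X" "AE t in leb I. \<forall>N. (\<Sum>n<N. b n t) \<le> x t"
    using partial_sums_dominated[OF X bX b0 bn] by blast
  \<comment> \<open>Domination by x holds almost everywhere only. Monotonicity carries summability
    from some s <= t to t, so the sum is nonincreasing on all of \<open>I\<close>.\<close>
  have sm: "summable (\<lambda>n. b n t)" if t: "t \<in> I" for t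
  proof -
    obtain s where s: "s \<in> I" "s \<le> t" "\<forall>N. (\<Sum>n<N. b n s) \<le> x s"
      using AE_imp_ex_le[OF x(2) t] by blast
    show ?thesis
    proof (rule summableI_nonneg_bounded[of _ "x s"])
      fix N
      have "(\<Sum>n<N. b n t) \<le> (\<Sum>n<N. b n s)" using bmono[OF s(1) t s(2)] by (intro sum_mono)
      also have "\<dots> \<le> x s" using s(3) by blast
      finally show "(\<Sum>n<N. b n t) \<le> x s" .
    qed (rule b0[OF t])
  qed
  define B where "B t = (\<Sum>n. b n t)" for t
  have Bn: "nonincr I B"
    unfolding nonincr_def B_def
    by (intro conjI ballI impI suminf_nonneg suminf_le sm b0 bmono)
  have bB: "b n t \<le> B t" if t: "t \<in> I" for n t
    using sum_le_suminf[OF sm[OF t], of "{n}"] b0[OF t] by (simp add: B_def)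
  have "AE t in leb I. \<bar>B t\<bar> \<le> \<bar>x t\<bar>"
    using x(2) AE_space
  proof eventually_elim
    case (elim t)
    then have t: "t \<in> I" by simp
    have "B t \<le> x t" unfolding B_def using elim by (intro suminf_le_const sm[OF t]) auto
    then show ?case using nonincr_nonneg[OF Bn t] by simp
  qed
  then have BX: "B \<in> elts X" by (rule is_ideal_elts[OF X(2) x(1) nonincr_L0[OF Bn]])
  note wB = w[OF BX Bn]
  have "ennreal (2^n) \<le> fnorm Y (\<lambda>t. w t * B t)" for n
  proof -
    have "AE t in leb I. \<bar>w t * b n t\<bar> \<le> \<bar>w t * B t\<bar>"
    proof (rule AE_I2)
      fix t assume "t \<in> space (leb I)"
      then have t: "t \<in> I" by simp
      show "\<bar>w t * b n t\<bar> \<le> \<bar>w t * B t\<bar>"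
        using b0[OF t, of n] bB[OF t, of n] by (simp add: abs_mult mult_left_mono)
    qed
    moreover have "(\<lambda>t. w t * b n t) \<in> L0 I"
      unfolding wb by (intro normed_spaceD(1)[OF Y(1)] normed_spaceD(4)[OF Y(1)] w a)
    ultimately show ?thesis using big[of n] is_ideal_norm_le[OF Y(2) wB] by (meson order_trans)
  qed
  moreover obtain M where M: "fnorm Y (\<lambda>t. w t * B t) = ennreal M" "0 \<le> M"
    using normed_spaceD(5)[OF Y(1) wB] by (cases "fnorm Y (\<lambda>t. w t * B t)") auto
  ultimately have "2^n \<le> M" for n :: nat by (simp add: ennreal_le_iff)
  then show False using real_arch_pow[of 2 M] by (auto simp: not_less[symmetric])
qed

section \<open>From nonincreasing functions to all of E\<close>

lemma product_space_norm_le: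
  assumes E: "normed_space I E" "is_ideal I E" and G: "is_ideal I G" "elts G \<subseteq> L0 I"
    and y: "y \<in> elts E" and g: "g \<in> elts G"
  shows "(\<lambda>t. \<bar>y t * g t\<bar>) \<in> elts (product_space I E G)"
    "fnorm (product_space I E G) (\<lambda>t. \<bar>y t * g t\<bar>) \<le> fnorm E y * fnorm G g"
proof -
  have m: "y \<in> borel_measurable (leb I)" "g \<in> borel_measurable (leb I)"
    using normed_spaceD(1)[OF E(1) y] G(2) g by (auto simp: L0_def)
  have ym: "(\<lambda>t. \<bar>y t\<bar>) \<in> L0 I" and gm: "(\<lambda>t. \<bar>g t\<bar>) \<in> L0 I" and h: "(\<lambda>t. \<bar>y t * g t\<bar>) \<in> L0 I"
    using m by (auto simp: L0_def)
  have y': "(\<lambda>t. \<bar>y t\<bar>) \<in> elts E" "fnorm E (\<lambda>t. \<bar>y t\<bar>) \<le> fnorm E y"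
    using is_ideal_elts[OF E(2) y ym] is_ideal_norm_le[OF E(2) y ym] by simp_all
  have g': "(\<lambda>t. \<bar>g t\<bar>) \<in> elts G" "fnorm G (\<lambda>t. \<bar>g t\<bar>) \<le> fnorm G g"
    using is_ideal_elts[OF G(1) g gm] is_ideal_norm_le[OF G(1) g gm] by simp_all
  have e: "AE t in leb I. \<bar>y t * g t\<bar> = \<bar>y t\<bar> * \<bar>g t\<bar>" by (simp add: abs_mult)
  show "(\<lambda>t. \<bar>y t * g t\<bar>) \<in> elts (product_space I E G)"
    unfolding product_space_def fspace.simps mem_Collect_eq
    using h y'(1) g'(1) e by (intro conjI bexI[of _ "\<lambda>t. \<bar>y t\<bar>"] bexI[of _ "\<lambda>t. \<bar>g t\<bar>"])
  have "fnorm (product_space I E G) (\<lambda>t. \<bar>y t * g t\<bar>) \<le> fnorm E (\<lambda>t. \<bar>y t\<bar>) * fnorm G (\<lambda>t. \<bar>g t\<bar>)"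
    unfolding product_space_def using y'(1) g'(1) e by (auto intro!: Inf_lower)
  also have "\<dots> \<le> fnorm E y * fnorm G g" by (intro mult_mono y' g') auto
  finally show "fnorm (product_space I E G) (\<lambda>t. \<bar>y t * g t\<bar>) \<le> fnorm E y * fnorm G g" .
qed

text \<open>The real constant in \<open>bounded_on\<close> may be zero or negative, which
  \<open>ennreal\<close> maps to 0; max(1,C) is a positive substitute.\<close>

lemma bounded_on_posE:
  assumes "bounded_on D T S X"
  obtains C where "0 < C" "\<And>x. x \<in> S \<Longrightarrow> D x \<and> T x \<in> elts X \<and> fnorm X (T x) \<le> ennreal C * fnorm X x"
proof -
  obtain C where C: "\<And>x. x \<in> S \<Longrightarrow> D x \<and> T x \<in> elts X \<and> fnorm X (T x) \<le> ennreal C * fnorm X x"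
    using assms unfolding bounded_on_def by blast
  have "ennreal C * q \<le> ennreal (max 1 C) * q" for q by (intro mult_right_mono ennreal_leI) auto
  then have "\<And>x. x \<in> S \<Longrightarrow> D x \<and> T x \<in> elts X \<and> fnorm X (T x) \<le> ennreal (max 1 C) * fnorm X x"
    using C by (meson order_trans)
  then show thesis using that[of "max 1 C"] by simp
qed

text \<open>The product norm is an infimum over arbitrary factors, whereas the multiplier bound is
  known for nonincreasing ones. H_r* makes the factors monotone, the bounds of D_2 on E and G absorb
  the shift to t/2, and 4^(1/r) is carried by the first factor.\<close>

lemma nonincr_factorization:
  assumes E: "normed_space I E" "is_ideal I E" and G: "is_ideal I G" "homogeneous G" "elts G \<subseteq> L0 I"
    and r: "0 < r" "cohardy_r_bounded I r E" "cohardy_r_bounded I r G"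
      "hardy_r_bounded_on_rearr I r E" "hardy_r_bounded_on_rearr I r G"
  shows "\<exists>C>0. \<forall>z u v. nonincr I z \<longrightarrow> u \<in> elts E \<longrightarrow> v \<in> elts G \<longrightarrow> (AE t in leb I. z t = u t * v t) \<longrightarrow>
    (\<exists>a\<in>elts E. \<exists>b\<in>elts G. nonincr I a \<and> nonincr I b \<and> (\<forall>t\<in>I. z t \<le> a t * b t) \<and>
       fnorm E a * fnorm G b \<le> ennreal C * (fnorm E u * fnorm G v))"
proof -
  obtain C4 where C4: "0 < C4" "\<And>u. u \<in> elts E \<Longrightarrow> cohardy_r_defined I r u \<and> cohardy_r I r u \<in> elts E \<and>
      fnorm E (cohardy_r I r u) \<le> ennreal C4 * fnorm E u"
    by (rule bounded_on_posE[OF r(2)[unfolded cohardy_r_bounded_def]]) blast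
  obtain C5 where C5: "0 < C5" "\<And>u. u \<in> elts G \<Longrightarrow> cohardy_r_defined I r u \<and> cohardy_r I r u \<in> elts G \<and>
      fnorm G (cohardy_r I r u) \<le> ennreal C5 * fnorm G u"
    by (rule bounded_on_posE[OF r(3)[unfolded cohardy_r_bounded_def]]) blast
  obtain C2 where C2: "0 < C2" "\<And>a. a \<in> elts E \<Longrightarrow> nonincr I a \<Longrightarrow> dil2 a \<in> elts E \<and> fnorm E (dil2 a) \<le> ennreal C2 * fnorm E a"
    using dil2_bounded_via_hardy_r[OF E(2) normed_space_homogeneous[OF E(1)] r(1,4)] by blast
  obtain C3 where C3: "0 < C3" "\<And>a. a \<in> elts G \<Longrightarrow> nonincr I a \<Longrightarrow> dil2 a \<in> elts G \<and> fnorm G (dil2 a) \<le> ennreal C3 * fnorm G a"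
    using dil2_bounded_via_hardy_r[OF G(1,2) r(1,5)] by blast
  define \<kappa> where "\<kappa> = (4::real) powr (1/r)"
  have \<kappa>: "0 < \<kappa>" by (simp add: \<kappa>_def)
  have "\<exists>a\<in>elts E. \<exists>b\<in>elts G. nonincr I a \<and> nonincr I b \<and> (\<forall>t\<in>I. z t \<le> a t * b t) \<and>
       fnorm E a * fnorm G b \<le> ennreal (\<kappa> * C2 * C4 * (C3 * C5)) * (fnorm E u * fnorm G v)"
    if z: "nonincr I z" and u: "u \<in> elts E" and v: "v \<in> elts G" and uv: "AE t in leb I. z t = u t * v t" for z u v
  proof -
    let ?a = "dil2 (cohardy_r I r u)" and ?b = "dil2 (cohardy_r I r v)"
    have nu: "nonincr I (cohardy_r I r u)" and nv: "nonincr I (cohardy_r I r v)"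
      using C4(2)[OF u] C5(2)[OF v] r(1) cohardy_r_nonincr by auto
    have a: "?a \<in> elts E" "fnorm E ?a \<le> ennreal (C2 * C4) * fnorm E u"
    proof -
      show "?a \<in> elts E" using C2(2) nu C4(2)[OF u] by blast
      have "fnorm E ?a \<le> ennreal C2 * (ennreal C4 * fnorm E u)"
        using C2(2)[of "cohardy_r I r u"] nu C4(2)[OF u] by (meson mult_left_mono order_trans zero_le)
      then show "fnorm E ?a \<le> ennreal (C2 * C4) * fnorm E u"
        using C2(1) C4(1) by (simp add: ennreal_mult mult.assoc)
    qed
    have b: "?b \<in> elts G" "fnorm G ?b \<le> ennreal (C3 * C5) * fnorm G v"
    proof -
      show "?b \<in> elts G" using C3(2) nv C5(2)[OF v] by blast
      have "fnorm G ?b \<le> ennreal C3 * (ennreal C5 * fnorm G v)"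
        using C3(2)[of "cohardy_r I r v"] nv C5(2)[OF v] by (meson mult_left_mono order_trans zero_le)
      then show "fnorm G ?b \<le> ennreal (C3 * C5) * fnorm G v"
        using C3(1) C5(1) by (simp add: ennreal_mult mult.assoc)
    qed
    let ?a' = "\<lambda>t. \<kappa> * ?a t"
    have a': "?a' \<in> elts E" "fnorm E ?a' = ennreal \<kappa> * fnorm E ?a"
      using normed_spaceD(4,7)[OF E(1) a(1), of \<kappa>] \<kappa> by auto
    have "fnorm E ?a' * fnorm G ?b \<le> ennreal \<kappa> * (ennreal (C2 * C4) * fnorm E u) * (ennreal (C3 * C5) * fnorm G v)"
      unfolding a'(2) by (intro mult_mono a b order.refl) auto
    also have "\<dots> = ennreal (\<kappa> * C2 * C4 * (C3 * C5)) * (fnorm E u * fnorm G v)"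
      using \<kappa> C2(1) C3(1) C4(1) C5(1) by (simp add: ennreal_mult ac_simps)
    finally have n: "fnorm E ?a' * fnorm G ?b \<le> ennreal (\<kappa> * C2 * C4 * (C3 * C5)) * (fnorm E u * fnorm G v)" .
    have "z t \<le> ?a' t * ?b t" if "t \<in> I" for t
      using nonincr_factor_bound[OF z normed_spaceD(1)[OF E(1) u] subsetD[OF G(3) v] uv r(1) _ _ that]
        C4(2)[OF u] C5(2)[OF v] by (simp add: \<kappa>_def mult.assoc)
    moreover have "nonincr I ?a'" using nonincr_dil2[OF nu] \<kappa> by (simp add: nonincr_def mult_left_mono)
    ultimately show ?thesis using n a'(1) b(1) nonincr_dil2[OF nv] by blast
  qed
  moreover have "0 < \<kappa> * C2 * C4 * (C3 * C5)" using \<kappa> C2(1) C3(1) C4(1) C5(1) by simp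
  ultimately show ?thesis by blast
qed

text \<open>The constant depends neither on w nor on K. This uniformity permits two applications to
  w = x*: with a K known only to be finite, and with a K proportional to the multiplier
  norm.\<close>

lemma multiplier_bound_from_nonincr:
  assumes E: "normed_space I E" "is_ideal I E"
    and F: "normed_space I F" "is_ideal I F" "fatou_property I F"
    and H: "cohardy_bounded I (product_space I E (koethe_dual I F))"
    and r: "0 < r" "cohardy_r_bounded I r E" "cohardy_r_bounded I r (koethe_dual I F)"
      "hardy_r_bounded_on_rearr I r E" "hardy_r_bounded_on_rearr I r (koethe_dual I F)"
  shows "\<exists>C>0. \<forall>w K. nonincr I w \<longrightarrow> 0 < K \<longrightarrow>
    (\<forall>a\<in>elts E. nonincr I a \<longrightarrow> (\<lambda>t. w t * a t) \<in> elts F \<and> fnorm F (\<lambda>t. w t * a t) \<le> ennreal K * fnorm E a) \<longrightarrow>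
    (\<forall>y\<in>elts E. (\<lambda>t. w t * y t) \<in> elts F \<and> fnorm F (\<lambda>t. w t * y t) \<le> ennreal (C * K) * fnorm E y)"
proof -
  let ?G = "koethe_dual I F" and ?P = "product_space I E (koethe_dual I F)"
  have G: "is_ideal I ?G" "homogeneous ?G" "elts ?G \<subseteq> L0 I"
    by (rule koethe_dual_ideal, rule koethe_dual_homogeneous, use normed_spaceD(1)[OF F(1)] in blast)
      (simp add: koethe_dual_elts subset_eq)
  obtain C1 where C1: "0 < C1" "\<And>h. h \<in> elts ?P \<Longrightarrow> cohardy_defined I h \<and> cohardy I h \<in> elts ?P \<and>
      fnorm ?P (cohardy I h) \<le> ennreal C1 * fnorm ?P h"
    by (rule bounded_on_posE[OF H[unfolded cohardy_bounded_def]]) blast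
  obtain C2 where C2: "0 < C2" "\<And>z u v. nonincr I z \<Longrightarrow> u \<in> elts E \<Longrightarrow> v \<in> elts ?G \<Longrightarrow>
     (AE t in leb I. z t = u t * v t) \<Longrightarrow>
    (\<exists>a\<in>elts E. \<exists>b\<in>elts ?G. nonincr I a \<and> nonincr I b \<and> (\<forall>t\<in>I. z t \<le> a t * b t) \<and>
       fnorm E a * fnorm ?G b \<le> ennreal C2 * (fnorm E u * fnorm ?G v))"
    using nonincr_factorization[OF E G r] by blast
  have "(\<lambda>t. w t * y t) \<in> elts F \<and> fnorm F (\<lambda>t. w t * y t) \<le> ennreal (C2 * C1 * K) * fnorm E y"
    if w: "nonincr I w" and K: "0 < K"
      "\<And>a. a \<in> elts E \<Longrightarrow> nonincr I a \<Longrightarrow> (\<lambda>t. w t * a t) \<in> elts F \<and> fnorm F (\<lambda>t. w t * a t) \<le> ennreal K * fnorm E a"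
      and y: "y \<in> elts E" for w K y
  proof -
    have wm: "w \<in> borel_measurable (leb I)" using nonincr_L0[OF w] by (simp add: L0_def)
    have ym: "y \<in> borel_measurable (leb I)" using normed_spaceD(1)[OF E(1) y] by (simp add: L0_def)
    have wy: "(\<lambda>t. w t * y t) \<in> L0 I" using wm ym by (simp add: L0_def)
    have bound: "(\<integral>\<^sup>+t. ennreal \<bar>(w t * y t) * g t\<bar> \<partial>leb I) \<le> ennreal (C2 * C1 * K) * (fnorm E y * fnorm ?G g)"
      if g: "g \<in> elts ?G" for g
    proof -
      define h where "h t = \<bar>y t * g t\<bar>" for t
      have hP: "h \<in> elts ?P" "fnorm ?P h \<le> fnorm E y * fnorm ?G g"
        unfolding h_def by (rule product_space_norm_le[OF E G(1,3) y g])+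
      note C1h = C1(2)[OF hP(1)]
      have hm: "h \<in> L0 I" using hP(1) by (simp add: product_space_def)
      have h0: "0 \<le> h t" for t by (simp add: h_def)
      define z where "z = cohardy I h"
      have zn: "nonincr I z" unfolding z_def using cohardy_nonincr[of h] C1h h0 by blast
      have zn2: "fnorm ?P z \<le> ennreal C1 * (fnorm E y * fnorm ?G g)"
        unfolding z_def by (rule order_trans[OF conjunct2[OF conjunct2[OF C1h]] mult_left_mono[OF hP(2) zero_le]])
      let ?W = "\<integral>\<^sup>+t. ennreal (w t * z t) \<partial>leb I"
      \<comment> \<open>For each factorization of z the monotone factor \<open>a\<close> stays with
        w, where K applies, and b is paired with \<open>w a\<close> by Hoelder.\<close>
      have W: "?W \<le> ennreal (C2 * K) * (fnorm E u * fnorm ?G v)"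
        if uv: "u \<in> elts E" "v \<in> elts ?G" "AE t in leb I. z t = u t * v t" for u v
      proof -
        obtain a b where ab: "a \<in> elts E" "b \<in> elts ?G" "nonincr I a" "nonincr I b" "\<And>t. t \<in> I \<Longrightarrow> z t \<le> a t * b t"
          "fnorm E a * fnorm ?G b \<le> ennreal C2 * (fnorm E u * fnorm ?G v)"
          using C2(2)[OF zn uv] by blast
        note wa = K(2)[OF ab(1,3)]
        have "?W \<le> (\<integral>\<^sup>+t. ennreal \<bar>b t * (w t * a t)\<bar> \<partial>leb I)"
        proof (rule nn_integral_mono)
          fix t assume "t \<in> space (leb I)"
          then have t: "t \<in> I" by simp
          have "w t * z t \<le> w t * (a t * b t)"
            using ab(5)[OF t] nonincr_nonneg[OF w t] by (intro mult_left_mono)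
          also have "\<dots> \<le> \<bar>b t * (w t * a t)\<bar>" by (simp add: ac_simps)
          finally show "ennreal (w t * z t) \<le> ennreal \<bar>b t * (w t * a t)\<bar>" by (rule ennreal_leI)
        qed
        also have "\<dots> \<le> fnorm F (\<lambda>t. w t * a t) * fnorm ?G b"
          using koethe_dual_Holder[OF F(1) _ subsetD[OF G(3) ab(2)]] wa by blast
        also have "\<dots> \<le> (ennreal K * fnorm E a) * fnorm ?G b"
          using wa by (intro mult_right_mono) auto
        also have "\<dots> \<le> ennreal K * (ennreal C2 * (fnorm E u * fnorm ?G v))"
          using ab(6) by (subst mult.assoc) (intro mult_left_mono, auto)
        also have "\<dots> = ennreal (C2 * K) * (fnorm E u * fnorm ?G v)"
          using C2(1) K(1) by (simp add: ennreal_mult ac_simps)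
        finally show ?thesis .
      qed
      define M where "M = C2 * K"
      have M: "0 < M" using C2(1) K(1) by (simp add: M_def)
      have MM: "ennreal (1/M) * (ennreal M * q) = q" "ennreal M * (ennreal (1/M) * q) = q" for q
      proof -
        have "ennreal (1/M) * ennreal M = 1" "ennreal M * ennreal (1/M) = 1"
          using M by (simp_all flip: ennreal_mult)
        then show "ennreal (1/M) * (ennreal M * q) = q" "ennreal M * (ennreal (1/M) * q) = q"
          unfolding mult.assoc[symmetric] by simp_all
      qed
      \<comment> \<open>Dividing by M first makes the left side a lower bound of all the products
        whose infimum is the norm of z.\<close>
      have "ennreal (1/M) * ?W \<le> fnorm ?P z"
        unfolding product_space_def fspace.simps
      proof (rule Inf_greatest, clarify)
        fix u v assume uv: "u \<in> elts E" "v \<in> elts ?G" "AE t in leb I. z t = u t * v t"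
        have "ennreal (1/M) * ?W \<le> ennreal (1/M) * (ennreal M * (fnorm E u * fnorm ?G v))"
          using W[OF uv] unfolding M_def by (intro mult_left_mono) auto
        then show "ennreal (1/M) * ?W \<le> fnorm E u * fnorm ?G v" unfolding MM .
      qed
      then have "ennreal M * (ennreal (1/M) * ?W) \<le> ennreal M * fnorm ?P z"
        by (rule mult_left_mono) simp
      then have W2: "?W \<le> ennreal M * fnorm ?P z" unfolding MM .
      have "(\<integral>\<^sup>+t. ennreal \<bar>(w t * y t) * g t\<bar> \<partial>leb I) = (\<integral>\<^sup>+t. ennreal (w t * h t) \<partial>leb I)"
        using nonincr_nonneg[OF w] by (intro nn_integral_cong) (simp add: h_def abs_mult mult.assoc)
      also have "\<dots> \<le> ?W" unfolding z_def using C1h by (intro nonincr_cohardy_duality[OF w hm h0]) blast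
      also note W2
      also have "ennreal M * fnorm ?P z \<le> ennreal M * (ennreal C1 * (fnorm E y * fnorm ?G g))"
        by (intro mult_left_mono zn2) simp
      also have "\<dots> = ennreal (C2 * C1 * K) * (fnorm E y * fnorm ?G g)"
        unfolding M_def using C2(1) C1(1) K(1) by (simp add: ennreal_mult ac_simps)
      finally show ?thesis .
    qed
    show ?thesis
    \<comment> \<open>\<open>lorentz_luxemburg\<close> needs a positive radius, so y = 0 almost
      everywhere is treated apart.\<close>
    proof (cases "fnorm E y = 0")
      case True
      then have "AE t in leb I. y t = 0" using normed_spaceD(6)[OF E(1) y] by simp
      then have ae: "AE t in leb I. \<bar>w t * y t\<bar> \<le> \<bar>0\<bar>" by eventually_elim simp
      have "fnorm F (\<lambda>_. 0) = 0" using normed_spaceD(6)[OF F(1) normed_spaceD(2)[OF F(1)]] by simp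
      then show ?thesis
        using is_ideal_elts[OF F(2) normed_spaceD(2)[OF F(1)] wy ae]
          is_ideal_norm_le[OF F(2) normed_spaceD(2)[OF F(1)] wy ae] by simp
    next
      case False
      obtain e where e: "fnorm E y = ennreal e" "0 < e"
        using False normed_spaceD(5)[OF E(1) y] by (cases "fnorm E y") (auto simp: less_le)
      have pos: "0 < C2 * C1 * K" using C2(1) C1(1) K(1) by simp
      have eq: "ennreal (C2 * C1 * K * e) = ennreal (C2 * C1 * K) * fnorm E y"
        using pos e by (simp add: ennreal_mult)
      have "(\<integral>\<^sup>+t. ennreal \<bar>(w t * y t) * g t\<bar> \<partial>leb I) \<le> ennreal (C2 * C1 * K * e) * fnorm ?G g"
        if "g \<in> elts ?G" for g
        using bound[OF that] unfolding eq by (simp add: mult.assoc)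
      from lorentz_luxemburg[OF F wy _ this] show ?thesis using pos e eq by simp
    qed
  qed
  moreover have "0 < C2 * C1" using C2(1) C1(1) by simp
  ultimately show ?thesis by blast
qed

end

subsection \<open>Symmetrization of multiplier spaces\<close>

lemma symmetrization_elts:
  "x \<in> elts (symmetrization I X) \<longleftrightarrow> x \<in> L0 I \<and> rearr_finite I x \<and> rearr I x \<in> elts X"
  by (simp add: symmetrization_def)

lemma symmetrization_norm: "fnorm (symmetrization I X) x = fnorm X (rearr I x)"
  by (simp add: symmetrization_def)

lemma multipliers_elts:
  "x \<in> elts (multipliers I X Y) \<longleftrightarrow> x \<in> L0 I \<and> (\<forall>y\<in>elts X. (\<lambda>t. x t * y t) \<in> elts Y)"
  by (simp add: multipliers_def)

lemma multipliers_norm: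
  "fnorm (multipliers I X Y) x = (SUP y\<in>{y\<in>elts X. fnorm X y = 1}. fnorm Y (\<lambda>t. x t * y t))"
  by (simp add: multipliers_def)

context half_interval
begin

lemma dil2_bounded_nonincr_rc:
  assumes "dil2_bounded I F"
  obtains D where "0 < D" "\<And>a. a \<in> elts F \<Longrightarrow> nonincr_rc I a \<Longrightarrow>
    dil2 a \<in> elts F \<and> fnorm F (dil2 a) \<le> ennreal D * fnorm F a"
proof -
  obtain D where D: "0 < D" "\<And>a. a \<in> decr_cone I F \<Longrightarrow> True \<and> dil2 a \<in> elts F \<and> fnorm F (dil2 a) \<le> ennreal D * fnorm F a"
    by (rule bounded_on_posE[OF assms[unfolded dil2_bounded_def]]) blast
  have "a \<in> decr_cone I F" if "a \<in> elts F" "nonincr_rc I a" for a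
    using that nonincr_finite[OF nonincr_rc_imp[OF that(2)]] rearr_nonincr_rc_eq[OF that(2)]
    by (auto simp: decr_cone_def intro!: AE_I2)
  then show thesis using that[of D] D by blast
qed

text \<open>The product x* y* is again right-continuous, which makes D_2 on F applicable to it
  although it need not be the rearrangement of x y.\<close>

lemma rearr_product_in:
  assumes F: "is_ideal I F"
    and D: "\<And>a. a \<in> elts F \<Longrightarrow> nonincr_rc I a \<Longrightarrow> dil2 a \<in> elts F \<and> fnorm F (dil2 a) \<le> ennreal D * fnorm F a"
    and x: "x \<in> L0 I" "rearr_finite I x" and y: "y \<in> L0 I" "rearr_finite I y"
    and xy: "(\<lambda>t. rearr I x t * rearr I y t) \<in> elts F"
  shows "(\<lambda>t. x t * y t) \<in> elts (symmetrization I F)"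
    "fnorm F (rearr I (\<lambda>t. x t * y t)) \<le> ennreal D * fnorm F (\<lambda>t. rearr I x t * rearr I y t)"
proof -
  let ?p = "\<lambda>t. x t * y t" and ?q = "\<lambda>t. rearr I x t * rearr I y t"
  have m: "?p \<in> L0 I" using x y by (simp add: L0_def)
  have fin: "rearr_finite I ?p" by (rule rearr_mult(1)[OF x y])
  have rm: "rearr I ?p \<in> L0 I" by (rule nonincr_L0[OF rearr_nonincr[OF m fin]])
  have "nonincr_rc I ?q" by (intro nonincr_rc_mult rearr_nonincr_rc x y)
  note Dq = D[OF xy this]
  have le: "AE t in leb I. \<bar>rearr I ?p t\<bar> \<le> \<bar>dil2 ?q t\<bar>"
  proof (rule AE_I2)
    fix t assume "t \<in> space (leb I)"
    then have t: "t \<in> I" by simp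
    show "\<bar>rearr I ?p t\<bar> \<le> \<bar>dil2 ?q t\<bar>"
      using rearr_mult(2)[OF x y t] rearr_nonneg[OF fin t] unfolding dil2_def by linarith
  qed
  have "rearr I ?p \<in> elts F" using is_ideal_elts[OF F _ rm le] Dq by blast
  then show "?p \<in> elts (symmetrization I F)" using m fin by (simp add: symmetrization_elts)
  show "fnorm F (rearr I ?p) \<le> ennreal D * fnorm F ?q"
    using is_ideal_norm_le[OF F _ rm le] Dq by (meson order_trans)
qed

text \<open>The constant is the factor 2 of \<open>rearr_product_attained\<close> times D for each
  of the two dilations composing D_4; right-continuity survives the first, so the second is allowed.
  The y depends only on x and \<open>a\<close>, and its norm bound does not presuppose that x y is
  in the symmetrization of F.\<close>

lemma rearr_times_nonincr:
  assumes E: "is_ideal I E"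
    and C: "\<And>a. a \<in> elts E \<Longrightarrow> nonincr I a \<Longrightarrow> dil2 a \<in> elts E \<and> fnorm E (dil2 a) \<le> ennreal C * fnorm E a"
    and F: "normed_space I F" "is_ideal I F"
    and D: "0 < D" "\<And>a. a \<in> elts F \<Longrightarrow> nonincr_rc I a \<Longrightarrow> dil2 a \<in> elts F \<and> fnorm F (dil2 a) \<le> ennreal D * fnorm F a"
    and x: "x \<in> L0 I" "rearr_finite I x" and a: "a \<in> elts E" "nonincr I a"
  shows "\<exists>y\<in>elts (symmetrization I E). fnorm E (rearr I y) \<le> ennreal C * fnorm E a \<and>
    ((\<lambda>t. x t * y t) \<in> elts (symmetrization I F) \<longrightarrow> (\<lambda>t. rearr I x t * a t) \<in> elts F \<and>
       fnorm F (\<lambda>t. rearr I x t * a t) \<le> ennreal (2 * D * D) * fnorm F (rearr I (\<lambda>t. x t * y t)))"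
proof -
  obtain y where y: "y \<in> L0 I" "rearr_finite I y" "\<And>t. t \<in> I \<Longrightarrow> rearr I y t \<le> a (t / 2)"
    and xy: "\<And>t. t \<in> I \<Longrightarrow> rearr I x t * a t \<le> 2 * rearr I (\<lambda>t. x t * y t) (t / 4)"
    using rearr_product_attained[OF x a(2)] by blast
  have ym: "rearr I y \<in> L0 I" by (rule nonincr_L0[OF rearr_nonincr[OF y(1,2)]])
  have le: "AE t in leb I. \<bar>rearr I y t\<bar> \<le> \<bar>dil2 a t\<bar>"
  proof (rule AE_I2)
    fix t assume "t \<in> space (leb I)"
    then have t: "t \<in> I" by simp
    show "\<bar>rearr I y t\<bar> \<le> \<bar>dil2 a t\<bar>"
      using y(3)[OF t] rearr_nonneg[OF y(2) t] unfolding dil2_def by linarith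
  qed
  note Ca = C[OF a]
  have yE: "y \<in> elts (symmetrization I E)"
    using is_ideal_elts[OF E _ ym le] Ca y by (simp add: symmetrization_elts)
  have yn: "fnorm E (rearr I y) \<le> ennreal C * fnorm E a"
    using is_ideal_norm_le[OF E _ ym le] Ca by (meson order_trans)
  have "(\<lambda>t. rearr I x t * a t) \<in> elts F \<and>
       fnorm F (\<lambda>t. rearr I x t * a t) \<le> ennreal (2 * D * D) * fnorm F (rearr I (\<lambda>t. x t * y t))"
    if p: "(\<lambda>t. x t * y t) \<in> elts (symmetrization I F)"
  proof -
    let ?p = "rearr I (\<lambda>t. x t * y t)"
    have pF: "?p \<in> elts F" and pr: "nonincr_rc I ?p"
      using p rearr_nonincr_rc by (auto simp: symmetrization_elts)
    note D1 = D(2)[OF pF pr]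
    note D2 = D(2)[OF conjunct1[OF D1] nonincr_rc_dil2[OF pr]]
    let ?d = "\<lambda>t. 2 * dil2 (dil2 ?p) t"
    have dF: "?d \<in> elts F" "fnorm F ?d = ennreal 2 * fnorm F (dil2 (dil2 ?p))"
      using normed_spaceD(4,7)[OF F(1) conjunct1[OF D2], of 2] by simp_all
    have m: "(\<lambda>t. rearr I x t * a t) \<in> L0 I"
      using nonincr_L0[OF nonincr_mult[OF rearr_nonincr[OF x] a(2)]] .
    have le: "AE t in leb I. \<bar>rearr I x t * a t\<bar> \<le> \<bar>?d t\<bar>"
    proof (rule AE_I2)
      fix t assume "t \<in> space (leb I)"
      then have t: "t \<in> I" by simp
      have "0 \<le> rearr I x t * a t" using rearr_nonneg[OF x(2) t] nonincr_nonneg[OF a(2) t] by simp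
      then show "\<bar>rearr I x t * a t\<bar> \<le> \<bar>?d t\<bar>" using xy[OF t] by (simp add: dil2_def)
    qed
    have "fnorm F (\<lambda>t. rearr I x t * a t) \<le> ennreal 2 * fnorm F (dil2 (dil2 ?p))"
      using is_ideal_norm_le[OF F(2) dF(1) m le] dF(2) by simp
    also have "\<dots> \<le> ennreal 2 * (ennreal D * (ennreal D * fnorm F ?p))"
      using order_trans[OF conjunct2[OF D2] mult_left_mono[OF conjunct2[OF D1] zero_le]]
      by (intro mult_left_mono) auto
    also have "\<dots> = ennreal (2 * D * D) * fnorm F ?p"
      using D(1) by (simp add: ennreal_mult mult.assoc)
    finally show ?thesis using is_ideal_elts[OF F(2) dF(1) m le] by simp
  qed
  then show ?thesis using yE yn by blast
qed

text \<open>A nonzero rearrangement b in E may vanish from some point on, so it cannot detect large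
  values of x on sets of large measure. H_r b has no zeros, and a nonincreasing positive minorant of
  it serves as g in \<open>rearr_finite_if_products\<close>.\<close>

lemma rearr_finite_multiplier:
  assumes E: "normed_space I E" "is_ideal I E"
    and nt: "nontrivial I (symmetrization I E)"
    and C: "\<And>a. a \<in> elts E \<Longrightarrow> nonincr I a \<Longrightarrow> dil2 a \<in> elts E \<and> fnorm E (dil2 a) \<le> ennreal C * fnorm E a"
    and r: "0 < r" "hardy_r_bounded_on_rearr I r E"
    and x: "x \<in> elts (multipliers I (symmetrization I E) (symmetrization I F))"
  shows "rearr_finite I x"
proof -
  obtain y0 where y0: "y0 \<in> elts (symmetrization I E)" "\<not> (AE t in leb I. y0 t = 0)"
    using nt unfolding nontrivial_def by blast
  define b where "b = rearr I y0"
  have y0': "y0 \<in> L0 I" "rearr_finite I y0" using y0(1) by (auto simp: symmetrization_elts)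
  note bn = rearr_nonincr[OF y0', folded b_def]
  obtain t0 where t0: "t0 \<in> I" "b t0 \<noteq> 0" using AE_zero_if_rearr_zero[OF y0'] y0(2) unfolding b_def by blast
  then have b0: "0 < b t0" using nonincr_nonneg[OF bn t0(1)] by simp
  have H: "hardy_r_defined I r b" "hardy_r r b \<in> elts E"
    using r(2) y0(1) unfolding hardy_r_bounded_on_rearr_def bounded_on_def b_def by auto
  \<comment> \<open>The bound of \<open>hardy_r_lower_bound\<close> with d = min(t0,t) and c =
    b(t0): constant up to t0, then decaying like t^(-1/r).\<close>
  define g where "g t = (min t0 t / t) powr (1/r) * b t0" for t
  have gp: "0 < g t" if "t \<in> I" for t
    using I_pos[OF that] I_pos[OF t0(1)] b0 by (simp add: g_def)
  have gn: "nonincr I g"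
    unfolding nonincr_def
  proof (intro conjI ballI impI)
    show "0 \<le> g t" if "t \<in> I" for t using gp[OF that] by simp
    fix s t assume st: "s \<in> I" "t \<in> I" "s \<le> t"
    have "min t0 t / t \<le> min t0 s / s"
      using st I_pos[OF st(1)] I_pos[OF st(2)] I_pos[OF t0(1)]
      by (auto simp: min_def field_simps)
    then show "g t \<le> g s" unfolding g_def
      using b0 r(1) I_pos[OF st(2)] I_pos[OF t0(1)] by (intro mult_right_mono powr_mono2) auto
  qed
  have "AE t in leb I. \<bar>g t\<bar> \<le> \<bar>hardy_r r b t\<bar>"
  proof (rule AE_I2)
    fix t assume "t \<in> space (leb I)"
    then have t: "t \<in> I" by simp
    have "(min t0 t / t) powr (1/r) * b t0 \<le> hardy_r r b t"
    proof (rule hardy_r_lower_bound[OF H(1) r(1) t])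
      fix s assume s: "0 < s" "s < min t0 t"
      then show "b t0 \<le> b s"
        using nonincr_le[OF bn I_down[OF t0(1)] t0(1)] by auto
    qed (use b0 I_pos[OF t] I_pos[OF t0(1)] in auto)
    then show "\<bar>g t\<bar> \<le> \<bar>hardy_r r b t\<bar>" using gp[OF t] by (simp add: g_def)
  qed
  then have gE: "g \<in> elts E" by (rule is_ideal_elts[OF E(2) H(2) nonincr_L0[OF gn]])
  have xm: "x \<in> L0 I" using x by (simp add: multipliers_elts)
  show ?thesis
  proof (rule rearr_finite_if_products[OF xm gn gp])
    fix y assume y: "y \<in> L0 I" "rearr_finite I y" "\<And>t. t \<in> I \<Longrightarrow> rearr I y t \<le> g (t / 2)"
    have "AE t in leb I. \<bar>rearr I y t\<bar> \<le> \<bar>dil2 g t\<bar>"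
    proof (rule AE_I2)
      fix t assume "t \<in> space (leb I)"
      then have t: "t \<in> I" by simp
      show "\<bar>rearr I y t\<bar> \<le> \<bar>dil2 g t\<bar>"
        using y(3)[OF t] rearr_nonneg[OF y(2) t] unfolding dil2_def by linarith
    qed
    then have "rearr I y \<in> elts E"
      using is_ideal_elts[OF E(2) conjunct1[OF C[OF gE gn]] nonincr_L0[OF rearr_nonincr[OF y(1,2)]]] by blast
    then have "y \<in> elts (symmetrization I E)" using y by (simp add: symmetrization_elts)
    then show "rearr_finite I (\<lambda>t. x t * y t)"
      using x by (simp add: multipliers_elts symmetrization_elts)
  qed
qed

text \<open>The supremum runs over norm exactly 1 and may be infinite at this stage. When y* has
  norm 0 the right side is 0 in \<open>ennreal\<close>, so that case goes through
  \<open>rearr_product_in\<close> instead of normalisation.\<close>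

lemma multiplier_norm_bound:
  assumes E: "normed_space I E" and F: "normed_space I F" "is_ideal I F"
    and D: "\<And>a. a \<in> elts F \<Longrightarrow> nonincr_rc I a \<Longrightarrow> dil2 a \<in> elts F \<and> fnorm F (dil2 a) \<le> ennreal D * fnorm F a"
    and x: "x \<in> elts (multipliers I (symmetrization I E) (symmetrization I F))" "rearr_finite I x"
    and y: "y \<in> elts (symmetrization I E)"
  shows "fnorm F (rearr I (\<lambda>t. x t * y t)) \<le>
    fnorm (multipliers I (symmetrization I E) (symmetrization I F)) x * fnorm E (rearr I y)"
proof (cases "fnorm E (rearr I y) = 0")
  case True
  have y': "y \<in> L0 I" "rearr_finite I y" "rearr I y \<in> elts E" using y by (auto simp: symmetrization_elts)
  have xm: "x \<in> L0 I" using x by (simp add: multipliers_elts)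
  have "AE t in leb I. rearr I y t = 0" using True normed_spaceD(6)[OF E y'(3)] by simp
  then have z: "AE t in leb I. rearr I x t * rearr I y t = 0" by eventually_elim simp
  then have ae: "AE t in leb I. \<bar>rearr I x t * rearr I y t\<bar> \<le> \<bar>0\<bar>" by eventually_elim simp
  have "(\<lambda>t. rearr I x t * rearr I y t) \<in> L0 I"
    by (intro nonincr_L0 nonincr_mult rearr_nonincr xm x(2) y')
  from is_ideal_elts[OF F(2) normed_spaceD(2)[OF F(1)] this ae]
  have q: "(\<lambda>t. rearr I x t * rearr I y t) \<in> elts F" .
  then have "fnorm F (\<lambda>t. rearr I x t * rearr I y t) = 0"
    using normed_spaceD(6)[OF F(1) q] z by blast
  then show ?thesis
    using rearr_product_in(2)[OF F(2) D xm x(2) y'(1,2) q] True by simp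
next
  case False
  have y': "y \<in> L0 I" "rearr_finite I y" "rearr I y \<in> elts E" using y by (auto simp: symmetrization_elts)
  have xm: "x \<in> L0 I" using x by (simp add: multipliers_elts)
  obtain c where c: "fnorm E (rearr I y) = ennreal c" "0 < c"
    using False normed_spaceD(5)[OF E y'(3)] by (cases "fnorm E (rearr I y)") (auto simp: less_le)
  have ic: "0 < 1 / c" using c by simp
  let ?u = "\<lambda>t. (1 / c) * y t"
  have um: "?u \<in> L0 I" using y'(1) by (simp add: L0_def)
  have uf: "rearr_finite I ?u" by (rule rearr_scale(1)[OF y'(1,2) ic])
  have uE: "(\<lambda>t. (1 / c) * rearr I y t) \<in> elts E" by (rule normed_spaceD(4)[OF E y'(3)])
  \<comment> \<open>Scaling of the rearrangement is known on \<open>I\<close> only; off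
    \<open>I\<close> the function \<open>rearr\<close> has no meaning. Equality is therefore passed
    on through invariance under almost everywhere equality.\<close>
  have "AE t in leb I. (1 / c) * rearr I y t = rearr I ?u t"
    using rearr_scale(2)[OF y'(1,2) ic] by (intro AE_I2) simp
  moreover have "\<And>x y. x \<in> elts E \<Longrightarrow> y \<in> L0 I \<Longrightarrow> AE t in leb I. x t = y t \<Longrightarrow> y \<in> elts E \<and> fnorm E y = fnorm E x"
    using E by (auto simp: normed_space_def quasi_normed_with_def)
  ultimately have u: "rearr I ?u \<in> elts E" "fnorm E (rearr I ?u) = fnorm E (\<lambda>t. (1 / c) * rearr I y t)"
    using uE nonincr_L0[OF rearr_nonincr[OF um uf]] by blast+
  have u1: "fnorm E (rearr I ?u) = 1"
    unfolding u(2) normed_spaceD(7)[OF E y'(3)] c(1) using c(2) by (simp flip: ennreal_mult)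
  have uS: "?u \<in> elts (symmetrization I E)" using um uf u by (simp add: symmetrization_elts)
  then have "fnorm F (rearr I (\<lambda>t. x t * ?u t)) \<le>
      fnorm (multipliers I (symmetrization I E) (symmetrization I F)) x"
    unfolding multipliers_norm symmetrization_norm using u1
    by (intro SUP_upper2[of ?u]) (auto simp: symmetrization_norm)
  then have "ennreal c * fnorm F (rearr I (\<lambda>t. x t * ?u t)) \<le>
      fnorm (multipliers I (symmetrization I E) (symmetrization I F)) x * fnorm E (rearr I y)"
    unfolding c(1) by (subst mult.commute) (rule mult_right_mono, auto)
  moreover have "ennreal c * fnorm F (rearr I (\<lambda>t. x t * ?u t)) = fnorm F (rearr I (\<lambda>t. x t * y t))"
  proof -
    have p: "(\<lambda>t. x t * ?u t) \<in> elts (symmetrization I F)"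
      by (rule bspec[OF conjunct2[OF x(1)[unfolded multipliers_elts]] uS])
    then have p': "(\<lambda>t. x t * ?u t) \<in> L0 I" "rearr_finite I (\<lambda>t. x t * ?u t)" "rearr I (\<lambda>t. x t * ?u t) \<in> elts F"
      by (auto simp: symmetrization_elts)
    have e: "(\<lambda>t. c * (x t * ?u t)) = (\<lambda>t. x t * y t)" using c(2) by auto
    have xy: "(\<lambda>t. x t * y t) \<in> elts (symmetrization I F)" using x(1) y by (simp add: multipliers_elts)
    have rm: "rearr I (\<lambda>t. x t * y t) \<in> L0 I"
      by (rule nonincr_L0[OF rearr_nonincr]) (use xy in \<open>simp_all add: symmetrization_elts\<close>)
    have "AE t in leb I. c * rearr I (\<lambda>t. x t * ?u t) t = rearr I (\<lambda>t. x t * y t) t"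
      using rearr_scale(2)[OF p'(1,2) c(2)] unfolding e by (intro AE_I2) simp
    moreover have "\<And>x y. x \<in> elts F \<Longrightarrow> y \<in> L0 I \<Longrightarrow> AE t in leb I. x t = y t \<Longrightarrow> y \<in> elts F \<and> fnorm F y = fnorm F x"
      using F(1) by (auto simp: normed_space_def quasi_normed_with_def)
    ultimately have "fnorm F (rearr I (\<lambda>t. x t * y t)) = fnorm F (\<lambda>t. c * rearr I (\<lambda>t. x t * ?u t) t)"
      using normed_spaceD(4)[OF F(1) p'(3)] rm by blast
    then show ?thesis using normed_spaceD(7)[OF F(1) p'(3), of c] c(2) by simp
  qed
  ultimately show ?thesis by simp
qed

theorem symmetrization_multipliers:
  assumes E: "normed_space I E" "is_ideal I E" "complete_space E"
    and F: "normed_space I F" "is_ideal I F" "fatou_property I F"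
    and nt: "nontrivial I (symmetrization I E)" and dF: "dil2_bounded I F"
    and H: "cohardy_bounded I (product_space I E (koethe_dual I F))"
    and r: "0 < r" "cohardy_r_bounded I r E" "cohardy_r_bounded I r (koethe_dual I F)"
      "hardy_r_bounded_on_rearr I r E" "hardy_r_bounded_on_rearr I r (koethe_dual I F)"
  shows "equal_spaces
           (multipliers I (symmetrization I E) (symmetrization I F))
           (symmetrization I (multipliers I E F))"
proof -
  let ?A = "multipliers I (symmetrization I E) (symmetrization I F)"
  let ?B = "symmetrization I (multipliers I E F)"
  obtain D where D: "0 < D" "\<And>a. a \<in> elts F \<Longrightarrow> nonincr_rc I a \<Longrightarrow>
      dil2 a \<in> elts F \<and> fnorm F (dil2 a) \<le> ennreal D * fnorm F a"
    by (rule dil2_bounded_nonincr_rc[OF dF]) blast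
  obtain C where C: "0 < C" "\<And>a. a \<in> elts E \<Longrightarrow> nonincr I a \<Longrightarrow>
      dil2 a \<in> elts E \<and> fnorm E (dil2 a) \<le> ennreal C * fnorm E a"
    using dil2_bounded_via_hardy_r[OF E(2) normed_space_homogeneous[OF E(1)] r(1,4)] by blast
  obtain L where L: "0 < L" "\<And>w K y. nonincr I w \<Longrightarrow> 0 < K \<Longrightarrow>
    (\<And>a. a \<in> elts E \<Longrightarrow> nonincr I a \<Longrightarrow> (\<lambda>t. w t * a t) \<in> elts F \<and> fnorm F (\<lambda>t. w t * a t) \<le> ennreal K * fnorm E a) \<Longrightarrow>
    y \<in> elts E \<Longrightarrow> (\<lambda>t. w t * y t) \<in> elts F \<and> fnorm F (\<lambda>t. w t * y t) \<le> ennreal (L * K) * fnorm E y"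
  proof -
    assume *: "\<And>L. 0 < L \<Longrightarrow> (\<And>w K y. nonincr I w \<Longrightarrow> 0 < K \<Longrightarrow>
    (\<And>a. a \<in> elts E \<Longrightarrow> nonincr I a \<Longrightarrow> (\<lambda>t. w t * a t) \<in> elts F \<and> fnorm F (\<lambda>t. w t * a t) \<le> ennreal K * fnorm E a) \<Longrightarrow>
    y \<in> elts E \<Longrightarrow> (\<lambda>t. w t * y t) \<in> elts F \<and> fnorm F (\<lambda>t. w t * y t) \<le> ennreal (L * K) * fnorm E y) \<Longrightarrow> thesis"
    obtain L where L: "0 < L" "\<forall>w K. nonincr I w \<longrightarrow> 0 < K \<longrightarrow>
    (\<forall>a\<in>elts E. nonincr I a \<longrightarrow> (\<lambda>t. w t * a t) \<in> elts F \<and> fnorm F (\<lambda>t. w t * a t) \<le> ennreal K * fnorm E a) \<longrightarrow>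
    (\<forall>y\<in>elts E. (\<lambda>t. w t * y t) \<in> elts F \<and> fnorm F (\<lambda>t. w t * y t) \<le> ennreal (L * K) * fnorm E y)"
      using multiplier_bound_from_nonincr[OF E(1,2) F H r] by blast
    show thesis by (rule *[OF L(1)]) (use L(2) in blast)
  qed
  have BA: "x \<in> elts ?A" "fnorm ?A x \<le> ennreal D * fnorm ?B x" if x: "x \<in> elts ?B" for x
  proof -
    have x': "x \<in> L0 I" "rearr_finite I x" "\<And>y. y \<in> elts E \<Longrightarrow> (\<lambda>t. rearr I x t * y t) \<in> elts F"
      using x by (auto simp: symmetrization_elts multipliers_elts)
    have *: "(\<lambda>t. x t * y t) \<in> elts (symmetrization I F)"
      "fnorm F (rearr I (\<lambda>t. x t * y t)) \<le> ennreal D * fnorm F (\<lambda>t. rearr I x t * rearr I y t)"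
      if "y \<in> elts (symmetrization I E)" for y
      using rearr_product_in[OF F(2) D(2) x'(1,2), of y] that x'(3) by (auto simp: symmetrization_elts)
    show "x \<in> elts ?A" using x'(1) *(1) by (simp add: multipliers_elts)
    show "fnorm ?A x \<le> ennreal D * fnorm ?B x"
      unfolding multipliers_norm[of I "symmetrization I E"]
    proof (rule SUP_least, clarify)
      fix y assume y: "y \<in> elts (symmetrization I E)" "fnorm (symmetrization I E) y = 1"
      have "fnorm F (\<lambda>t. rearr I x t * rearr I y t) \<le> fnorm ?B x"
        unfolding symmetrization_norm multipliers_norm
        using y by (intro SUP_upper2[of "rearr I y"]) (auto simp: symmetrization_elts symmetrization_norm)
      then show "fnorm (symmetrization I F) (\<lambda>t. x t * y t) \<le> ennreal D * fnorm ?B x"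
        unfolding symmetrization_norm using *(2)[OF y(1)] by (meson mult_left_mono order_trans zero_le)
    qed
  qed
  have cone: "\<exists>y\<in>elts (symmetrization I E). fnorm E (rearr I y) \<le> ennreal C * fnorm E a \<and>
      (\<lambda>t. rearr I x t * a t) \<in> elts F \<and>
      fnorm F (\<lambda>t. rearr I x t * a t) \<le> ennreal (2 * D * D) * fnorm F (rearr I (\<lambda>t. x t * y t))"
    if "x \<in> elts ?A" "rearr_finite I x" "a \<in> elts E" "nonincr I a" for x a
    using rearr_times_nonincr[OF E(2) C(2) F(1,2) D _ that(2-4)] that(1)
    by (auto simp: multipliers_elts)
  have AB: "x \<in> elts ?B" "fnorm ?B x < \<infinity>" if x: "x \<in> elts ?A" for x
  proof -
    have xm: "x \<in> L0 I" using x by (simp add: multipliers_elts)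
    have fin: "rearr_finite I x" by (rule rearr_finite_multiplier[OF E(1,2) nt C(2) r(1,4) x])
    have n: "nonincr I (rearr I x)" by (rule rearr_nonincr[OF xm fin])
    have in_F: "(\<lambda>t. rearr I x t * a t) \<in> elts F" if "a \<in> elts E" "nonincr I a" for a
      using cone[OF x fin that] by blast
    \<comment> \<open>This K comes from the gliding hump and depends on x without control: it gives
      membership and a finite norm, not yet a norm comparison.\<close>
    obtain K where K: "0 < K" "\<And>a. a \<in> elts E \<Longrightarrow> nonincr I a \<Longrightarrow>
        fnorm F (\<lambda>t. rearr I x t * a t) \<le> ennreal K * fnorm E a"
      using multiplier_bounded_on_nonincr[OF E F(1,2) in_F] by blast
    have b: "(\<lambda>t. rearr I x t * y t) \<in> elts F \<and>
        fnorm F (\<lambda>t. rearr I x t * y t) \<le> ennreal (L * K) * fnorm E y" if "y \<in> elts E" for y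
      by (rule L(2)[OF n K(1) _ that]) (use in_F K(2) in blast)
    then show "x \<in> elts ?B" using xm fin nonincr_L0[OF n] by (simp add: symmetrization_elts multipliers_elts)
    have "fnorm ?B x \<le> ennreal (L * K)"
      unfolding symmetrization_norm multipliers_norm
    proof (rule SUP_least, clarify)
      fix y assume "y \<in> elts E" "fnorm E y = 1"
      then show "fnorm F (\<lambda>t. rearr I x t * y t) \<le> ennreal (L * K)" using b[of y] by simp
    qed
    then show "fnorm ?B x < \<infinity>" by (simp add: order_le_less_trans[OF _ ennreal_less_top])
  qed
  \<comment> \<open>2 D D is the cost of passing from (x y)* to x* a, and C that of bounding the
    norm of y* by that of a.\<close>
  define Q where "Q = 2 * D * D * C"
  have Q: "0 < Q" using C(1) D(1) by (simp add: Q_def)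
  have Afin: "fnorm ?A x < \<infinity>" if x: "x \<in> elts ?A" for x
    using BA(2)[OF AB(1)[OF x]] AB(2)[OF x] by (auto simp: ennreal_mult_less_top intro: order_le_less_trans)
  have BA_norm: "fnorm ?B x \<le> ennreal (L * Q) * fnorm ?A x" if x: "x \<in> elts ?A" for x
  proof -
    have xm: "x \<in> L0 I" using x by (simp add: multipliers_elts)
    have fin: "rearr_finite I x" using AB(1)[OF x] by (simp add: symmetrization_elts)
    obtain N where N: "fnorm ?A x = ennreal N" "0 \<le> N"
      using Afin[OF x] by (cases "fnorm ?A x") auto
    \<comment> \<open>The bound K must be positive while N may be 0; the slack e is removed
      below.\<close>
    have eps: "fnorm ?B x \<le> ennreal (L * (Q * (N + e)))" if e: "0 < e" for e
      unfolding symmetrization_norm multipliers_norm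
    proof (rule SUP_least, clarify)
      fix y assume y: "y \<in> elts E" "fnorm E y = 1"
      have "(\<lambda>t. rearr I x t * y t) \<in> elts F \<and>
          fnorm F (\<lambda>t. rearr I x t * y t) \<le> ennreal (L * (Q * (N + e))) * fnorm E y"
      proof (rule L(2)[OF rearr_nonincr[OF xm fin] _ _ y(1)])
        show "0 < Q * (N + e)" using Q N e by simp
        fix a assume a: "a \<in> elts E" "nonincr I a"
        obtain u where u: "u \<in> elts (symmetrization I E)" "fnorm E (rearr I u) \<le> ennreal C * fnorm E a"
          "(\<lambda>t. rearr I x t * a t) \<in> elts F"
          "fnorm F (\<lambda>t. rearr I x t * a t) \<le> ennreal (2 * D * D) * fnorm F (rearr I (\<lambda>t. x t * u t))"
          using cone[OF x fin a] by blast
        note u(4)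
        also have "ennreal (2 * D * D) * fnorm F (rearr I (\<lambda>t. x t * u t)) \<le>
            ennreal (2 * D * D) * (ennreal N * fnorm E (rearr I u))"
          using multiplier_norm_bound[OF E(1) F(1,2) D(2) x fin u(1)] unfolding N(1)
          by (intro mult_left_mono) auto
        also have "\<dots> \<le> ennreal (2 * D * D) * (ennreal (N + e) * (ennreal C * fnorm E a))"
          using u(2) e by (intro mult_left_mono mult_mono ennreal_leI) auto
        also have "\<dots> = ennreal (Q * (N + e)) * fnorm E a"
          using C(1) D(1) N(2) e by (simp add: Q_def ennreal_mult ac_simps)
        finally show "(\<lambda>t. rearr I x t * a t) \<in> elts F \<and>
            fnorm F (\<lambda>t. rearr I x t * a t) \<le> ennreal (Q * (N + e)) * fnorm E a" using u(3) by simp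
      qed
      then show "fnorm F (\<lambda>t. rearr I x t * y t) \<le> ennreal (L * (Q * (N + e)))" using y(2) by simp
    qed
    have "fnorm ?B x \<le> ennreal (L * Q * N)"
    proof (rule ennreal_le_epsilon)
      fix e :: real assume e: "0 < e"
      have "fnorm ?B x \<le> ennreal (L * (Q * (N + e / (L * Q))))"
        using L(1) Q e by (intro eps) simp
      also have "L * (Q * (N + e / (L * Q))) = L * Q * N + e"
        using L(1) Q by (simp add: field_simps)
      also have "ennreal \<dots> = ennreal (L * Q * N) + ennreal e"
        using L(1) Q N(2) e by simp
      finally show "fnorm ?B x \<le> ennreal (L * Q * N) + ennreal e" .
    qed
    also have "\<dots> = ennreal (L * Q) * fnorm ?A x"
      unfolding N(1) using L(1) Q N(2) by (simp add: ennreal_mult)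
    finally show ?thesis .
  qed
  have lower: "ennreal (1 / D) * fnorm ?A x \<le> fnorm ?B x" if x: "x \<in> elts ?A" for x
  proof -
    have "ennreal (1 / D) * fnorm ?A x \<le> ennreal (1 / D) * (ennreal D * fnorm ?B x)"
      using BA(2)[OF AB(1)[OF x]] by (intro mult_left_mono) auto
    also have "\<dots> = fnorm ?B x" using D(1) by (simp flip: mult.assoc ennreal_mult)
    finally show ?thesis .
  qed
  show ?thesis
    unfolding equal_spaces_def
  proof (intro conjI)
    show "elts ?A = elts ?B" using AB(1) BA(1) by blast
    show "\<forall>x\<in>elts ?A. fnorm ?A x < \<infinity> \<and> fnorm ?B x < \<infinity>" using AB(2) Afin by blast
    have "0 < 1 / D" "0 < L * Q" using D(1) L(1) Q by simp_all
    then show "\<exists>c C. 0 < c \<and> 0 < C \<and> (\<forall>x\<in>elts ?A. ennreal c * fnorm ?A x \<le> fnorm ?B x \<and>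
        fnorm ?B x \<le> ennreal C * fnorm ?A x)"
      using lower BA_norm by blast
  qed
qed

end

theorem theorem3:
  fixes I :: "real set" and E F :: fspace
  assumes "I = {0<..<1} \<or> I = {0<..}"
    and "banach_ideal_space I E"
    and "banach_ideal_space I F"
    and "fatou_property I F"
    and "nontrivial I (symmetrization I E)" and "normable I (symmetrization I E)"
    and "nontrivial I (symmetrization I F)" and "normable I (symmetrization I F)"
    and "dil2_bounded I F"
    and "nontrivial I (symmetrization I (koethe_dual I F))"
    and "nontrivial I (symmetrization I (koethe_dual I (product_space I E (koethe_dual I F))))"
    and "cohardy_bounded I F"
    and "cohardy_bounded I (product_space I E (koethe_dual I F))"
    and "\<exists>r>0. cohardy_r_bounded I r E \<and> cohardy_r_bounded I r (koethe_dual I F) \<and>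
           hardy_r_bounded_on_rearr I r E \<and> hardy_r_bounded_on_rearr I r (koethe_dual I F)"
  shows "equal_spaces
           (multipliers I (symmetrization I E) (symmetrization I F))
           (symmetrization I (multipliers I E F))"
proof -
  interpret half_interval I by unfold_locales (rule assms(1))
  obtain r where "0 < r" "cohardy_r_bounded I r E" "cohardy_r_bounded I r (koethe_dual I F)"
    "hardy_r_bounded_on_rearr I r E" "hardy_r_bounded_on_rearr I r (koethe_dual I F)"
    using assms(14) by blast
  then show ?thesis
    using assms(2-5,9,13) unfolding banach_ideal_space_def
    by (intro symmetrization_multipliers) auto
qed

end
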